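(* Let $\Omega\subset\mathbb{R}^n$ be a bounded open domain with $\partial\Omega\in C^2$, let $\Gamma$ be an open subset of $\partial\Omega$, and let $A$, $a_0$, $k$ be as in the context. Let $\Gamma$ be non-empty. Then there is a constant $C$ such that $$\|u\|_{(0)}(\Omega)\leq C\Big(\|u\|_{(0)}(\Gamma)+k^{-1}\big(\|f\|_{(0)}(\Omega)+\|u_0\|_{(1)}(\Gamma)+\|u_1\|_{(0)}(\Gamma)+\|u\|_{(1)}(\Omega)\big)\Big)$$ for all $u\in H^{(2)}(\Omega)$ solving the Cauchy problem $$(A-ia_0k+k^2)u=f \ \text{ in } \Omega,\qquad u=u_0,\ \partial_\nu u=u_1\ \text{ on } \Gamma .$$ Moreover, if in addition $\Omega$ is $C^2$-diffeomorphic to the unit ball, then there are a monotone family of closed subspaces $H^{(1)}(\Omega;k)$ of $H^{(1)}(\Omega)$ with $\overline{\bigcup_k H^{(1)}(\Omega;k)}=H^{(1)}(\Omega)$, a semi-norm $|||\cdot|||_{(1;k)}(\Omega)$ on $H^{(1)}(\Omega)$ which is zero on $H^{(1)}(\Omega;k)$ and decreasing with respect to $k$, and a constant $C$ such that $$\|u\|_{(0)}(\Omega)\leq C\Big(\|u\|_{(0)}(\Gamma)+k^{-1}\big(\|f\|_{(0)}(\Omega)+\|u_0\|_{(1)}(\Gamma)+\|u_1\|_{(0)}(\Gamma)+|||u|||_{(1;k)}(\Omega)\big)\Big)$$ for all $u\in H^{(2)}(\Omega)$ solving the same Cauchy problem.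
   Context: $A$ is the general second order partial differential operator $Au=\sum_{j,m=1}^n a_{jm}\partial_j\partial_m u+\sum_{j=1}^n a_j\partial_j u+au$ on $\Omega$, with symmetric $(a_{jm})$, satisfying the uniform ellipticity condition $\varepsilon_0|\xi|^2\le\sum_{j,l=1}^n a_{jl}(x)\xi_j\xi_l\le E_0^2|\xi|^2$ for some positive numbers $\varepsilon_0,E_0$ and all $x\in\Omega$, $\xi\in\mathbb{R}^n$. It is assumed that $a_{jm},\partial_p a_{jm},a_j,a\in L^\infty(\Omega)$. $a_0$ is the given coefficient in the term $-ia_0k$ of the equation, and $k$ is the wave number. $H^{(l)}(\Omega)$ is the classical ($L^2$-based) Sobolev space of order $l$ with standard norm $\|\cdot\|_{(l)}(\Omega)$ (so $\|\cdot\|_{(0)}$ is the $L^2$ norm), and similarly $\|\cdot\|_{(l)}(\Gamma)$ on $\Gamma$; $\partial_\nu$ is the normal derivative on $\partial\Omega$. The constants $C$ depend only on $\Omega,\Gamma,A,a_0$ (in particular not on $k$). The subspaces $H^{(1)}(\Omega;k)$ grow with $k$; the closure is taken in $H^{(1)}(\Omega)$. *)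

theory Defs
  imports "HOL-Analysis.Analysis"
begin

section \<open>Classical differentiability\<close>

definition partial_deriv :: "'n \<Rightarrow> (real^'n \<Rightarrow> 'b) \<Rightarrow> real^'n \<Rightarrow> 'b::real_normed_vector" where
  "partial_deriv j f x = frechet_derivative f (at x) (axis j 1)"

primrec Ck_on :: "nat \<Rightarrow> (real^'n) set \<Rightarrow> (real^'n \<Rightarrow> 'b::real_normed_vector) \<Rightarrow> bool" where
  "Ck_on 0 U f = continuous_on U f"
| "Ck_on (Suc k) U f = ((\<forall>x\<in>U. f differentiable (at x)) \<and> (\<forall>j. Ck_on k U (partial_deriv j f)))"

definition smooth_fun :: "(real^'n \<Rightarrow> 'b::real_normed_vector) \<Rightarrow> bool" where
  "smooth_fun f \<longleftrightarrow> (\<forall>k. Ck_on k UNIV f)"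

text \<open>The \<open>C\<^sup>2\<close>-diffeomorphism is between the open sets; no regularity up to the boundary
  is asked for.\<close>

definition C2_diffeomorphic :: "(real^'n) set \<Rightarrow> (real^'n) set \<Rightarrow> bool" where
  "C2_diffeomorphic S T \<longleftrightarrow>
     (\<exists>\<Phi> \<Psi>. homeomorphism S T \<Phi> \<Psi> \<and> Ck_on 2 S \<Phi> \<and> Ck_on 2 T \<Psi>)"


section \<open>Domains with \<open>C\<^sup>2\<close> boundary\<close>

text \<open>Near each boundary point, after relabelling and reorienting the axes, \<open>\<Omega>\<close> is the region
  on one side of the graph of a \<open>C\<^sup>2\<close> function of the remaining \<open>n - 1\<close> coordinates.  Such a
  function is encoded as a function on \<open>\<real>\<^sup>n\<close> that does not depend on the \<open>j\<close>-th coordinate.\<close>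

definition C2_boundary :: "(real^'n) set \<Rightarrow> bool" where
  "C2_boundary \<Omega> \<longleftrightarrow>
     (\<forall>x0 \<in> frontier \<Omega>. \<exists>r>0. \<exists>j. \<exists>s\<in>{1,-1}. \<exists>\<gamma>::real^'n \<Rightarrow> real.
        Ck_on 2 UNIV \<gamma> \<and> (\<forall>x t. \<gamma> (x + t *\<^sub>R axis j 1) = \<gamma> x) \<and>
        \<Omega> \<inter> ball x0 r = {x \<in> ball x0 r. \<gamma> x < s * x $ j})"

text \<open>The unit outer normal, computed from an arbitrary local defining function of \<open>\<Omega>\<close>.\<close>

definition outer_normal :: "(real^'n) set \<Rightarrow> real^'n \<Rightarrow> real^'n" where
  "outer_normal \<Omega> x =
     (THE v. \<exists>U \<rho> g. open U \<and> x \<in> U \<and> Ck_on 1 U (\<rho>::real^'n \<Rightarrow> real) \<and>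
        \<Omega> \<inter> U = {y \<in> U. \<rho> y < 0} \<and>
        g = (\<chi> j. partial_deriv j \<rho> x) \<and> g \<noteq> 0 \<and> v = g /\<^sub>R norm g)"


section \<open>Surface measure\<close>

text \<open>The normalisation makes the \<open>d\<close>-dimensional Hausdorff measure agree with the Euclidean
  surface measure on \<open>d\<close>-dimensional \<open>C\<^sup>1\<close> submanifolds.  The empty set is given size 0
  separately because \<open>0 ^ 0 = 1\<close>, and only bounded covering sets are allowed because
  \<^const>\<open>diameter\<close> carries no information about unbounded sets.  The outer measure is a
  metric outer measure, hence countably additive on the Borel sets by Caratheodory's criterion,
  so \<^const>\<open>measure_of\<close> does not fall back to the zero measure.\<close>

definition hausdorff_size :: "nat \<Rightarrow> 'a::euclidean_space set \<Rightarrow> ennreal" where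
  "hausdorff_size d S =
     (if S = {} then 0 else ennreal (unit_ball_vol (real d) * (diameter S / 2) ^ d))"

definition hausdorff_pre :: "nat \<Rightarrow> real \<Rightarrow> 'a::euclidean_space set \<Rightarrow> ennreal" where
  "hausdorff_pre d \<delta> E =
     (INF F \<in> {F :: nat \<Rightarrow> 'a set. E \<subseteq> (\<Union>i. F i) \<and> (\<forall>i. bounded (F i) \<and> diameter (F i) \<le> \<delta>)}.
        (\<Sum>i. hausdorff_size d (F i)))"

definition hausdorff_outer :: "nat \<Rightarrow> 'a::euclidean_space set \<Rightarrow> ennreal" where
  "hausdorff_outer d E = (SUP \<delta> \<in> {0<..}. hausdorff_pre d \<delta> E)"

definition hausdorff_measure :: "nat \<Rightarrow> 'a::euclidean_space measure" where
  "hausdorff_measure d = measure_of UNIV (sets borel) (hausdorff_outer d)"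

definition surface_measure :: "(real^'n) set \<Rightarrow> (real^'n) measure" where
  "surface_measure S = completion (restrict_space (hausdorff_measure (CARD('n) - 1)) S)"


section \<open>Lebesgue and Sobolev spaces on a domain\<close>

definition L2 :: "'a measure \<Rightarrow> ('a \<Rightarrow> complex) set" where
  "L2 M = {u \<in> borel_measurable M. integrable M (\<lambda>x. (norm (u x))\<^sup>2)}"

definition L2_norm :: "'a measure \<Rightarrow> ('a \<Rightarrow> complex) \<Rightarrow> real" where
  "L2_norm M u = sqrt (\<integral>x. (norm (u x))\<^sup>2 \<partial>M)"

definition Linf :: "'a measure \<Rightarrow> ('a \<Rightarrow> 'b::real_normed_vector) set" where
  "Linf M = {u \<in> borel_measurable M. \<exists>B. AE x in M. norm (u x) \<le> B}"

definition loc_integrable :: "(real^'n) set \<Rightarrow> (real^'n \<Rightarrow> 'b::euclidean_space) \<Rightarrow> bool" where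
  "loc_integrable \<Omega> u \<longleftrightarrow> (\<forall>K. compact K \<and> K \<subseteq> \<Omega> \<longrightarrow> integrable (lebesgue_on K) u)"

definition test_fun :: "(real^'n) set \<Rightarrow> (real^'n \<Rightarrow> real) \<Rightarrow> bool" where
  "test_fun \<Omega> \<phi> \<longleftrightarrow> smooth_fun \<phi> \<and> (\<exists>K. compact K \<and> K \<subseteq> \<Omega> \<and> (\<forall>x. x \<notin> K \<longrightarrow> \<phi> x = 0))"

definition has_weak_partial ::
    "(real^'n) set \<Rightarrow> 'n \<Rightarrow> (real^'n \<Rightarrow> 'b::euclidean_space) \<Rightarrow> (real^'n \<Rightarrow> 'b) \<Rightarrow> bool" where
  "has_weak_partial \<Omega> j u v \<longleftrightarrow> loc_integrable \<Omega> u \<and> loc_integrable \<Omega> v \<and>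
     (\<forall>\<phi>. test_fun \<Omega> \<phi> \<longrightarrow>
        (\<integral>x. partial_deriv j \<phi> x *\<^sub>R u x \<partial>lebesgue_on \<Omega>) =
        - (\<integral>x. \<phi> x *\<^sub>R v x \<partial>lebesgue_on \<Omega>))"

text \<open>Determined up to null sets whenever a weak derivative exists.\<close>

definition weak_partial ::
    "(real^'n) set \<Rightarrow> 'n \<Rightarrow> (real^'n \<Rightarrow> 'b::euclidean_space) \<Rightarrow> real^'n \<Rightarrow> 'b" where
  "weak_partial \<Omega> j u = (SOME v. has_weak_partial \<Omega> j u v)"

text \<open>Elements of the Sobolev spaces are functions, not classes modulo null sets; their values
  outside \<open>\<Omega>\<close> are irrelevant.\<close>

primrec sobolev :: "nat \<Rightarrow> (real^'n) set \<Rightarrow> (real^'n \<Rightarrow> complex) set" where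
  "sobolev 0 \<Omega> = L2 (lebesgue_on \<Omega>)"
| "sobolev (Suc l) \<Omega> =
     {u \<in> L2 (lebesgue_on \<Omega>). \<forall>j. \<exists>v \<in> sobolev l \<Omega>. has_weak_partial \<Omega> j u v}"

abbreviation norm0 :: "(real^'n) set \<Rightarrow> (real^'n \<Rightarrow> complex) \<Rightarrow> real" where
  "norm0 \<Omega> u \<equiv> L2_norm (lebesgue_on \<Omega>) u"

definition norm1 :: "(real^'n) set \<Rightarrow> (real^'n \<Rightarrow> complex) \<Rightarrow> real" where
  "norm1 \<Omega> u = sqrt ((norm0 \<Omega> u)\<^sup>2 + (\<Sum>j\<in>UNIV. (norm0 \<Omega> (weak_partial \<Omega> j u))\<^sup>2))"

definition closure1 :: "(real^'n) set \<Rightarrow> (real^'n \<Rightarrow> complex) set \<Rightarrow> (real^'n \<Rightarrow> complex) set" where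
  "closure1 \<Omega> V = {u \<in> sobolev 1 \<Omega>. \<forall>\<epsilon>>0. \<exists>v\<in>V. norm1 \<Omega> (\<lambda>x. u x - v x) < \<epsilon>}"

definition closed_subspace1 :: "(real^'n) set \<Rightarrow> (real^'n \<Rightarrow> complex) set \<Rightarrow> bool" where
  "closed_subspace1 \<Omega> V \<longleftrightarrow> V \<subseteq> sobolev 1 \<Omega> \<and> (\<lambda>x. 0) \<in> V \<and>
     (\<forall>u\<in>V. \<forall>v\<in>V. (\<lambda>x. u x + v x) \<in> V) \<and> (\<forall>c. \<forall>u\<in>V. (\<lambda>x. c * u x) \<in> V) \<and>
     closure1 \<Omega> V = V"

definition seminorm1 :: "(real^'n) set \<Rightarrow> ((real^'n \<Rightarrow> complex) \<Rightarrow> real) \<Rightarrow> bool" where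
  "seminorm1 \<Omega> p \<longleftrightarrow>
     (\<forall>u \<in> sobolev 1 \<Omega>. 0 \<le> p u) \<and>
     (\<forall>u \<in> sobolev 1 \<Omega>. \<forall>v \<in> sobolev 1 \<Omega>. p (\<lambda>x. u x + v x) \<le> p u + p v) \<and>
     (\<forall>c. \<forall>u \<in> sobolev 1 \<Omega>. p (\<lambda>x. c * u x) = norm c * p u)"


section \<open>Traces and Sobolev norms on the boundary\<close>

text \<open>The trace operator is the continuous extension of the restriction map from functions smooth
  up to the boundary, which are dense in \<open>H\<^sup>1\<close> of a bounded \<open>C\<^sup>2\<close> domain.\<close>

definition has_trace ::
    "(real^'n) set \<Rightarrow> (real^'n \<Rightarrow> complex) \<Rightarrow> (real^'n \<Rightarrow> complex) \<Rightarrow> bool" where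
  "has_trace \<Omega> u g \<longleftrightarrow> g \<in> L2 (surface_measure (frontier \<Omega>)) \<and>
     (\<exists>\<phi>::nat \<Rightarrow> real^'n \<Rightarrow> complex. (\<forall>m. smooth_fun (\<phi> m)) \<and>
        (\<lambda>m. norm1 \<Omega> (\<lambda>x. \<phi> m x - u x)) \<longlonglongrightarrow> 0 \<and>
        (\<lambda>m. L2_norm (surface_measure (frontier \<Omega>)) (\<lambda>x. \<phi> m x - g x)) \<longlonglongrightarrow> 0)"

definition bdry_trace :: "(real^'n) set \<Rightarrow> (real^'n \<Rightarrow> complex) \<Rightarrow> real^'n \<Rightarrow> complex" where
  "bdry_trace \<Omega> u = (SOME g. has_trace \<Omega> u g)"

definition normal_deriv :: "(real^'n) set \<Rightarrow> (real^'n \<Rightarrow> complex) \<Rightarrow> real^'n \<Rightarrow> complex" where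
  "normal_deriv \<Omega> u x =
     (\<Sum>j\<in>UNIV. of_real (outer_normal \<Omega> x $ j) * bdry_trace \<Omega> (weak_partial \<Omega> j u) x)"

abbreviation bdry_norm0 :: "(real^'n) set \<Rightarrow> (real^'n \<Rightarrow> complex) \<Rightarrow> real" where
  "bdry_norm0 \<Gamma> v \<equiv> L2_norm (surface_measure \<Gamma>) v"

text \<open>The weak tangential gradient \<open>w\<close> of \<open>v\<close> on a relatively open subset \<open>\<Gamma>\<close> of the boundary.
  The vector fields \<open>\<nu>\<^sub>i \<partial>\<^sub>j - \<nu>\<^sub>j \<partial>\<^sub>i\<close> are tangential, span the tangent space, and are
  skew-symmetric with respect to surface measure; for \<open>v\<close> of class \<open>C\<^sup>1\<close> they act on \<open>v\<close> as
  \<open>\<nu>\<^sub>i w\<^sub>j - \<nu>\<^sub>j w\<^sub>i\<close> with \<open>w = \<nabla>v - (\<nu> \<bullet> \<nabla>v) \<nu>\<close>.\<close>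

definition has_weak_surface_grad ::
    "(real^'n) set \<Rightarrow> (real^'n) set \<Rightarrow> (real^'n \<Rightarrow> complex) \<Rightarrow> ('n \<Rightarrow> real^'n \<Rightarrow> complex) \<Rightarrow> bool"
  where
  "has_weak_surface_grad \<Omega> \<Gamma> v w \<longleftrightarrow>
     (let \<nu> = (\<lambda>i x. outer_normal \<Omega> x $ i) in
      v \<in> L2 (surface_measure \<Gamma>) \<and> (\<forall>i. w i \<in> L2 (surface_measure \<Gamma>)) \<and>
      (AE x in surface_measure \<Gamma>. (\<Sum>i\<in>UNIV. of_real (\<nu> i x) * w i x) = 0) \<and>
      (\<forall>\<phi> i j. test_fun (- (frontier \<Omega> - \<Gamma>)) \<phi> \<longrightarrow>
         (\<integral>x. (\<nu> i x * partial_deriv j \<phi> x - \<nu> j x * partial_deriv i \<phi> x) *\<^sub>R v x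
            \<partial>surface_measure \<Gamma>) =
         - (\<integral>x. \<phi> x *\<^sub>R (of_real (\<nu> i x) * w j x - of_real (\<nu> j x) * w i x)
            \<partial>surface_measure \<Gamma>)))"

definition weak_surface_grad ::
    "(real^'n) set \<Rightarrow> (real^'n) set \<Rightarrow> (real^'n \<Rightarrow> complex) \<Rightarrow> 'n \<Rightarrow> real^'n \<Rightarrow> complex" where
  "weak_surface_grad \<Omega> \<Gamma> v = (SOME w. has_weak_surface_grad \<Omega> \<Gamma> v w)"

text \<open>Traces of \<open>H\<^sup>2\<close> functions have a weak surface gradient in \<open>L\<^sup>2\<close>, so this is the
  \<open>H\<^sup>1(\<Gamma>)\<close> norm for them.\<close>

definition bdry_norm1 :: "(real^'n) set \<Rightarrow> (real^'n) set \<Rightarrow> (real^'n \<Rightarrow> complex) \<Rightarrow> real" where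
  "bdry_norm1 \<Omega> \<Gamma> v =
     sqrt ((bdry_norm0 \<Gamma> v)\<^sup>2 + (\<Sum>i\<in>UNIV. (bdry_norm0 \<Gamma> (weak_surface_grad \<Omega> \<Gamma> v i))\<^sup>2))"


section \<open>The operator and the Cauchy problem\<close>

definition op_A ::
    "(real^'n) set \<Rightarrow> ('n \<Rightarrow> 'n \<Rightarrow> real^'n \<Rightarrow> real) \<Rightarrow> ('n \<Rightarrow> real^'n \<Rightarrow> complex) \<Rightarrow>
     (real^'n \<Rightarrow> complex) \<Rightarrow> (real^'n \<Rightarrow> complex) \<Rightarrow> real^'n \<Rightarrow> complex" where
  "op_A \<Omega> a2 a1 a u x =
     (\<Sum>j\<in>UNIV. \<Sum>m\<in>UNIV. of_real (a2 j m x) * weak_partial \<Omega> j (weak_partial \<Omega> m u) x) +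
     (\<Sum>j\<in>UNIV. a1 j x * weak_partial \<Omega> j u x) + a x * u x"

definition cauchy_problem ::
    "(real^'n) set \<Rightarrow> (real^'n) set \<Rightarrow> ('n \<Rightarrow> 'n \<Rightarrow> real^'n \<Rightarrow> real) \<Rightarrow>
     ('n \<Rightarrow> real^'n \<Rightarrow> complex) \<Rightarrow> (real^'n \<Rightarrow> complex) \<Rightarrow> (real^'n \<Rightarrow> complex) \<Rightarrow> real \<Rightarrow>
     (real^'n \<Rightarrow> complex) \<Rightarrow> (real^'n \<Rightarrow> complex) \<Rightarrow> (real^'n \<Rightarrow> complex) \<Rightarrow>
     (real^'n \<Rightarrow> complex) \<Rightarrow> bool" where
  "cauchy_problem \<Omega> \<Gamma> a2 a1 a a0 k f u0 u1 u \<longleftrightarrow>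
     (AE x in lebesgue_on \<Omega>.
        op_A \<Omega> a2 a1 a u x - \<i> * a0 x * of_real k * u x + of_real (k\<^sup>2) * u x = f x) \<and>
     (AE x in surface_measure \<Gamma>. bdry_trace \<Omega> u x = u0 x) \<and>
     (AE x in surface_measure \<Gamma>. normal_deriv \<Omega> u x = u1 x)"

end

theory Submission
  imports Defs "HOL-Computational_Algebra.Polynomial"
begin

text \<open>The boundary terms on the right-hand side are non-negative, and the estimate already holds
  without them: every solution satisfies \<open>k \<parallel>u\<parallel>\<^sub>0 \<le> C (\<parallel>f\<parallel>\<^sub>0 + \<parallel>u\<parallel>\<^sub>1)\<close>.  A bounded \<open>C\<^sup>2\<close> domain has the
  uniform cone property, so near each point of its closure \<open>u(x)\<close> can be compared with a weighted
  average of \<open>u\<close> over a ball of radius comparable to \<open>1 / k\<close> inside the cone at \<open>x\<close>.  The deviation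
  from the average is at most \<open>C / k\<close> times the norm of the gradient, and the average is controlled by testing the equation
  with the averaging kernel, after one integration by parts.

  For the second part, the Riesz representatives in \<open>H\<^sup>1\<close> of the integrals over rational boxes span a
  dense subspace, and on the span of finitely many of them the \<open>H\<^sup>1\<close> inner product with \<open>u\<close> is
  bounded by \<open>\<parallel>u\<parallel>\<^sub>0\<close>.  Hence \<open>\<parallel>u\<parallel>\<^sub>1\<close> is at most twice the distance of \<open>u\<close> from the span plus
  a multiple of \<open>\<parallel>u\<parallel>\<^sub>0\<close>.  If the dimension grows slowly enough with \<open>k\<close>, that multiple of
  \<open>\<parallel>u\<parallel>\<^sub>0\<close> is absorbed, and the semi-norm is the \<open>H\<^sup>1\<close> distance from the span.\<close>

section \<open>Semi-inner product spaces of functions\<close>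

text \<open>The width \<open>1 / k\<close> balances two errors. In \<open>L2\<close>, shifts of that
  length change \<open>u\<close> by at most a multiple of \<open>1 / k\<close> times its gradient.
  In the tested equation \<open>u\<close> itself carries \<open>k\<^sup>2\<close>, while the one
  derivative that lands on the kernel, like the term with \<open>a0\<close>, costs a single
  \<open>k\<close>, so the average gains \<open>1 / k\<close> as well. A second integration by parts
  would put second derivatives on \<open>a2\<close> and another \<open>k\<close> on the kernel, so
  the gradient stays on the right-hand side. The boundary is the obstacle: a ball around
  \<open>x\<close> would leave the domain when \<open>x\<close> is close to it. The kernel is
  therefore supported off-centre, inside the cone at \<open>x\<close>; it is then a test function of
  the domain, and the segments from \<open>x\<close> to its support stay inside, so that
  translations can be estimated without extending \<open>u\<close> as a Sobolev function. For the
  subspaces, Riesz representatives are used because no derivative of \<open>u\<close> occurs in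
  their product with \<open>u\<close>. On a finite-dimensional span the bound costs a constant that
  is finite but otherwise uncontrolled; hence the dimension is tied to \<open>k\<close> through
  these constants themselves.\<close>

lemma quadratic_nonneg:
  fixes a b :: real assumes "0 \<le> b" "\<And>t. 0 \<le> 2 * t * a + t\<^sup>2 * b" shows "a = 0"
proof (rule ccontr)
  assume a: "a \<noteq> 0"
  \<comment> \<open>The minimiser of the quadratic is \<open>- a / b\<close>; enlarging the
    denominator to \<open>b + 1\<close> covers \<open>b = 0\<close> and still gives a negative
    value.\<close>
  have "0 \<le> 2 * (- a / (b + 1)) * a + (- a / (b + 1))\<^sup>2 * b" by (rule assms(2))
  also have "\<dots> = - (a\<^sup>2 * (b + 2)) / (b + 1)\<^sup>2"
    using assms(1) by (simp add: divide_simps power2_eq_square) (simp add: algebra_simps)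
  also have "\<dots> < 0" using a assms(1) by (simp add: divide_neg_pos)
  finally show False by simp
qed

text \<open>The elements are functions rather than classes modulo null sets, so the form is only
  semi-definite.  It is the real part of a sesquilinear form; the complex structure enters through
  \<open>cnj_left\<close> alone.\<close>

locale semi_inner =
  fixes S :: "('x \<Rightarrow> complex) set" and B :: "('x \<Rightarrow> complex) \<Rightarrow> ('x \<Rightarrow> complex) \<Rightarrow> real"
  assumes zero_mem: "(\<lambda>x. 0) \<in> S"
    and add_mem: "\<And>u v. u \<in> S \<Longrightarrow> v \<in> S \<Longrightarrow> (\<lambda>x. u x + v x) \<in> S"
    and scale_mem: "\<And>c u. u \<in> S \<Longrightarrow> (\<lambda>x. c * u x) \<in> S"
    and sym: "\<And>u v. u \<in> S \<Longrightarrow> v \<in> S \<Longrightarrow> B u v = B v u"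
    and add_left: "\<And>u v w. u \<in> S \<Longrightarrow> v \<in> S \<Longrightarrow> w \<in> S \<Longrightarrow> B (\<lambda>x. u x + v x) w = B u w + B v w"
    and cnj_left: "\<And>c u v. u \<in> S \<Longrightarrow> v \<in> S \<Longrightarrow> B (\<lambda>x. c * u x) v = B u (\<lambda>x. cnj c * v x)"
    and real_left: "\<And>r u v. u \<in> S \<Longrightarrow> v \<in> S \<Longrightarrow> B (\<lambda>x. of_real r * u x) v = r * B u v"
    and pos: "\<And>u. u \<in> S \<Longrightarrow> 0 \<le> B u u"
begin

definition nrm :: "('x \<Rightarrow> complex) \<Rightarrow> real" where
  "nrm u = sqrt (B u u)"

lemma nrm_nonneg [simp]: "u \<in> S \<Longrightarrow> 0 \<le> nrm u"
  by (simp add: nrm_def pos)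

lemma nrm_sq: "u \<in> S \<Longrightarrow> (nrm u)\<^sup>2 = B u u"
  by (simp add: nrm_def pos)

lemma diff_mem: "u \<in> S \<Longrightarrow> v \<in> S \<Longrightarrow> (\<lambda>x. u x - v x) \<in> S"
  using add_mem[of u "\<lambda>x. - 1 * v x"] scale_mem[of v "- 1"] by simp

lemma add_right:
  assumes "u \<in> S" "v \<in> S" "w \<in> S" shows "B w (\<lambda>x. u x + v x) = B w u + B w v"
  using assms sym[of w "\<lambda>x. u x + v x"] sym[of w u] sym[of w v] add_left add_mem by simp

lemma real_right:
  assumes "u \<in> S" "v \<in> S" shows "B v (\<lambda>x. of_real r * u x) = r * B v u"
  using assms sym[of v "\<lambda>x. of_real r * u x"] sym[of v u] real_left scale_mem by simp

lemma diff_left: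
  assumes "u \<in> S" "v \<in> S" "w \<in> S" shows "B (\<lambda>x. u x - v x) w = B u w - B v w"
  using add_left[of u "\<lambda>x. of_real (-1) * v x" w] scale_mem[of v "-1"] real_left[of v w "-1"] assms
  by simp

lemma diff_right:
  assumes "u \<in> S" "v \<in> S" "w \<in> S" shows "B w (\<lambda>x. u x - v x) = B w u - B w v"
  using assms sym[of w "\<lambda>x. u x - v x"] sym[of w u] sym[of w v] diff_left diff_mem by simp

text \<open>Moving \<open>c\<close> to the right factor turns it into \<open>cnj c * c\<close>, a
  real number, which the real form can extract; a complex \<open>c\<close> cannot be pulled out of a
  real part.\<close>

lemma nrm_scale:
  assumes "u \<in> S" shows "nrm (\<lambda>x. c * u x) = norm c * nrm u"
proof -
  have "B (\<lambda>x. c * u x) (\<lambda>x. c * u x) = B u (\<lambda>x. cnj c * (c * u x))"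
    using assms cnj_left[of u "\<lambda>x. c * u x" c] scale_mem by simp
  also have "(\<lambda>x. cnj c * (c * u x)) = (\<lambda>x. of_real ((norm c)\<^sup>2) * u x)"
    by (rule ext) (metis complex_norm_square mult.assoc mult.commute)
  finally show ?thesis
    using assms by (simp add: nrm_def real_right[of u u "(norm c)\<^sup>2", simplified] real_sqrt_mult)
qed

lemma nrm_zero [simp]: "nrm (\<lambda>x. 0) = 0"
  using nrm_scale[OF zero_mem, of 0] by simp

lemma expand_square:
  assumes "u \<in> S" "v \<in> S"
  shows "B (\<lambda>x. u x + of_real t * v x) (\<lambda>x. u x + of_real t * v x)
      = B u u + 2 * t * B u v + t\<^sup>2 * B v v"
proof -
  let ?w = "\<lambda>x. of_real t * v x"
  have w: "?w \<in> S" using assms scale_mem by blast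
  have "B (\<lambda>x. u x + ?w x) (\<lambda>x. u x + ?w x) = B u (\<lambda>x. u x + ?w x) + B ?w (\<lambda>x. u x + ?w x)"
    using assms w add_mem by (intro add_left) auto
  also have "\<dots> = (B u u + B u ?w) + (B ?w u + B ?w ?w)"
    using assms w add_right by simp
  also have "B ?w u = t * B u v" using assms real_left sym by simp
  also have "B u ?w = t * B u v" using assms real_right by simp
  also have "B ?w ?w = t * (t * B v v)" using assms real_left w real_right by simp
  finally show ?thesis by (simp add: power2_eq_square)
qed

lemma Cauchy_Schwarz:
  assumes u: "u \<in> S" and v: "v \<in> S" shows "\<bar>B u v\<bar> \<le> nrm u * nrm v"
proof -
  have q: "0 \<le> B u u + 2 * t * B u v + t\<^sup>2 * B v v" for t
    unfolding expand_square[OF u v, symmetric] using pos add_mem scale_mem u v by simp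
  have "(B u v)\<^sup>2 \<le> B u u * B v v"
  proof (cases "B v v = 0")
    case True
    \<comment> \<open>The form is only semi-definite, so \<open>B v v = 0\<close> does not say
      \<open>v = 0\<close>. The quadratic becomes affine in \<open>t\<close>, and the
      \<open>t\<close> below would make it equal to \<open>-1\<close>.\<close>
    have "B u v = 0"
    proof (rule ccontr)
      assume nz: "B u v \<noteq> 0"
      have "0 \<le> B u u + 2 * (- (B u u + 1) / (2 * B u v)) * B u v"
        using q[of "- (B u u + 1) / (2 * B u v)"] True by simp
      also have "\<dots> = -1" using nz by (simp add: divide_simps)
      finally show False by simp
    qed
    then show ?thesis using True by simp
  next
    case False
    then have p: "B v v > 0" using pos[OF v] by simp
    \<comment> \<open>\<open>t = - B u v / B v v\<close> minimises the quadratic.\<close>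
    have "0 \<le> B u u + 2 * (- B u v / B v v) * B u v + (- B u v / B v v)\<^sup>2 * B v v" by (rule q)
    also have "\<dots> = B u u - (B u v)\<^sup>2 / B v v"
      using p by (simp add: divide_simps power2_eq_square)
    finally have "(B u v)\<^sup>2 / B v v \<le> B u u" by simp
    then show ?thesis using p by (simp add: divide_simps)
  qed
  then have "sqrt ((B u v)\<^sup>2) \<le> sqrt (B u u * B v v)" by (rule real_sqrt_le_mono)
  then show ?thesis by (simp add: nrm_def real_sqrt_mult)
qed

lemma nrm_triangle:
  assumes u: "u \<in> S" and v: "v \<in> S" shows "nrm (\<lambda>x. u x + v x) \<le> nrm u + nrm v"
proof -
  have "(nrm (\<lambda>x. u x + v x))\<^sup>2 = (nrm u)\<^sup>2 + 2 * B u v + (nrm v)\<^sup>2"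
    using expand_square[OF u v, of 1] u v add_mem by (simp add: nrm_sq)
  also have "\<dots> \<le> (nrm u)\<^sup>2 + 2 * (nrm u * nrm v) + (nrm v)\<^sup>2"
    using Cauchy_Schwarz[OF u v] by simp
  also have "\<dots> = (nrm u + nrm v)\<^sup>2" by (simp add: power2_eq_square algebra_simps)
  finally show ?thesis using u v by (meson nrm_nonneg add_nonneg_nonneg power2_le_imp_le)
qed

lemma nrm_minus_commute:
  assumes u: "u \<in> S" and v: "v \<in> S" shows "nrm (\<lambda>x. u x - v x) = nrm (\<lambda>x. v x - u x)"
  using nrm_scale[of "\<lambda>x. u x - v x" "-1"] diff_mem[OF u v] by simp

lemma nrm_triangle_diff:
  assumes "u \<in> S" "v \<in> S" "w \<in> S"
  shows "nrm (\<lambda>x. u x - w x) \<le> nrm (\<lambda>x. u x - v x) + nrm (\<lambda>x. v x - w x)"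
  using nrm_triangle[of "\<lambda>x. u x - v x" "\<lambda>x. v x - w x"] assms diff_mem by simp

lemma nrm_le_diff_add:
  assumes "u \<in> S" "v \<in> S" shows "nrm u \<le> nrm (\<lambda>x. u x - v x) + nrm v"
  using nrm_triangle[of "\<lambda>x. u x - v x" v] assms diff_mem by simp

lemma parallelogram:
  assumes u: "u \<in> S" and v: "v \<in> S"
  shows "B (\<lambda>x. u x + v x) (\<lambda>x. u x + v x) + B (\<lambda>x. u x - v x) (\<lambda>x. u x - v x)
      = 2 * B u u + 2 * B v v"
  using expand_square[OF u v, of 1] expand_square[OF u v, of "-1"] by simp

text \<open>For \<open>V = S\<close> this is the Riesz representation theorem; for \<open>l = B u\<close> the function \<open>w\<close> is the
  orthogonal projection of \<open>u\<close> onto the closure of \<open>V\<close>.\<close>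

lemma Riesz_on_subspace:
  assumes complete: "\<And>X. (\<And>n. X n \<in> S) \<Longrightarrow>
        (\<And>e. e > 0 \<Longrightarrow> \<exists>M::nat. \<forall>m\<ge>M. \<forall>n\<ge>M. nrm (\<lambda>x. X m x - X n x) < e) \<Longrightarrow>
        \<exists>w\<in>S. (\<lambda>n. nrm (\<lambda>x. X n x - w x)) \<longlonglongrightarrow> 0"
    and VS: "V \<subseteq> S" and V0: "(\<lambda>x. 0) \<in> V"
    and Vadd: "\<And>u v. u \<in> V \<Longrightarrow> v \<in> V \<Longrightarrow> (\<lambda>x. u x + v x) \<in> V"
    and Vscale: "\<And>r u. u \<in> V \<Longrightarrow> (\<lambda>x. of_real r * u x) \<in> V"
    and l_add: "\<And>u v. u \<in> V \<Longrightarrow> v \<in> V \<Longrightarrow> l (\<lambda>x. u x + v x) = l u + l v"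
    and l_scale: "\<And>r u. u \<in> V \<Longrightarrow> l (\<lambda>x. of_real r * u x) = r * l u"
    and l_bd: "\<And>u. u \<in> V \<Longrightarrow> \<bar>l u\<bar> \<le> K * nrm u"
  obtains w where "w \<in> S" "\<And>e. e > 0 \<Longrightarrow> \<exists>v\<in>V. nrm (\<lambda>x. w x - v x) < e"
    "\<And>v. v \<in> V \<Longrightarrow> B w v = l v"
proof -
  \<comment> \<open>\<open>J\<close> is the energy whose stationary points on \<open>V\<close> solve
    \<open>B w v = l v\<close>. Completing the square bounds it from below.\<close>
  define J where "J v = B v v - 2 * l v" for v
  have lower: "- K\<^sup>2 \<le> J v" if "v \<in> V" for v
  proof -
    have vS: "v \<in> S" using that VS by blast
    have "0 \<le> (nrm v - K)\<^sup>2" by simp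
    also have "\<dots> = B v v - 2 * (K * nrm v) + K\<^sup>2"
      using nrm_sq[OF vS] by (simp add: power2_eq_square algebra_simps)
    finally show ?thesis using l_bd[OF that] by (simp add: J_def)
  qed
  define d where "d = Inf (J ` V)"
  have bdd: "bdd_below (J ` V)" using lower by (auto intro!: bdd_belowI)
  have ne: "J ` V \<noteq> {}" using V0 by auto
  have d_le: "d \<le> J v" if "v \<in> V" for v
    unfolding d_def using that bdd by (auto intro: cInf_lower)
  have "\<exists>v\<in>V. J v < d + 1 / (real n + 1)" for n :: nat
    using cInf_lessD[OF ne, of "d + 1 / (real n + 1)"] by (auto simp: d_def)
  then obtain X where XV: "\<And>n. X n \<in> V" and Xd: "\<And>n::nat. J (X n) < d + 1 / (real n + 1)"
    by metis
  have XS: "X n \<in> S" for n using XV VS by blast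
  have dist: "(nrm (\<lambda>x. X m x - X n x))\<^sup>2 \<le> 2 * (1 / (real m + 1) + 1 / (real n + 1))" for m n
  proof -
    \<comment> \<open>The parallelogram law at the midpoint \<open>s / 2\<close>, whose energy is at
      least \<open>d\<close>: two almost minimal elements of \<open>V\<close> must be close to each
      other.\<close>
    define s where "s = (\<lambda>x. X m x + X n x)"
    have s: "s \<in> V" "s \<in> S" using XV Vadd VS by (auto simp: s_def)
    have h: "(\<lambda>x. of_real (1/2) * s x) \<in> V" using s Vscale by blast
    have "d \<le> J (\<lambda>x. of_real (1/2) * s x)" using h by (rule d_le)
    also have "\<dots> = B s s / 4 - l s"
      unfolding J_def l_scale[OF s(1)] using s scale_mem[of s "of_real (1/2)"]
      by (simp only: real_left real_right)
    finally have 1: "4 * d \<le> B s s - 4 * l s" by simp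
    have "B s s + (nrm (\<lambda>x. X m x - X n x))\<^sup>2 = 2 * B (X m) (X m) + 2 * B (X n) (X n)"
      using parallelogram[OF XS XS, of m n] XS diff_mem by (simp add: nrm_sq s_def)
    moreover have "l s = l (X m) + l (X n)" unfolding s_def by (rule l_add[OF XV XV])
    ultimately have "(nrm (\<lambda>x. X m x - X n x))\<^sup>2 \<le> 2 * J (X m) + 2 * J (X n) - 4 * d"
      using 1 by (simp add: J_def)
    then show ?thesis using Xd[of m] Xd[of n] by simp
  qed
  have "\<exists>M::nat. \<forall>m\<ge>M. \<forall>n\<ge>M. nrm (\<lambda>x. X m x - X n x) < e" if "e > 0" for e
  proof -
    obtain M :: nat where M: "4 / e\<^sup>2 < real M" using reals_Archimedean2 by blast
    have Mp: "0 < real M" by (rule le_less_trans[OF _ M]) simp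
    have "nrm (\<lambda>x. X m x - X n x) < e" if "m \<ge> M" "n \<ge> M" for m n
    proof -
      have "1 / (real m + 1) \<le> 1 / real M" "1 / (real n + 1) \<le> 1 / real M"
        using that Mp by (auto intro!: divide_left_mono mult_pos_pos)
      then have "(nrm (\<lambda>x. X m x - X n x))\<^sup>2 \<le> 4 / real M"
        using dist[of m n] by simp
      also have "\<dots> < e\<^sup>2" using M Mp \<open>e > 0\<close> by (simp add: field_simps)
      finally show ?thesis using \<open>e > 0\<close> by (simp add: power_less_imp_less_base)
    qed
    then show ?thesis by blast
  qed
  then obtain w where w: "w \<in> S" and lim: "(\<lambda>n. nrm (\<lambda>x. X n x - w x)) \<longlonglongrightarrow> 0"
    using complete[of X] XS by metis
  have approx: "\<exists>v\<in>V. nrm (\<lambda>x. w x - v x) < e" if "e > 0" for e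
  proof -
    from LIMSEQ_D[OF lim that] obtain n where "norm (nrm (\<lambda>x. X n x - w x) - 0) < e" by blast
    then have "nrm (\<lambda>x. w x - X n x) < e" using nrm_minus_commute[OF w XS] by simp
    then show ?thesis using XV by blast
  qed
  have eq: "B w v = l v" if v: "v \<in> V" for v
  proof -
    have vS: "v \<in> S" using v VS by blast
    have Blim: "(\<lambda>n. B (X n) v) \<longlonglongrightarrow> B w v"
    proof (rule LIM_zero_cancel, rule Lim_null_comparison)
      show "\<forall>\<^sub>F n in sequentially. norm (B (X n) v - B w v) \<le> nrm (\<lambda>x. X n x - w x) * nrm v"
        using Cauchy_Schwarz[OF diff_mem[OF XS w] vS] by (simp add: diff_left[OF XS w vS])
      show "(\<lambda>n. nrm (\<lambda>x. X n x - w x) * nrm v) \<longlonglongrightarrow> 0"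
        using tendsto_mult_right[OF lim, of "nrm v"] by simp
    qed
    \<comment> \<open>First variation. The limit \<open>w\<close> need not lie in \<open>V\<close>,
      so the comparison with \<open>d\<close> is made at \<open>X n + t v\<close>, and only the
      resulting inequality is passed to the limit.\<close>
    have "0 \<le> 2 * t * (B w v - l v) + t\<^sup>2 * B v v" for t
    proof -
      have step: "0 \<le> 1 / (real n + 1) + 2 * t * (B (X n) v - l v) + t\<^sup>2 * B v v" for n
      proof -
        let ?y = "\<lambda>x. X n x + of_real t * v x"
        have tv: "(\<lambda>x. of_real t * v x) \<in> V" using v Vscale by blast
        have "d \<le> J ?y" using XV tv by (intro d_le Vadd)
        also have "J ?y = J (X n) + 2 * t * (B (X n) v - l v) + t\<^sup>2 * B v v"
          unfolding J_def expand_square[OF XS vS] l_add[OF XV tv] l_scale[OF v]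
          by (simp add: algebra_simps)
        finally show ?thesis using Xd[of n] by simp
      qed
      have "(\<lambda>n. 1 / (real n + 1) + 2 * t * (B (X n) v - l v) + t\<^sup>2 * B v v)
              \<longlonglongrightarrow> 0 + 2 * t * (B w v - l v) + t\<^sup>2 * B v v"
        using LIMSEQ_inverse_real_of_nat
        by (intro tendsto_intros Blim) (simp add: inverse_eq_divide add.commute)
      then show ?thesis using step by (intro LIMSEQ_le_const[of _ _ 0]) auto
    qed
    from quadratic_nonneg[OF pos[OF vS] this] show ?thesis by simp
  qed
  show ?thesis using that[OF w approx eq] by blast
qed

end

section \<open>Square integrable functions\<close>

text \<open>As \<open>\<bullet>\<close> on complex numbers is the scalar product of the plane, this
  is the real part of the Hermitian product; multiplying one factor by \<open>\<i>\<close> gives the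
  imaginary part up to sign.\<close>

definition ip :: "'a measure \<Rightarrow> ('a \<Rightarrow> complex) \<Rightarrow> ('a \<Rightarrow> complex) \<Rightarrow> real" where
  "ip M u v = (\<integral>x. u x \<bullet> v x \<partial>M)"

lemma L2_measurable: "u \<in> L2 M \<Longrightarrow> u \<in> borel_measurable M"
  by (simp add: L2_def)

lemma L2_integrable_square: "u \<in> L2 M \<Longrightarrow> integrable M (\<lambda>x. (norm (u x))\<^sup>2)"
  by (simp add: L2_def)

lemma L2_dominated:
  assumes "u \<in> borel_measurable M" "integrable M g" "AE x in M. (norm (u x))\<^sup>2 \<le> g x"
  shows "u \<in> L2 M"
  unfolding L2_def
  using assms by (auto intro!: Bochner_Integration.integrable_bound[of M g] elim!: AE_mp)

lemma L2_integrable_norm_mult: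
  assumes "u \<in> L2 M" "v \<in> L2 M" shows "integrable M (\<lambda>x. norm (u x) * norm (v x))"
proof (rule Bochner_Integration.integrable_bound[of M "\<lambda>x. (norm (u x))\<^sup>2 + (norm (v x))\<^sup>2"])
  show "AE x in M. norm (norm (u x) * norm (v x)) \<le> norm ((norm (u x))\<^sup>2 + (norm (v x))\<^sup>2)"
  proof (rule AE_I2)
    fix x
    have "2 * (norm (u x) * norm (v x)) \<le> (norm (u x))\<^sup>2 + (norm (v x))\<^sup>2"
      using sum_squares_bound[of "norm (u x)" "norm (v x)"] by simp
    moreover have "0 \<le> norm (u x) * norm (v x)" by simp
    ultimately have "norm (u x) * norm (v x) \<le> (norm (u x))\<^sup>2 + (norm (v x))\<^sup>2" by linarith
    then show "norm (norm (u x) * norm (v x)) \<le> norm ((norm (u x))\<^sup>2 + (norm (v x))\<^sup>2)"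
      by simp
  qed
qed (use assms in \<open>auto simp: L2_def\<close>)

lemma L2_integrable_mult:
  assumes "u \<in> L2 M" "v \<in> L2 M" shows "integrable M (\<lambda>x. u x * v x)"
  by (rule Bochner_Integration.integrable_bound[OF L2_integrable_norm_mult[OF assms]])
     (use assms in \<open>auto simp: L2_def norm_mult\<close>)

lemma L2_integrable_inner:
  assumes "u \<in> L2 M" "v \<in> L2 M" shows "integrable M (\<lambda>x. u x \<bullet> v x)"
  by (rule Bochner_Integration.integrable_bound[OF L2_integrable_norm_mult[OF assms]])
     (use assms in \<open>auto simp: L2_def Cauchy_Schwarz_ineq2\<close>)

lemma L2_zero: "(\<lambda>x. 0) \<in> L2 M"
  by (simp add: L2_def)

lemma L2_add:
  assumes "u \<in> L2 M" "v \<in> L2 M" shows "(\<lambda>x. u x + v x) \<in> L2 M"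
proof (rule L2_dominated[of _ _ "\<lambda>x. 2 * (norm (u x))\<^sup>2 + 2 * (norm (v x))\<^sup>2"])
  show "AE x in M. (norm (u x + v x))\<^sup>2 \<le> 2 * (norm (u x))\<^sup>2 + 2 * (norm (v x))\<^sup>2"
  proof (rule AE_I2)
    fix x
    have "(norm (u x + v x))\<^sup>2 \<le> (norm (u x) + norm (v x))\<^sup>2"
      by (intro power_mono norm_triangle_ineq) auto
    also have "\<dots> \<le> 2 * (norm (u x))\<^sup>2 + 2 * (norm (v x))\<^sup>2"
      using sum_squares_bound[of "norm (u x)" "norm (v x)"] by (simp add: power2_sum)
    finally show "(norm (u x + v x))\<^sup>2 \<le> 2 * (norm (u x))\<^sup>2 + 2 * (norm (v x))\<^sup>2" .
  qed
qed (use assms in \<open>auto simp: L2_def\<close>)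

lemma L2_scale: "u \<in> L2 M \<Longrightarrow> (\<lambda>x. c * u x) \<in> L2 M"
  by (auto simp: L2_def norm_mult power_mult_distrib)

lemma ip_self: "ip M u u = (L2_norm M u)\<^sup>2"
  by (simp add: ip_def L2_norm_def dot_square_norm)

interpretation l2: semi_inner "L2 M" "ip M" for M :: "'a measure"
proof
  fix u v w :: "'a \<Rightarrow> complex" and c :: complex and r :: real
  show "(\<lambda>x. 0) \<in> L2 M" by (rule L2_zero)
  show "u \<in> L2 M \<Longrightarrow> (\<lambda>x. c * u x) \<in> L2 M" by (rule L2_scale)
  show "u \<in> L2 M \<Longrightarrow> v \<in> L2 M \<Longrightarrow> (\<lambda>x. u x + v x) \<in> L2 M" by (rule L2_add)
  show "ip M u v = ip M v u" by (simp add: ip_def inner_commute)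
  show "u \<in> L2 M \<Longrightarrow> v \<in> L2 M \<Longrightarrow> w \<in> L2 M \<Longrightarrow> ip M (\<lambda>x. u x + v x) w = ip M u w + ip M v w"
    by (simp add: ip_def inner_add_left L2_integrable_inner)
  show "ip M (\<lambda>x. c * u x) v = ip M u (\<lambda>x. cnj c * v x)"
    unfolding ip_def by (intro Bochner_Integration.integral_cong) (auto simp: inner_complex_def
        algebra_simps)
  show "ip M (\<lambda>x. of_real r * u x) v = r * ip M u v"
    unfolding ip_def integral_mult_right_zero[symmetric]
    by (intro Bochner_Integration.integral_cong) (auto simp: inner_complex_def algebra_simps)
  show "0 \<le> ip M u u" by (simp add: ip_self)
qed

lemma L2_norm_nonneg [simp]: "0 \<le> L2_norm M u"
  by (simp add: L2_norm_def)

lemma nrm_L2 [simp]: "semi_inner.nrm (ip M) = L2_norm M"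
  by (rule ext) (simp add: l2.nrm_def ip_self)

lemma L2_norm_sq: "(L2_norm M u)\<^sup>2 = (\<integral>x. (norm (u x))\<^sup>2 \<partial>M)"
  by (simp add: L2_norm_def)

lemma ip_bound: "u \<in> L2 M \<Longrightarrow> v \<in> L2 M \<Longrightarrow> \<bar>ip M u v\<bar> \<le> L2_norm M u * L2_norm M v"
  using l2.Cauchy_Schwarz[of u M v] by simp

lemma L2_norm_triangle:
  "u \<in> L2 M \<Longrightarrow> v \<in> L2 M \<Longrightarrow> L2_norm M (\<lambda>x. u x + v x) \<le> L2_norm M u + L2_norm M v"
  using l2.nrm_triangle[of u M v] by simp

lemma L2_norm_scale: "u \<in> L2 M \<Longrightarrow> L2_norm M (\<lambda>x. c * u x) = norm c * L2_norm M u"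
  using l2.nrm_scale[of u M c] by simp

lemma L2_norm_mono:
  assumes "u \<in> borel_measurable M" "v \<in> L2 M" "AE x in M. norm (u x) \<le> norm (v x)"
  shows "u \<in> L2 M" "L2_norm M u \<le> L2_norm M v"
proof -
  have sq: "AE x in M. (norm (u x))\<^sup>2 \<le> (norm (v x))\<^sup>2"
    using assms(3) by eventually_elim (simp add: power_mono)
  show u: "u \<in> L2 M"
    using L2_dominated[OF assms(1) L2_integrable_square[OF assms(2)] sq] .
  show "L2_norm M u \<le> L2_norm M v"
    unfolding L2_norm_def
    by (intro real_sqrt_le_mono integral_mono_AE L2_integrable_square u assms sq)
qed

lemma L2_cong_AE:
  assumes "u \<in> L2 M" "v \<in> borel_measurable M" "AE x in M. u x = v x"
  shows "v \<in> L2 M" "L2_norm M v = L2_norm M u"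
proof -
  show v: "v \<in> L2 M"
    by (rule L2_norm_mono(1)[OF assms(2,1)]) (use assms(3) in eventually_elim, simp)
  show "L2_norm M v = L2_norm M u"
    unfolding L2_norm_def using assms
    by (intro arg_cong[where f=sqrt] integral_cong_AE) (auto simp: L2_def)
qed

lemma L2_norm_zero_AE:
  assumes "u \<in> L2 M" shows "L2_norm M u = 0 \<longleftrightarrow> (AE x in M. u x = 0)"
  using integral_nonneg_eq_0_iff_AE[OF L2_integrable_square[OF assms]]
  by (simp add: L2_norm_def)

lemma L2_sum:
  assumes "\<And>i. i \<in> I \<Longrightarrow> u i \<in> L2 M" shows "(\<lambda>x. \<Sum>i\<in>I. u i x) \<in> L2 M"
  using assms by (induction I rule: infinite_finite_induct) (auto simp: L2_zero L2_add)

lemma L2_norm_sum: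
  assumes "\<And>i. i \<in> I \<Longrightarrow> u i \<in> L2 M"
  shows "L2_norm M (\<lambda>x. \<Sum>i\<in>I. u i x) \<le> (\<Sum>i\<in>I. L2_norm M (u i))"
  using assms
proof (induction I rule: infinite_finite_induct)
  case (insert i I)
  then show ?case
    using L2_norm_triangle[of "u i" M "\<lambda>x. \<Sum>i\<in>I. u i x"] L2_sum[of I u M] by fastforce
qed (auto simp: L2_norm_def)

lemma L2_mult_Linf:
  fixes g :: "'a \<Rightarrow> complex"
  assumes "g \<in> Linf M" "u \<in> L2 M" shows "(\<lambda>x. g x * u x) \<in> L2 M"
proof -
  from assms(1) obtain K where g: "g \<in> borel_measurable M" and K: "AE x in M. norm (g x) \<le> K"
    by (auto simp: Linf_def)
  show ?thesis
  proof (rule L2_norm_mono(1)[OF _ L2_scale[OF assms(2), of "of_real \<bar>K\<bar>"]])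
    show "(\<lambda>x. g x * u x) \<in> borel_measurable M" using g L2_measurable[OF assms(2)] by simp
    show "AE x in M. norm (g x * u x) \<le> norm (complex_of_real \<bar>K\<bar> * u x)"
      using K by eventually_elim (auto simp: norm_mult intro!: mult_right_mono)
  qed
qed

text \<open>Non-negative integrals make sense without integrability, so one inequality between them
  yields both membership in \<open>L2\<close> and the bound on the norm. Fatou's lemma and Tonelli's
  theorem deliver their conclusions in this form.\<close>

lemma L2_norm_le_iff_nn:
  assumes "u \<in> borel_measurable M" "0 \<le> K"
  shows "u \<in> L2 M \<and> L2_norm M u \<le> K \<longleftrightarrow> (\<integral>\<^sup>+x. ennreal ((norm (u x))\<^sup>2) \<partial>M) \<le> ennreal (K\<^sup>2)"
proof
  assume L: "u \<in> L2 M \<and> L2_norm M u \<le> K"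
  then have "(L2_norm M u)\<^sup>2 \<le> K\<^sup>2" by (intro power_mono) auto
  then show "(\<integral>\<^sup>+x. ennreal ((norm (u x))\<^sup>2) \<partial>M) \<le> ennreal (K\<^sup>2)"
    using L by (subst nn_integral_eq_integral) (auto simp: L2_def L2_norm_sq ennreal_leI)
next
  assume R: "(\<integral>\<^sup>+x. ennreal ((norm (u x))\<^sup>2) \<partial>M) \<le> ennreal (K\<^sup>2)"
  have i: "integrable M (\<lambda>x. (norm (u x))\<^sup>2)"
    using R assms by (intro integrableI_nonneg) (auto intro: le_less_trans)
  then have u: "u \<in> L2 M" using assms by (simp add: L2_def)
  have "ennreal ((L2_norm M u)\<^sup>2) \<le> ennreal (K\<^sup>2)"
    using R i by (subst (asm) nn_integral_eq_integral) (auto simp: L2_norm_sq)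
  then have "(L2_norm M u)\<^sup>2 \<le> K\<^sup>2" by (simp add: ennreal_le_iff)
  then have "L2_norm M u \<le> K" using assms(2) by (rule power2_le_imp_le)
  then show "u \<in> L2 M \<and> L2_norm M u \<le> K" using u by simp
qed

lemma L2_integrable:
  assumes "finite_measure M" "u \<in> L2 M"
  shows "integrable M u" "(\<integral>x. norm (u x) \<partial>M) \<le> L2_norm M u * sqrt (measure M (space M))"
proof -
  interpret finite_measure M by fact
  have one: "(\<lambda>x. 1) \<in> L2 M" by (simp add: L2_def)
  have n: "(\<lambda>x. of_real (norm (u x))) \<in> L2 M" using assms(2) by (auto simp: L2_def)
  show "integrable M u" using L2_integrable_mult[OF assms(2) one] by simp
  have "(\<integral>x. norm (u x) \<partial>M) = ip M (\<lambda>x. of_real (norm (u x))) (\<lambda>x. 1)"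
    by (simp add: ip_def)
  also have "\<dots> \<le> L2_norm M (\<lambda>x. of_real (norm (u x))) * L2_norm M (\<lambda>x. 1)"
    using ip_bound[OF n one] by simp
  finally show "(\<integral>x. norm (u x) \<partial>M) \<le> L2_norm M u * sqrt (measure M (space M))"
    by (simp add: L2_norm_def)
qed

text \<open>On a finite measure space an \<open>L2\<close> Cauchy sequence is Cauchy in the mean,
  hence has a subsequence that converges almost everywhere. Fatou's lemma along this subsequence,
  with the other index fixed, turns the Cauchy estimate into an estimate of the distance to the
  limit for the whole sequence.\<close>

theorem L2_complete:
  fixes X :: "nat \<Rightarrow> 'a \<Rightarrow> complex"
  assumes fin: "finite_measure M" and X: "\<And>n. X n \<in> L2 M"
    and Cau: "\<And>e. e > 0 \<Longrightarrow> \<exists>N. \<forall>m\<ge>N. \<forall>n\<ge>N. L2_norm M (\<lambda>x. X m x - X n x) < e"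
  shows "\<exists>w\<in>L2 M. (\<lambda>n. L2_norm M (\<lambda>x. X n x - w x)) \<longlonglongrightarrow> 0"
proof -
  have [measurable]: "X n \<in> borel_measurable M" for n using X by (rule L2_measurable)
  \<comment> \<open>The summand \<open>1\<close> keeps \<open>s\<close> positive when the whole
    space has measure zero.\<close>
  define s where "s = sqrt (measure M (space M)) + 1"
  have s: "s > 0" by (simp add: s_def add_nonneg_pos)
  obtain r where r: "strict_mono r" and AEC: "AE x in M. Cauchy (\<lambda>i. X (r i) x)"
  proof (rule cauchy_L1_AE_cauchy_subseq[of M X])
    show "integrable M (X n)" for n using L2_integrable(1)[OF fin X] .
    fix e :: real assume "e > 0"
    then obtain N where N: "\<And>m n. m \<ge> N \<Longrightarrow> n \<ge> N \<Longrightarrow> L2_norm M (\<lambda>x. X m x - X n x) < e / s"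
      using Cau[of "e / s"] s by (auto simp del: less_divide_eq_1_pos)
    have "(LINT x|M. norm (X i x - X j x)) < e" if "i \<ge> N" "j \<ge> N" for i j
    proof -
      have "(LINT x|M. norm (X i x - X j x)) \<le> L2_norm M (\<lambda>x. X i x - X j x)
          * sqrt (measure M (space M))"
        by (rule L2_integrable(2)[OF fin l2.diff_mem[OF X X]])
      also have "\<dots> \<le> L2_norm M (\<lambda>x. X i x - X j x) * s"
        by (intro mult_left_mono) (auto simp: s_def)
      also have "\<dots> < e / s * s" using N[OF that] s by (intro mult_strict_right_mono)
      finally show ?thesis using s by simp
    qed
    then show "\<exists>N. \<forall>i\<ge>N. \<forall>j\<ge>N. (LINT x|M. norm (X i x - X j x)) < e" by blast
  qed
  define w where "w x = lim (\<lambda>i. X (r i) x)" for x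
  have wm [measurable]: "w \<in> borel_measurable M"
    unfolding w_def by (intro borel_measurable_lim_metric) simp
  have lim: "AE x in M. (\<lambda>i. X (r i) x) \<longlonglongrightarrow> w x"
    using AEC by eventually_elim (simp add: w_def flip: convergent_LIMSEQ_iff Cauchy_convergent_iff)
  have bound: "\<exists>N. \<forall>n\<ge>N. (\<lambda>x. X n x - w x) \<in> L2 M \<and> L2_norm M (\<lambda>x. X n x - w x) \<le> e"
      if e: "e > 0" for e
  proof -
    obtain N where N: "\<And>m n. m \<ge> N \<Longrightarrow> n \<ge> N \<Longrightarrow> L2_norm M (\<lambda>x. X m x - X n x) < e"
      using Cau[OF e] by blast
    have "(\<lambda>x. X n x - w x) \<in> L2 M \<and> L2_norm M (\<lambda>x. X n x - w x) \<le> e" if n: "n \<ge> N" for n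
    proof (subst L2_norm_le_iff_nn)
      have le: "(\<integral>\<^sup>+x. ennreal ((norm (X n x - X (r i) x))\<^sup>2) \<partial>M) \<le> ennreal (e\<^sup>2)" if "i \<ge> N" for i
      proof -
        have "r i \<ge> N" using that seq_suble[OF r, of i] by simp
        then show ?thesis
          using L2_norm_le_iff_nn[of "\<lambda>x. X n x - X (r i) x" M e] N[OF n, of "r i"] e
            l2.diff_mem[OF X X, of n "r i"] by simp
      qed
      have "(\<integral>\<^sup>+x. ennreal ((norm (X n x - w x))\<^sup>2) \<partial>M)
          = (\<integral>\<^sup>+x. liminf (\<lambda>i. ennreal ((norm (X n x - X (r i) x))\<^sup>2)) \<partial>M)"
      proof (rule nn_integral_cong_AE, use lim in eventually_elim)
        case (elim x)
        have "(\<lambda>i. ennreal ((norm (X n x - X (r i) x))\<^sup>2)) \<longlonglongrightarrow> ennreal ((norm (X n x - w x))\<^sup>2)"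
          by (intro tendsto_intros elim)
        then show ?case using lim_imp_Liminf[OF trivial_limit_sequentially] by metis
      qed
      also have "\<dots> \<le> liminf (\<lambda>i. \<integral>\<^sup>+x. ennreal ((norm (X n x - X (r i) x))\<^sup>2) \<partial>M)"
        by (rule nn_integral_liminf) simp
      also have "\<dots> \<le> ennreal (e\<^sup>2)"
        by (rule Liminf_le) (use le in \<open>auto simp: eventually_sequentially\<close>)
      finally show "(\<integral>\<^sup>+x. ennreal ((norm (X n x - w x))\<^sup>2) \<partial>M) \<le> ennreal (e\<^sup>2)" .
    qed (use e in auto)
    then show ?thesis by blast
  qed
  \<comment> \<open>So far \<open>w\<close> is only a pointwise limit; it is square integrable as
    the difference of \<open>X n\<close> and \<open>X n - w\<close>.\<close>
  obtain n where "(\<lambda>x. X n x - w x) \<in> L2 M" using bound[of 1] by auto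
  from l2.diff_mem[OF X this, of n] have w: "w \<in> L2 M" by simp
  have "(\<lambda>n. L2_norm M (\<lambda>x. X n x - w x)) \<longlonglongrightarrow> 0"
  proof (rule LIMSEQ_I)
    fix e :: real assume "e > 0"
    then obtain N where "\<forall>n\<ge>N. L2_norm M (\<lambda>x. X n x - w x) \<le> e / 2" using bound[of "e / 2"] by auto
    then have "\<forall>n\<ge>N. norm (L2_norm M (\<lambda>x. X n x - w x) - 0) < e"
      using \<open>e > 0\<close> by fastforce
    then show "\<exists>N. \<forall>n\<ge>N. norm (L2_norm M (\<lambda>x. X n x - w x) - 0) < e" by blast
  qed
  then show ?thesis using w by blast
qed

section \<open>Smooth functions and test functions\<close>

lemma partial_deriv_eq: "(f has_derivative f') (at x) \<Longrightarrow> partial_deriv j f x = f' (axis j 1)"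
  by (simp add: partial_deriv_def frechet_derivative_at[symmetric])

lemma linear_axis_expansion:
  fixes f :: "real^'n \<Rightarrow> 'b::real_vector"
  assumes "linear f" shows "f h = (\<Sum>j\<in>UNIV. (h $ j) *\<^sub>R f (axis j 1))"
proof -
  have "f h = f (\<Sum>j\<in>UNIV. (h $ j) *\<^sub>R axis j 1)"
    by (simp add: basis_expansion flip: scalar_mult_eq_scaleR)
  also have "\<dots> = (\<Sum>j\<in>UNIV. (h $ j) *\<^sub>R f (axis j 1))"
    by (simp add: linear_sum[OF assms] linear_scale[OF assms])
  finally show ?thesis .
qed

lemma differentiable_partial_deriv:
  fixes f :: "real^'n \<Rightarrow> 'b::real_normed_vector"
  assumes "f differentiable (at x)"
  shows "(f has_derivative (\<lambda>h. \<Sum>j\<in>UNIV. (h $ j) *\<^sub>R partial_deriv j f x)) (at x)"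
proof -
  have d: "(f has_derivative frechet_derivative f (at x)) (at x)"
    using assms by (simp add: frechet_derivative_works)
  show ?thesis
    by (rule has_derivative_eq_rhs[OF d])
       (auto simp: partial_deriv_def intro!: ext linear_axis_expansion has_derivative_linear[OF d])
qed

lemma Ck_on_Suc_imp: "Ck_on (Suc k) U f \<Longrightarrow> Ck_on k U f"
  by (induction k arbitrary: f)
     (auto intro!: continuous_at_imp_continuous_on differentiable_imp_continuous_within)

lemma Ck_add:
  "Ck_on k UNIV f \<Longrightarrow> Ck_on k UNIV g \<Longrightarrow> Ck_on k UNIV (\<lambda>x. f x + g x)"
proof (induction k arbitrary: f g)
  case (Suc k)
  have "partial_deriv j (\<lambda>x. f x + g x) = (\<lambda>x. partial_deriv j f x + partial_deriv j g x)" for j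
  proof
    fix x
    have "(f has_derivative frechet_derivative f (at x)) (at x)"
      "(g has_derivative frechet_derivative g (at x)) (at x)"
      using Suc.prems by (auto simp flip: frechet_derivative_works)
    from has_derivative_add[OF this] show
      "partial_deriv j (\<lambda>x. f x + g x) x = partial_deriv j f x + partial_deriv j g x"
      by (subst partial_deriv_eq) (auto simp: partial_deriv_def)
  qed
  then show ?case using Suc by (auto intro!: differentiable_add)
qed (simp add: continuous_on_add)

lemma partial_deriv_mult:
  fixes f g :: "real^'n \<Rightarrow> real"
  assumes "f differentiable (at x)" "g differentiable (at x)"
  shows "partial_deriv j (\<lambda>x. f x * g x) x = partial_deriv j f x * g x + f x * partial_deriv j g x"
proof -
  have "(f has_derivative frechet_derivative f (at x)) (at x)"
    "(g has_derivative frechet_derivative g (at x)) (at x)"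
    using assms by (auto simp flip: frechet_derivative_works)
  from has_derivative_mult[OF this] show ?thesis
    by (simp add: partial_deriv_eq) (simp add: partial_deriv_def)
qed

lemma Ck_mult:
  fixes f g :: "real^'n \<Rightarrow> real"
  shows "Ck_on k UNIV f \<Longrightarrow> Ck_on k UNIV g \<Longrightarrow> Ck_on k UNIV (\<lambda>x. f x * g x)"
proof (induction k arbitrary: f g)
  case (Suc k)
  have "partial_deriv j (\<lambda>x. f x * g x) = (\<lambda>x. partial_deriv j f x * g x + f x
      * partial_deriv j g x)" for j
    using Suc.prems by (auto simp: partial_deriv_mult)
  moreover have "Ck_on k UNIV f" "Ck_on k UNIV g"
    using Suc.prems Ck_on_Suc_imp by blast+
  ultimately show ?case using Suc by (auto intro!: differentiable_mult Ck_add)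
qed (simp add: continuous_on_mult)

lemma partial_deriv_affine:
  fixes f :: "real^'n \<Rightarrow> real"
  assumes "f differentiable (at (c *\<^sub>R x + a))"
  shows "partial_deriv j (\<lambda>x. f (c *\<^sub>R x + a)) x = c * partial_deriv j f (c *\<^sub>R x + a)"
    and "(\<lambda>x. f (c *\<^sub>R x + a)) differentiable (at x)"
proof -
  have d: "(f has_derivative frechet_derivative f (at (c *\<^sub>R x + a))) (at (c *\<^sub>R x + a))"
    using assms by (simp add: frechet_derivative_works)
  have A: "((\<lambda>x. f (c *\<^sub>R x + a)) has_derivative (\<lambda>h. frechet_derivative f (at (c *\<^sub>R x
      + a)) (c *\<^sub>R h))) (at x)"
    by (rule has_derivative_compose[where g = f and f = "\<lambda>x. c *\<^sub>R x + a" and f'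
        = "\<lambda>h. c *\<^sub>R h", OF _ d])
       (auto intro!: derivative_eq_intros)
  show "partial_deriv j (\<lambda>x. f (c *\<^sub>R x + a)) x = c * partial_deriv j f (c *\<^sub>R x + a)"
    unfolding partial_deriv_eq[OF A] using linear_scale[OF has_derivative_linear[OF d]]
    by (simp add: partial_deriv_def)
  show "(\<lambda>x. f (c *\<^sub>R x + a)) differentiable (at x)"
    using A by (auto simp: differentiable_def)
qed

lemma Ck_const: "Ck_on k UNIV (\<lambda>x::real^'n. c :: 'b::real_normed_vector)"
proof (induction k arbitrary: c)
  case (Suc k)
  have "partial_deriv j (\<lambda>x::real^'n. c) = (\<lambda>x. 0)" for j
    by (rule ext) (simp add: partial_deriv_eq[OF has_derivative_const])
  then show ?case using Suc by auto
qed auto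

lemma Ck_affine:
  fixes f :: "real^'n \<Rightarrow> real"
  shows "Ck_on k UNIV f \<Longrightarrow> Ck_on k UNIV (\<lambda>x. f (c *\<^sub>R x + a))"
proof (induction k arbitrary: f)
  case 0
  then show ?case by (auto intro!: continuous_on_compose2[of UNIV f] continuous_intros)
next
  case (Suc k)
  have "partial_deriv j (\<lambda>x. f (c *\<^sub>R x + a)) = (\<lambda>x. c * partial_deriv j f (c *\<^sub>R x + a))" for j
    using Suc.prems by (auto simp: partial_deriv_affine)
  moreover have "Ck_on k UNIV (\<lambda>x. c * partial_deriv j f (c *\<^sub>R x + a))" for j
    using Suc by (intro Ck_mult Ck_const) auto
  ultimately show ?case using Suc.prems by (auto simp: partial_deriv_affine)
qed

text \<open>The family \<open>f\<close> lists a function with all its derivatives. Differentiation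
  replaces \<open>f n\<close> by \<open>f (Suc n)\<close>, so the induction on \<open>k\<close> has
  to run for all \<open>n\<close> at once.\<close>

lemma Ck_coordinate:
  fixes f :: "nat \<Rightarrow> real \<Rightarrow> real" and i :: "'n::finite"
  assumes "\<And>n t. (f n has_real_derivative f (Suc n) t) (at t)"
  shows "Ck_on k UNIV (\<lambda>x. f n (a * (x $ i) + b))"
proof (induction k arbitrary: n)
  case 0
  have "continuous_on UNIV (f n)"
    using assms by (meson DERIV_continuous continuous_at_imp_continuous_on)
  then show ?case by (auto intro!: continuous_on_compose2[of UNIV "f n"] continuous_intros)
next
  case (Suc k)
  have d: "((\<lambda>x. f n (a * (x $ i) + b)) has_derivative (\<lambda>h. f (Suc n) (a * (x $ i) + b) * (a
      * h $ i))) (at x)" for x :: "real^'n"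
    by (rule has_derivative_compose[of _ "\<lambda>h. a
        * h $ i", OF _ assms[unfolded has_field_derivative_def]])
       (auto intro!: derivative_eq_intros bounded_linear_imp_has_derivative bounded_linear_vec_nth)
  have "partial_deriv j (\<lambda>x. f n (a * (x $ i) + b))
      = (\<lambda>x. (a * axis j 1 $ i) * f (Suc n) (a * (x $ i) + b))" for j
    by (rule ext) (simp add: partial_deriv_eq[OF d])
  moreover have "Ck_on k UNIV (\<lambda>x. (a * axis j 1 $ i) * f (Suc n) (a * (x $ i) + b))" for j
    by (intro Ck_mult Ck_const Suc)
  ultimately show ?case using d by (auto simp: differentiable_def)
qed

text \<open>Admitting polynomial factors makes the family closed under differentiation, which gives
  smoothness by induction.\<close>

definition exp_bump :: "real poly \<Rightarrow> real \<Rightarrow> real" where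
  "exp_bump p t = (if t > 0 then poly p (1 / t) * exp (- (1 / t)) else 0)"

text \<open>In the variable \<open>s = 1 / t\<close> the claim to the right of \<open>0\<close> is
  that the exponential outgrows every polynomial; to the left the function is zero.\<close>

lemma exp_bump_tendsto_0: "(exp_bump p \<longlongrightarrow> 0) (at 0)"
proof -
  have "((\<lambda>s. poly p s * exp (- s)) \<longlongrightarrow> 0) at_top"
  proof -
    have "((\<lambda>s. \<Sum>i\<le>degree p. coeff p i * (s ^ i / exp s)) \<longlongrightarrow> (\<Sum>i\<le>degree p. coeff p i * 0)) at_top"
      by (intro tendsto_intros tendsto_power_div_exp_0)
    moreover have "(\<lambda>s. poly p s * exp (- s)) = (\<lambda>s. \<Sum>i\<le>degree p. coeff p i * (s ^ i / exp s))"
      by (auto simp: poly_altdef exp_minus sum_distrib_right sum_divide_distrib divide_inverse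
          mult.assoc)
    ultimately show ?thesis by simp
  qed
  from filterlim_compose[OF this filterlim_inverse_at_top_right]
  have "((\<lambda>t. poly p (inverse t) * exp (- inverse t)) \<longlongrightarrow> 0) (at_right 0)" .
  then have "(exp_bump p \<longlongrightarrow> 0) (at_right 0)"
    by (rule Lim_transform_eventually)
       (auto simp: eventually_at_right_field exp_bump_def inverse_eq_divide intro!: exI[of _ 1])
  moreover have "(exp_bump p \<longlongrightarrow> 0) (at_left 0)"
    by (rule Lim_transform_eventually[of "\<lambda>_. 0"])
       (auto simp: eventually_at_left_field exp_bump_def intro!: exI[of _ "-1"])
  ultimately show ?thesis by (simp add: filterlim_at_split)
qed

text \<open>With \<open>s = 1 / t\<close>, the derivative of \<open>p(s) exp (- s)\<close> in
  \<open>t\<close> is \<open>- s\<^sup>2 (p'(s) - p(s)) exp (- s)\<close>, and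
  \<open>[:0, 0, 1:]\<close> is the factor \<open>s\<^sup>2\<close>. At \<open>t = 0\<close> the
  difference quotient is itself of the form \<open>exp_bump\<close>, for the polynomial
  \<open>s p(s)\<close>, so it tends to \<open>0\<close>.\<close>

lemma exp_bump_deriv:
  "(exp_bump p has_real_derivative exp_bump ([:0, 0, 1:] * (p - pderiv p)) t) (at t)"
proof -
  consider "t > 0" | "t < 0" | "t = 0" by linarith
  then show ?thesis
  proof cases
    case 1
    have "((\<lambda>t. poly p (1 / t) * exp (- (1 / t))) has_real_derivative
        exp_bump ([:0, 0, 1:] * (p - pderiv p)) t) (at t)"
      using 1 by (auto intro!: derivative_eq_intros DERIV_chain2[OF poly_DERIV]
          simp: exp_bump_def field_simps power2_eq_square)
    then show ?thesis
      by (rule DERIV_cong_ev[THEN iffD1, OF refl _ refl, rotated])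
         (use 1 in \<open>auto simp: exp_bump_def eventually_nhds intro!: exI[of _ "{0<..}"]\<close>)
  next
    case 2
    have "((\<lambda>t. 0) has_real_derivative exp_bump ([:0, 0, 1:] * (p - pderiv p)) t) (at t)"
      using 2 by (auto simp: exp_bump_def)
    then show ?thesis
      by (rule DERIV_cong_ev[THEN iffD1, OF refl _ refl, rotated])
         (use 2 in \<open>auto simp: exp_bump_def eventually_nhds intro!: exI[of _ "{..<0}"]\<close>)
  next
    case 3
    have "(\<lambda>h. (exp_bump p (0 + h) - exp_bump p 0) / h) = exp_bump ([:0, 1:] * p)"
      by (auto simp: exp_bump_def)
    then show ?thesis
      unfolding 3 DERIV_def using exp_bump_tendsto_0[of "[:0, 1:] * p"] by (simp add: exp_bump_def)
  qed
qed

lemma exp_bump_coordinate_smooth: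
  fixes i :: "'n::finite"
  shows "Ck_on k UNIV (\<lambda>x::real^'n. exp_bump 1 (a * (x $ i) + b))"
proof -
  define q where "q n = ((\<lambda>p. [:0, 0, 1:] * (p - pderiv p)) ^^ n) (1 :: real poly)" for n
  have "Ck_on k UNIV (\<lambda>x::real^'n. exp_bump (q 0) (a * (x $ i) + b))"
  proof (rule Ck_coordinate[of "\<lambda>n. exp_bump (q n)"])
    show "(exp_bump (q n) has_real_derivative exp_bump (q (Suc n)) t) (at t)" for n t
      using exp_bump_deriv[of "q n" t] by (simp add: q_def)
  qed
  then show ?thesis by (simp add: q_def)
qed

lemma Ck_prod:
  fixes f :: "'i \<Rightarrow> real^'n \<Rightarrow> real"
  assumes "\<And>i. i \<in> I \<Longrightarrow> Ck_on k UNIV (f i)"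
  shows "Ck_on k UNIV (\<lambda>x. \<Prod>i\<in>I. f i x)"
  using assms by (induction I rule: infinite_finite_induct) (auto intro!: Ck_mult Ck_const)

lemma test_fun_differentiable: "test_fun U \<phi> \<Longrightarrow> \<phi> differentiable (at x)"
  unfolding test_fun_def smooth_fun_def by (metis Ck_on.simps(2) UNIV_I)

lemma test_fun_continuous: "test_fun U \<phi> \<Longrightarrow> continuous_on S \<phi>"
  by (meson continuous_at_imp_continuous_on differentiable_imp_continuous_within
      test_fun_differentiable)

lemma partial_deriv_outside:
  fixes \<phi> :: "real^'n \<Rightarrow> 'b::real_normed_vector"
  assumes "closed K" "\<And>x. x \<notin> K \<Longrightarrow> \<phi> x = 0" "x \<notin> K" shows "partial_deriv j \<phi> x = 0"
proof -
  have "((\<lambda>x. 0) has_derivative (\<lambda>h. 0)) (at x)" by simp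
  then have "(\<phi> has_derivative (\<lambda>h. 0)) (at x)"
    by (rule has_derivative_transform_within_open[of _ _ _ _ "- K"]) (use assms in auto)
  then show ?thesis by (simp add: partial_deriv_eq)
qed

lemma test_fun_partial_deriv: "test_fun U \<phi> \<Longrightarrow> test_fun U (partial_deriv j \<phi>)"
  unfolding test_fun_def smooth_fun_def
  by (metis Ck_on.simps(2) compact_imp_closed partial_deriv_outside)

lemma test_fun_add:
  assumes "test_fun U \<phi>" "test_fun U \<psi>" shows "test_fun U (\<lambda>x. \<phi> x + \<psi> x)"
proof -
  from assms obtain K L where "compact K" "K \<subseteq> U" "\<forall>x. x \<notin> K \<longrightarrow> \<phi> x = 0"
    "compact L" "L \<subseteq> U" "\<forall>x. x \<notin> L \<longrightarrow> \<psi> x = 0" by (auto simp: test_fun_def)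
  then show ?thesis using assms unfolding test_fun_def smooth_fun_def
    by (auto intro!: Ck_add exI[of _ "K \<union> L"])
qed

lemma test_fun_mult:
  assumes "test_fun U \<phi>" "smooth_fun \<psi>" shows "test_fun U (\<lambda>x. \<psi> x * \<phi> x)"
  using assms by (auto simp: test_fun_def smooth_fun_def intro!: Ck_mult)

lemma test_fun_cmult: "test_fun U \<phi> \<Longrightarrow> test_fun U (\<lambda>x. c * \<phi> x)"
  by (intro test_fun_mult) (auto simp: smooth_fun_def Ck_const)

lemma test_fun_zero: "test_fun U (\<lambda>x. 0)"
  by (auto simp: test_fun_def smooth_fun_def Ck_const)

text \<open>The support condition is asked pointwise, as \<open>x + h *\<^sub>R z \<in> U\<close>,
  because this is how cone and segment conditions are stated. It serves both for pure translations,
  with \<open>h = 1\<close>, and for shrinking a kernel by \<open>h = 1 / k\<close>.\<close>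

lemma test_fun_affine:
  assumes \<phi>: "test_fun Z \<phi>" and h: "h \<noteq> 0" and U: "\<And>z. z \<in> Z \<Longrightarrow> x + h *\<^sub>R z \<in> U"
  shows "test_fun U (\<lambda>y. \<phi> ((1 / h) *\<^sub>R (y - x)))"
proof -
  from \<phi> obtain K where K: "compact K" "K \<subseteq> Z" "\<forall>x. x \<notin> K \<longrightarrow> \<phi> x = 0" and s: "smooth_fun \<phi>"
    by (auto simp: test_fun_def)
  have "compact ((\<lambda>z. x + h *\<^sub>R z) ` K)"
    by (intro compact_continuous_image K continuous_intros)
  moreover have "(\<lambda>z. x + h *\<^sub>R z) ` K \<subseteq> U" using K U by auto
  moreover have "\<phi> ((1 / h) *\<^sub>R (y - x)) = 0" if "y \<notin> (\<lambda>z. x + h *\<^sub>R z) ` K" for y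
  proof -
    have "y = x + h *\<^sub>R ((1 / h) *\<^sub>R (y - x))" using h by simp
    then have "(1 / h) *\<^sub>R (y - x) \<notin> K" using that by blast
    then show ?thesis using K by blast
  qed
  moreover have "smooth_fun (\<lambda>y. \<phi> ((1 / h) *\<^sub>R (y - x)))"
    using s Ck_affine[of _ \<phi> "1 / h" "- (1 / h) *\<^sub>R x"]
        by (simp add: smooth_fun_def scaleR_diff_right)
  ultimately show ?thesis unfolding test_fun_def by blast
qed

lemma test_fun_bounded:
  assumes "test_fun U \<phi>" obtains M where "M \<ge> 0" "\<And>x. \<bar>\<phi> x\<bar> \<le> M"
proof -
  from assms obtain K where K: "compact K" "\<And>x. x \<notin> K \<Longrightarrow> \<phi> x = 0" by (auto simp: test_fun_def)
  have "bounded (\<phi> ` K)"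
    by (intro compact_imp_bounded compact_continuous_image K test_fun_continuous[OF assms])
  then obtain M where M: "\<And>x. x \<in> K \<Longrightarrow> \<bar>\<phi> x\<bar> \<le> M" by (auto simp: bounded_iff)
  show ?thesis
  proof (rule that[of "\<bar>M\<bar>"])
    show "\<bar>\<phi> x\<bar> \<le> \<bar>M\<bar>" for x
      using M[of x] K(2)[of x] by (cases "x \<in> K") auto
  qed simp
qed

text \<open>Each coordinate contributes one factor per face of the box. The factor \<open>n\<close>
  in the argument steepens the profile: \<open>exp (- 1 / (n c))\<close> tends to \<open>1\<close>
  for every \<open>c > 0\<close>, whereas outside the open box some factor is \<open>0\<close> for
  every \<open>n\<close>. Convergence to the indicator serves the fundamental lemma, positivity of
  \<open>\<psi> 1\<close> the normalisation of a kernel.\<close>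

lemma box_bumps:
  fixes a b :: "real^'n"
  obtains \<psi> :: "nat \<Rightarrow> real^'n \<Rightarrow> real" where
    "\<And>n. smooth_fun (\<psi> n)" "\<And>n x. x \<notin> cbox a b \<Longrightarrow> \<psi> n x = 0"
    "\<And>n x. 0 \<le> \<psi> n x" "\<And>n x. \<psi> n x \<le> 1"
    "\<And>x. (\<lambda>n. \<psi> n x) \<longlonglongrightarrow> indicator (box a b) x"
    "\<And>x. x \<in> box a b \<Longrightarrow> 0 < \<psi> 1 x"
proof -
  define \<psi> where "\<psi> n x = (\<Prod>i\<in>UNIV. exp_bump 1 (real n * x $ i + - real n * a $ i) *
      exp_bump 1 (- real n * x $ i + real n * b $ i))" for n and x :: "real^'n"
  have b01: "0 \<le> exp_bump 1 t" "exp_bump 1 t \<le> 1" for t by (auto simp: exp_bump_def)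
  have mem: "x \<in> box a b \<longleftrightarrow> (\<forall>i. a $ i < x $ i \<and> x $ i < b $ i)" for x by (simp add: mem_box_cart)
  have out: "\<psi> n x = 0" if "x \<notin> box a b" for n x
  proof -
    from that obtain i where "x $ i \<le> a $ i \<or> b $ i \<le> x $ i" by (auto simp: mem not_less)
    then have "real n * x $ i + - real n * a $ i \<le> 0 \<or> - real n * x $ i + real n * b $ i \<le> 0"
      by (auto intro: mult_left_mono)
    then have "exp_bump 1 (real n * x $ i + - real n * a $ i) * exp_bump 1 (- real n * x $ i
        + real n * b $ i) = 0"
      by (auto simp: exp_bump_def)
    then show ?thesis unfolding \<psi>_def by (intro prod_zero) auto
  qed
  show ?thesis
  proof (rule that[of \<psi>])
    show "smooth_fun (\<psi> n)" for n
      unfolding smooth_fun_def \<psi>_def by (intro allI Ck_prod Ck_mult exp_bump_coordinate_smooth)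
    show "\<psi> n x = 0" if "x \<notin> cbox a b" for n x
      using that box_subset_cbox[of a b] by (intro out) auto
    show "0 \<le> \<psi> n x" for n x unfolding \<psi>_def by (intro prod_nonneg ballI mult_nonneg_nonneg b01)
    show "\<psi> n x \<le> 1" for n x
      unfolding \<psi>_def by (intro prod_le_1 conjI mult_nonneg_nonneg mult_le_one b01)
    show "0 < \<psi> 1 x" if "x \<in> box a b" for x
      unfolding \<psi>_def using that by (intro prod_pos) (auto simp: mem exp_bump_def)
    show "(\<lambda>n. \<psi> n x) \<longlonglongrightarrow> indicator (box a b) x" for x
    proof (cases "x \<in> box a b")
      case False
      then show ?thesis by (simp add: out)
    next
      case True
      have one: "(\<lambda>n. exp_bump 1 (real n * c)) \<longlonglongrightarrow> 1" if c: "c > 0" for c :: real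
      proof -
        have "(\<lambda>n. exp (- (inverse c * inverse (real n)))) \<longlonglongrightarrow> exp (- (inverse c * 0))"
          by (intro tendsto_intros lim_inverse_n)
        then have "(\<lambda>n. exp (- (inverse c * inverse (real n)))) \<longlonglongrightarrow> 1" by simp
        then show ?thesis
          by (rule Lim_transform_eventually)
             (use c in \<open>auto simp: exp_bump_def eventually_sequentially divide_inverse intro!:
                 exI[of _ 1]\<close>)
      qed
      have "(\<lambda>n. \<psi> n x) \<longlonglongrightarrow> (\<Prod>i\<in>(UNIV::'n set). 1 * 1)"
        unfolding \<psi>_def
      proof (intro tendsto_prod tendsto_mult)
        fix i
        have "x $ i - a $ i > 0" "b $ i - x $ i > 0" using True by (auto simp: mem)
        from this[THEN one]
        show "(\<lambda>n. exp_bump 1 (real n * x $ i + - real n * a $ i)) \<longlonglongrightarrow> 1"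
          "(\<lambda>n. exp_bump 1 (- real n * x $ i + real n * b $ i)) \<longlonglongrightarrow> 1"
          by (simp_all add: algebra_simps)
      qed
      then show ?thesis using True by simp
    qed
  qed
qed

section \<open>The fundamental lemma of the calculus of variations\<close>

lemma open_lebesgue: "open U \<Longrightarrow> U \<in> sets lebesgue"
  by (simp add: sets_completionI_sets)

lemma AE_lebesgue_on_iff:
  "S \<in> sets lebesgue \<Longrightarrow> (AE x in lebesgue_on S. P x) \<longleftrightarrow> (AE x in lebesgue. x \<in> S \<longrightarrow> P x)"
  by (simp add: AE_restrict_space_iff)

lemma sigma_finite_lebesgue: "sigma_finite_measure (lebesgue :: 'a::euclidean_space measure)"
proof -
  obtain A :: "'a set set" where "countable A" "A \<subseteq> sets lborel" "\<Union>A = space lborel"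
    "\<forall>a\<in>A. emeasure lborel a \<noteq> \<infinity>"
    using lborel.sigma_finite_countable by blast
  note A = this
  have "A \<subseteq> sets lebesgue" using A(2) by (auto simp: sets_completionI_sets)
  moreover have "\<forall>a\<in>A. emeasure lebesgue a \<noteq> \<infinity>"
  proof
    fix a assume a: "a \<in> A"
    then have "a \<in> sets lborel" using A(2) by auto
    then have "emeasure lebesgue a = emeasure lborel a" by simp
    then show "emeasure lebesgue a \<noteq> \<infinity>" using A(4) a by simp
  qed
  ultimately show ?thesis
    using A(1,3) by (intro sigma_finite_measure.intro exI[of _ A]) simp
qed

text \<open>Rational corners keep the family countable, so that it can be enumerated when a spanning
  sequence is built, while it remains an intersection-stable generator of the Borel sets.\<close>

definition rational_boxes :: "(real^'n) set set" where
  "rational_boxes = {box a b | a b. (\<forall>i. a $ i \<in> \<rat>) \<and> (\<forall>i. b $ i \<in> \<rat>)}"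

lemma box_Int_box_cart:
  fixes a b c d :: "real^'n"
  shows "box a b \<inter> box c d = box (\<chi> i. max (a $ i) (c $ i)) (\<chi> i. min (b $ i) (d $ i))"
  by (auto simp: mem_box_cart)

lemma Int_stable_rational_boxes: "Int_stable rational_boxes"
proof (rule Int_stableI)
  fix A B :: "(real^'n) set" assume "A \<in> rational_boxes" "B \<in> rational_boxes"
  then obtain a b c d where "A = box a b" "B = box c d"
    "\<forall>i. a $ i \<in> \<rat>" "\<forall>i. b $ i \<in> \<rat>" "\<forall>i. c $ i \<in> \<rat>" "\<forall>i. d $ i \<in> \<rat>"
    unfolding rational_boxes_def by blast
  then show "A \<inter> B \<in> rational_boxes"
    unfolding rational_boxes_def
    by (intro CollectI exI[of _ "\<chi> i. max (a $ i) (c $ i)"] exI[of _ "\<chi> i. min (b $ i) (d $ i)"])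
       (simp add: box_Int_box_cart max_def min_def)
qed

lemma sets_borel_rational_boxes: "sets borel = sigma_sets UNIV (rational_boxes :: (real^'n) set
    set)"
proof
  have op: "S \<in> sigma_sets UNIV rational_boxes" if "open S" for S :: "(real^'n) set"
  proof -
    let ?a = "\<lambda>f :: real^'n \<Rightarrow> real \<times> real. (\<Sum>i\<in>Basis. fst (f i) *\<^sub>R i)"
    let ?b = "\<lambda>f :: real^'n \<Rightarrow> real \<times> real. (\<Sum>i\<in>Basis. snd (f i) *\<^sub>R i)"
    define I where "I = {f\<in>Basis \<rightarrow>\<^sub>E \<rat> \<times> \<rat>. box (?a f) (?b f) \<subseteq> S}"
    have eq: "S = (\<Union>f\<in>I. box (?a f) (?b f))"
      unfolding I_def by (rule open_UNION_box[OF that])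
    have "countable I"
      by (rule countable_subset[of _ "Basis \<rightarrow>\<^sub>E \<rat> \<times> \<rat>"])
         (auto simp: I_def countable_rat intro!: countable_PiE)
    moreover have "box (?a f) (?b f) \<in> rational_boxes" if "f \<in> I" for f
    proof -
      have "f (axis i 1) \<in> \<rat> \<times> \<rat>" for i
        using that by (auto simp: I_def axis_in_Basis_iff dest!: PiE_mem[where x = "axis i 1"])
      moreover have "?a f $ i = fst (f (axis i 1))" "?b f $ i = snd (f (axis i 1))" for i
        by (simp_all add: cart_eq_inner_axis axis_in_Basis_iff)
      ultimately have "?a f $ i \<in> \<rat>" "?b f $ i \<in> \<rat>" for i by (auto simp: mem_Times_iff)
      then show ?thesis unfolding rational_boxes_def by blast
    qed
    ultimately show ?thesis
      by (subst eq) (auto intro!: sigma_sets_UNION)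
  qed
  have "sigma_sets UNIV {S. open S} \<subseteq> sigma_sets UNIV (rational_boxes :: (real^'n) set set)"
    by (rule sigma_sets_mono) (use op in auto)
  then show "sets borel \<subseteq> sigma_sets UNIV (rational_boxes :: (real^'n) set set)"
    by (simp add: borel_def)
  show "sigma_sets UNIV (rational_boxes :: (real^'n) set set) \<subseteq> sets borel"
    by (rule sets.sigma_sets_subset[of _ borel, simplified]) (auto simp: rational_boxes_def)
qed

text \<open>The Borel sets over which \<open>f\<close> integrates to zero form a Dynkin system, and
  the boxes are an intersection-stable generator. A Lebesgue set differs from a Borel set by a null
  set, so \<open>f\<close> integrates to zero over every Lebesgue set and vanishes almost
  everywhere.\<close>

lemma AE_zero_if_rational_boxes:
  fixes f :: "real^'n \<Rightarrow> 'b::{banach, second_countable_topology}"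
  assumes f: "integrable lebesgue f"
    and box: "\<And>B. B \<in> rational_boxes \<Longrightarrow> (\<integral>x. indicator B x *\<^sub>R f x \<partial>lebesgue) = 0"
  shows "AE x in lebesgue. f x = 0"
proof -
  interpret sigma_finite_measure "lebesgue :: (real^'n) measure"
    by (rule sigma_finite_lebesgue)
  have si: "set_integrable lebesgue A f" if "A \<in> sets lebesgue" for A
    unfolding set_integrable_def by (rule integrable_mult_indicator[OF that f])
  have sb: "A \<in> sets lebesgue" if "A \<in> sets borel" for A :: "(real^'n) set"
    using that by (simp add: sets_completionI_sets)
  have rb: "B \<in> sets borel" if "B \<in> rational_boxes" for B :: "(real^'n) set"
    using that by (auto simp: rational_boxes_def)
  \<comment> \<open>Complements require the integral over the whole space, which is not a box; it is
    the limit of the integrals over growing cubes with integer corners.\<close>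
  have univ: "(LINT x:UNIV|lebesgue. f x) = 0"
  proof -
    define A :: "nat \<Rightarrow> (real^'n) set" where "A n = box (\<chi> i. - real n) (\<chi> i. real n)" for n
    have A: "A n \<in> (rational_boxes :: (real^'n) set set)" for n
      unfolding A_def rational_boxes_def by fastforce
    have U: "(\<Union>n. A n) = UNIV"
    proof -
      have "x \<in> (\<Union>n. A n)" for x :: "real^'n"
      proof -
        obtain n where n: "norm x < real n" using reals_Archimedean2 by blast
        have "\<bar>x $ i\<bar> < real n" for i using component_le_norm_cart[of x i] n by simp
        then have "- real n < x $ i" "x $ i < real n" for i
            by (auto simp: abs_less_iff minus_less_iff)
        then have "x \<in> A n" by (simp add: A_def mem_box_cart)
        then show ?thesis by blast
      qed
      then show ?thesis by blast
    qed
    have "(\<lambda>n. LINT x:A n|lebesgue. f x) \<longlonglongrightarrow> (LINT x:(\<Union>n. A n)|lebesgue. f x)"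
    proof (rule set_integral_cont_up)
      show "incseq A"
      proof (rule incseq_SucI, rule subsetI)
        fix n and x :: "real^'n" assume x: "x \<in> A n"
        have "- real (Suc n) < x $ i \<and> x $ i < real (Suc n)" for i
          using x by (auto simp: A_def mem_box_cart dest!: spec[of _ i])
        then show "x \<in> A (Suc n)" by (simp add: A_def mem_box_cart)
      qed
      show "A n \<in> sets lebesgue" for n by (rule sb[OF rb[OF A]])
      show "set_integrable lebesgue (\<Union>n. A n) f" unfolding U by (rule si) simp
    qed
    moreover have "(LINT x:A n|lebesgue. f x) = 0" for n
      using box[OF A[of n]] by (simp add: set_lebesgue_integral_def)
    ultimately show ?thesis unfolding U by (simp add: LIMSEQ_const_iff)
  qed
  have sub: "rational_boxes \<subseteq> Pow (UNIV :: (real^'n) set)" by simp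
  have borel_zero: "(LINT x:A|lebesgue. f x) = 0" if "A \<in> sets borel" for A
    using that unfolding sets_borel_rational_boxes
  proof (induction A rule: sigma_sets_induct_disjoint[OF Int_stable_rational_boxes sub, consumes
      1, case_names basic empty compl union])
    case (basic A)
    then show ?case using box by (simp add: set_lebesgue_integral_def)
  next
    case empty
    then show ?case by (simp add: set_lebesgue_integral_def)
  next
    case (compl A)
    have A: "A \<in> sets lebesgue" by (rule sb) (use compl(1) in \<open>simp add: sets_borel_rational_boxes\<close>)
    have "(LINT x:(UNIV - A)|lebesgue. f x) = (LINT x|lebesgue. indicator UNIV x *\<^sub>R f x
        - indicator A x *\<^sub>R f x)"
      unfolding set_lebesgue_integral_def
      by (intro Bochner_Integration.integral_cong) (auto simp: indicator_def)
    also have "\<dots> = (LINT x:UNIV|lebesgue. f x) - (LINT x:A|lebesgue. f x)"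
      unfolding set_lebesgue_integral_def
      by (rule Bochner_Integration.integral_diff)
         (use si[OF A] f in \<open>simp_all add: set_integrable_def\<close>)
    finally show ?case using univ compl(2) by simp
  next
    case (union A)
    have A: "A i \<in> sets lebesgue" for i
      by (rule sb) (use union(2) in \<open>auto simp: sets_borel_rational_boxes\<close>)
    have "(LINT x:(\<Union>i. A i)|lebesgue. f x) = (\<Sum>i. LINT x:A i|lebesgue. f x)"
    proof (rule lebesgue_integral_countable_add)
      show "A i \<inter> A j = {}" if "i \<noteq> j" for i j
        using union(1) that by (auto simp: disjoint_family_on_def)
      show "set_integrable lebesgue (\<Union>i. A i) f" by (rule si) (use A in auto)
    qed (rule A)
    then show ?case using union(3) by simp
  qed
  show ?thesis
  proof (rule density_zero[OF f])
    fix A :: "(real^'n) set" assume A: "A \<in> sets lebesgue"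
    then obtain S N N' where *: "A = S \<union> N" "N \<subseteq> N'" "N' \<in> null_sets lborel" "S \<in> sets lborel"
      by (rule sets_completionE)
    then have S: "S \<in> sets lebesgue" by (auto intro: sb)
    have N': "N' \<in> null_sets lebesgue" using *(3) by (rule null_sets_completionI)
    have "(LINT x:A|lebesgue. f x) = (LINT x:S|lebesgue. f x)"
    proof (rule set_integral_cong_set)
      show "set_borel_measurable lebesgue S f" "set_borel_measurable lebesgue A f"
        using si[OF A] si[OF S] unfolding set_borel_measurable_def set_integrable_def
        by (auto dest: borel_measurable_integrable)
      show "AE x in lebesgue. (x \<in> S) = (x \<in> A)"
        using AE_not_in[OF N'] by eventually_elim (use * in blast)
    qed
    then show "(LINT x:A|lebesgue. f x) = 0" using borel_zero * by simp
  qed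
qed

lemma loc_integrable_indicator:
  fixes w :: "real^'n \<Rightarrow> 'b::euclidean_space"
  assumes "loc_integrable U w" "compact K" "K \<subseteq> U"
  shows "integrable lebesgue (\<lambda>x. indicator K x *\<^sub>R w x)"
  using assms integrable_restrict_space[of K lebesgue w]
  by (simp add: loc_integrable_def sets_completionI_sets borel_compact)

lemma test_integrable:
  fixes w :: "real^'n \<Rightarrow> 'b::euclidean_space"
  assumes w: "loc_integrable U w" and \<phi>: "test_fun U \<phi>"
  shows "integrable lebesgue (\<lambda>x. \<phi> x *\<^sub>R w x)"
proof -
  obtain K where K: "compact K" "K \<subseteq> U" "\<And>x. x \<notin> K \<Longrightarrow> \<phi> x = 0"
    using \<phi> by (auto simp: test_fun_def)
  obtain M where M: "\<And>x. \<bar>\<phi> x\<bar> \<le> M" using test_fun_bounded[OF \<phi>] by blast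
  have i: "integrable lebesgue (\<lambda>x. indicator K x *\<^sub>R w x)"
    using loc_integrable_indicator[OF w K(1,2)] .
  have "\<phi> \<in> borel_measurable borel"
    by (rule borel_measurable_continuous_onI[OF test_fun_continuous[OF \<phi>]])
  then have m: "\<phi> \<in> borel_measurable lebesgue" by (simp add: measurable_completion)
  \<comment> \<open>\<open>w\<close> is known to be integrable over \<open>K\<close> and may be
    arbitrary elsewhere; since \<open>\<phi>\<close> vanishes off \<open>K\<close>, the indicator
    may be inserted.\<close>
  have "integrable lebesgue (\<lambda>x. \<phi> x *\<^sub>R (indicator K x *\<^sub>R w x))"
  proof (rule Bochner_Integration.integrable_bound[of _ "\<lambda>x. M *\<^sub>R (indicator K x *\<^sub>R w x)"])
    show "integrable lebesgue (\<lambda>x. M *\<^sub>R (indicator K x *\<^sub>R w x))"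
      using i by (rule integrable_scaleR_right)
    show "(\<lambda>x. \<phi> x *\<^sub>R (indicator K x *\<^sub>R w x)) \<in> borel_measurable lebesgue"
      using m borel_measurable_integrable[OF i] by (rule borel_measurable_scaleR)
    show "AE x in lebesgue. norm (\<phi> x *\<^sub>R (indicator K x *\<^sub>R w x))
        \<le> norm (M *\<^sub>R (indicator K x *\<^sub>R w x))"
    proof (rule AE_I2)
      fix x
      have "\<bar>\<phi> x\<bar> \<le> \<bar>M\<bar>" using M[of x] by simp
      then show "norm (\<phi> x *\<^sub>R (indicator K x *\<^sub>R w x)) \<le> norm (M *\<^sub>R (indicator K x *\<^sub>R w x))"
        unfolding norm_scaleR[of "\<phi> x"] norm_scaleR[of M] by (rule mult_right_mono) simp
    qed
  qed
  moreover have "(\<lambda>x. \<phi> x *\<^sub>R (indicator K x *\<^sub>R w x)) = (\<lambda>x. \<phi> x *\<^sub>R w x)"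
  proof
    show "\<phi> x *\<^sub>R (indicator K x *\<^sub>R w x) = \<phi> x *\<^sub>R w x" for x
      using K(3)[of x] by (cases "x \<in> K") auto
  qed
  ultimately show ?thesis by simp
qed

text \<open>Pairings with test functions can thus be taken over the whole space, where translations
  act.\<close>

lemma test_integral:
  fixes w :: "real^'n \<Rightarrow> 'b::euclidean_space"
  assumes "open U" "test_fun U \<phi>"
  shows "(\<integral>x. \<phi> x *\<^sub>R w x \<partial>lebesgue_on U) = (\<integral>x. \<phi> x *\<^sub>R w x \<partial>lebesgue)"
proof -
  have out: "\<phi> x = 0" if "x \<notin> U" for x using assms(2) that by (auto simp: test_fun_def)
  have "(\<lambda>x. indicator U x *\<^sub>R (\<phi> x *\<^sub>R w x)) = (\<lambda>x. \<phi> x *\<^sub>R w x)"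
  proof
    show "indicator U x *\<^sub>R (\<phi> x *\<^sub>R w x) = \<phi> x *\<^sub>R w x" for x
      using out[of x] by (cases "x \<in> U") auto
  qed
  then show ?thesis using integral_restrict_space[of U lebesgue "\<lambda>x. \<phi> x *\<^sub>R w x"] assms(1)
    by (simp add: open_lebesgue)
qed

text \<open>Inside a closed box contained in \<open>U\<close> the bumps of smaller boxes are test
  functions; their limit turns the hypothesis into vanishing integrals over boxes. Countably many
  closed boxes cover \<open>U\<close>, so the exceptional null sets can be united.\<close>

lemma fundamental_lemma:
  fixes w :: "real^'n \<Rightarrow> 'b::euclidean_space"
  assumes U: "open U" and w: "loc_integrable U w"
    and zero: "\<And>\<phi>. test_fun U \<phi> \<Longrightarrow> (\<integral>x. \<phi> x *\<^sub>R w x \<partial>lebesgue) = 0"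
  shows "AE x in lebesgue_on U. w x = 0"
proof -
  have cb: "AE x in lebesgue. x \<in> cbox c d \<longrightarrow> w x = 0" if cd: "cbox c d \<subseteq> U" for c d
  proof -
    have i: "integrable lebesgue (\<lambda>x. indicator (cbox c d) x *\<^sub>R w x)"
      by (rule loc_integrable_indicator[OF w _ cd]) simp
    have "AE x in lebesgue. indicator (cbox c d) x *\<^sub>R w x = 0"
    proof (rule AE_zero_if_rational_boxes[OF i])
      fix B :: "(real^'n) set" assume "B \<in> rational_boxes"
      then obtain a b where B: "B = box a b" by (auto simp: rational_boxes_def)
      \<comment> \<open>The rational box \<open>B\<close> may stick out of \<open>cbox c d\<close>;
        the bumps are built for the intersection of the open boxes, with corners \<open>e\<close>
        and \<open>g\<close>.\<close>
      define e where "e = (\<chi> i. max (a $ i) (c $ i))"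
      define g where "g = (\<chi> i. min (b $ i) (d $ i))"
      have sub: "cbox e g \<subseteq> cbox c d" by (auto simp: e_def g_def mem_box_cart)
      have Int: "box a b \<inter> box c d = box e g" unfolding e_def g_def by (rule box_Int_box_cart)
      obtain \<psi> :: "nat \<Rightarrow> real^'n \<Rightarrow> real" where \<psi>: "\<And>n. smooth_fun (\<psi> n)"
        "\<And>n x. x \<notin> cbox e g \<Longrightarrow> \<psi> n x = 0" "\<And>n x. 0 \<le> \<psi> n x" "\<And>n x. \<psi> n x \<le> 1"
        "\<And>x. (\<lambda>n. \<psi> n x) \<longlonglongrightarrow> indicator (box e g) x"
        using box_bumps[of e g] by metis
      have t: "test_fun U (\<psi> n)" for n
        unfolding test_fun_def using \<psi>(1,2) sub cd by (intro conjI exI[of _ "cbox e g"]) auto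
      have eq: "\<psi> n x *\<^sub>R w x = \<psi> n x *\<^sub>R (indicator (cbox c d) x *\<^sub>R w x)" for n x
        using \<psi>(2)[of x n] sub by (auto simp: indicator_def)
      have "(\<lambda>n. \<integral>x. \<psi> n x *\<^sub>R w x \<partial>lebesgue) \<longlonglongrightarrow> (\<integral>x. indicator (box e g) x *\<^sub>R (indicator (cbox c
          d) x *\<^sub>R w x) \<partial>lebesgue)"
      proof (rule integral_dominated_convergence[where w
          = "\<lambda>x. norm (indicator (cbox c d) x *\<^sub>R w x)"])
        show "integrable lebesgue (\<lambda>x. norm (indicator (cbox c d) x *\<^sub>R w x))"
          using i by (rule integrable_norm)
        show "(\<lambda>x. \<psi> n x *\<^sub>R w x) \<in> borel_measurable lebesgue" for n
          using test_integrable[OF w t] by (rule borel_measurable_integrable)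
        show "(\<lambda>x. indicator (box e g) x *\<^sub>R (indicator (cbox c d) x *\<^sub>R w x)) \<in> borel_measurable
            lebesgue"
          by (rule borel_measurable_integrable[OF integrable_mult_indicator[OF _ i]])
             (simp add: sets_completionI_sets)
        show "AE x in lebesgue. (\<lambda>n. \<psi> n x *\<^sub>R w x)
            \<longlonglongrightarrow> indicator (box e g) x *\<^sub>R (indicator (cbox c d) x *\<^sub>R w x)"
          unfolding eq by (intro AE_I2 tendsto_intros \<psi>)
        show "AE x in lebesgue. norm (\<psi> n x *\<^sub>R w x) \<le> norm (indicator (cbox c d) x *\<^sub>R w x)" for n
        proof (rule AE_I2)
          fix x
          show "norm (\<psi> n x *\<^sub>R w x) \<le> norm (indicator (cbox c d) x *\<^sub>R w x)"
            unfolding eq norm_scaleR[of "\<psi> n x"] using \<psi>(3,4)[of n x]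
            by (intro mult_left_le_one_le) auto
        qed
      qed
      then have 0: "(\<integral>x. indicator (box e g) x *\<^sub>R (indicator (cbox c d) x *\<^sub>R w x) \<partial>lebesgue) = 0"
        using zero[OF t] by (simp add: LIMSEQ_const_iff)
      \<comment> \<open>On \<open>cbox c d\<close> the indicators of \<open>B\<close> and of
        \<open>box e g\<close> agree except on its boundary, which is negligible.\<close>
      have "AE x in lebesgue. x \<notin> cbox c d - box c d"
        using negligible_frontier_interval[of c d] unfolding negligible_iff_null_sets
            by (rule AE_not_in)
      then have ae: "AE x in lebesgue. indicator B x *\<^sub>R (indicator (cbox c d) x *\<^sub>R w x) =
          indicator (box e g) x *\<^sub>R (indicator (cbox c d) x *\<^sub>R w x)"
      proof eventually_elim
        case (elim x)
        then show ?case using Int by (cases "x \<in> cbox c d") (auto simp: B indicator_def)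
      qed
      have bl: "box p q \<in> sets lebesgue" for p q :: "real^'n" by (simp add: sets_completionI_sets)
      have "(\<integral>x. indicator B x *\<^sub>R (indicator (cbox c d) x *\<^sub>R w x) \<partial>lebesgue) =
          (\<integral>x. indicator (box e g) x *\<^sub>R (indicator (cbox c d) x *\<^sub>R w x) \<partial>lebesgue)"
        unfolding B
        by (intro integral_cong_AE borel_measurable_integrable integrable_mult_indicator[OF bl i])
           (rule ae[unfolded B])
      then show "(\<integral>x. indicator B x *\<^sub>R (indicator (cbox c d) x *\<^sub>R w x) \<partial>lebesgue) = 0"
        using 0 by simp
    qed
    then show ?thesis by eventually_elim auto
  qed
  obtain \<D> where D: "countable \<D>" "\<D> \<subseteq> Pow U"
    "\<And>X. X \<in> \<D> \<Longrightarrow> \<exists>a b. X = cbox a b" "\<Union>\<D> = U"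
    by (rule open_countable_Union_open_cbox[OF U], rule that)
  have "AE x in lebesgue. \<forall>X\<in>\<D>. x \<in> X \<longrightarrow> w x = 0"
  proof (subst AE_ball_countable[OF D(1)], rule ballI)
    fix X assume X: "X \<in> \<D>"
    obtain a b where ab: "X = cbox a b" using D(3)[OF X] by blast
    have "cbox a b \<subseteq> U" using D(2) X ab by auto
    then show "AE x in lebesgue. x \<in> X \<longrightarrow> w x = 0" unfolding ab by (rule cb)
  qed
  then have "AE x in lebesgue. x \<in> U \<longrightarrow> w x = 0"
  proof eventually_elim
    case (elim x)
    show ?case
    proof
      assume "x \<in> U"
      then obtain X where "X \<in> \<D>" "x \<in> X" using D(4) by auto
      then show "w x = 0" using elim by blast
    qed
  qed
  then show ?thesis by (simp add: AE_lebesgue_on_iff[OF open_lebesgue[OF U]])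
qed

section \<open>Weak derivatives and the first-order Sobolev space\<close>

text \<open>Completeness of Lebesgue measure. It makes functions measurable that are determined only
  up to null sets, such as \<open>weak_partial\<close>.\<close>

lemma borel_measurable_on_AE:
  fixes f g :: "real^'n \<Rightarrow> 'b::euclidean_space"
  assumes S: "S \<in> sets lebesgue" and f: "f \<in> borel_measurable (lebesgue_on S)"
    and eq: "AE x in lebesgue_on S. f x = g x"
  shows "g \<in> borel_measurable (lebesgue_on S)"
proof -
  have "(\<lambda>x. indicator S x *\<^sub>R f x) \<in> borel_measurable lebesgue"
    using f S by (simp add: borel_measurable_restrict_space_iff)
  moreover have "AE x in lebesgue. indicator S x *\<^sub>R f x = indicator S x *\<^sub>R g x"
    using eq unfolding AE_lebesgue_on_iff[OF S] by eventually_elim (auto simp: indicator_def)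
  ultimately have "(\<lambda>x. indicator S x *\<^sub>R g x) \<in> borel_measurable lebesgue"
    by (rule borel_measurable_AE)
  then show ?thesis using S by (simp add: borel_measurable_restrict_space_iff)
qed

lemma AE_lebesgue_on_subset:
  assumes "AE x in lebesgue_on S. P x" "T \<subseteq> S" "S \<in> sets lebesgue" "T \<in> sets lebesgue"
  shows "AE x in lebesgue_on T. P x"
  using assms(1) unfolding AE_lebesgue_on_iff[OF assms(3)] AE_lebesgue_on_iff[OF assms(4)]
  by eventually_elim (use assms(2) in auto)

lemma loc_integrable_cong:
  fixes u :: "real^'n \<Rightarrow> 'b::euclidean_space"
  assumes U: "open U" and u: "loc_integrable U u" and eq: "AE x in lebesgue_on U. u x = v x"
  shows "loc_integrable U v"
  unfolding loc_integrable_def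
proof (intro allI impI)
  fix K assume K: "compact K \<and> K \<subseteq> U"
  then have KL: "K \<in> sets lebesgue" by (simp add: sets_completionI_sets borel_compact)
  have i: "integrable (lebesgue_on K) u" using u K by (simp add: loc_integrable_def)
  have ae: "AE x in lebesgue_on K. u x = v x"
    by (rule AE_lebesgue_on_subset[OF eq _ open_lebesgue[OF U] KL]) (use K in auto)
  show "integrable (lebesgue_on K) v"
    by (rule integrable_cong_AE_imp[OF i borel_measurable_on_AE[OF KL
        borel_measurable_integrable[OF i] ae]])
       (use ae in eventually_elim, simp)
qed

lemma has_weak_partial_iff:
  fixes u v :: "real^'n \<Rightarrow> 'b::euclidean_space"
  assumes "open U"
  shows "has_weak_partial U j u v \<longleftrightarrow> loc_integrable U u \<and> loc_integrable U v \<and>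
    (\<forall>\<phi>. test_fun U \<phi> \<longrightarrow> (\<integral>x. partial_deriv j \<phi> x *\<^sub>R u x \<partial>lebesgue)
        = - (\<integral>x. \<phi> x *\<^sub>R v x \<partial>lebesgue))"
  unfolding has_weak_partial_def
  by (auto simp: test_integral[OF assms] test_integral[OF assms test_fun_partial_deriv])

lemma test_integral_cong:
  fixes u v :: "real^'n \<Rightarrow> 'b::euclidean_space"
  assumes U: "open U" and u: "loc_integrable U u" and eq: "AE x in lebesgue_on U. u x
      = v x" and \<phi>: "test_fun U \<phi>"
  shows "(\<integral>x. \<phi> x *\<^sub>R u x \<partial>lebesgue) = (\<integral>x. \<phi> x *\<^sub>R v x \<partial>lebesgue)"
proof (rule integral_cong_AE)
  show "(\<lambda>x. \<phi> x *\<^sub>R u x) \<in> borel_measurable lebesgue"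
      "(\<lambda>x. \<phi> x *\<^sub>R v x) \<in> borel_measurable lebesgue"
    using test_integrable[OF u \<phi>] test_integrable[OF loc_integrable_cong[OF U u eq] \<phi>] by auto
  show "AE x in lebesgue. \<phi> x *\<^sub>R u x = \<phi> x *\<^sub>R v x"
    using eq unfolding AE_lebesgue_on_iff[OF open_lebesgue[OF U]]
    by eventually_elim (use \<phi> in \<open>auto simp: test_fun_def\<close>)
qed

lemma has_weak_partial_cong:
  fixes u v :: "real^'n \<Rightarrow> 'b::euclidean_space"
  assumes U: "open U" and h: "has_weak_partial U j u v"
    and u: "AE x in lebesgue_on U. u x = u' x" and v: "AE x in lebesgue_on U. v x = v' x"
  shows "has_weak_partial U j u' v'"
proof -
  have l: "loc_integrable U u" "loc_integrable U v" using h by (auto simp: has_weak_partial_def)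
  show ?thesis
    using h l loc_integrable_cong[OF U l(1) u] loc_integrable_cong[OF U l(2) v]
      test_integral_cong[OF U l(1) u test_fun_partial_deriv] test_integral_cong[OF U l(2) v]
    unfolding has_weak_partial_iff[OF U] by simp
qed

lemma loc_integrable_add:
  fixes u v :: "real^'n \<Rightarrow> 'b::euclidean_space"
  shows "loc_integrable U u \<Longrightarrow> loc_integrable U v \<Longrightarrow> loc_integrable U (\<lambda>x. u x + v x)"
  by (simp add: loc_integrable_def)

lemma loc_integrable_cmult: "loc_integrable U u \<Longrightarrow> loc_integrable U (\<lambda>x. (c::complex) * u x)"
  by (simp add: loc_integrable_def)

lemma has_weak_partial_add:
  fixes u v u' v' :: "real^'n \<Rightarrow> 'b::euclidean_space"
  assumes "open U" "has_weak_partial U j u v" "has_weak_partial U j u' v'"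
  shows "has_weak_partial U j (\<lambda>x. u x + u' x) (\<lambda>x. v x + v' x)"
  using assms(2,3) unfolding has_weak_partial_iff[OF assms(1)]
  by (auto simp: scaleR_add_right test_integrable test_fun_partial_deriv intro!: loc_integrable_add)

lemma has_weak_partial_cmult:
  fixes u v :: "real^'n \<Rightarrow> complex"
  assumes "open U" "has_weak_partial U j u v"
  shows "has_weak_partial U j (\<lambda>x. c * u x) (\<lambda>x. c * v x)"
  using assms(2) unfolding has_weak_partial_iff[OF assms(1)]
  by (auto simp flip: mult_scaleR_right intro!: loc_integrable_cmult)

text \<open>Both candidates have the same pairing with every test function, so the fundamental lemma
  applies to their difference.\<close>

lemma has_weak_partial_unique:
  fixes u v :: "real^'n \<Rightarrow> complex"
  assumes U: "open U" and v: "has_weak_partial U j u v" and w: "has_weak_partial U j u w"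
  shows "AE x in lebesgue_on U. v x = w x"
proof -
  have l: "loc_integrable U v" "loc_integrable U w"
    using v w by (auto simp: has_weak_partial_def)
  have l': "loc_integrable U (\<lambda>x. v x + (-1) * w x)"
    by (intro loc_integrable_add loc_integrable_cmult l)
  have "AE x in lebesgue_on U. v x + (-1) * w x = 0"
  proof (rule fundamental_lemma[OF U l'])
    fix \<phi> assume \<phi>: "test_fun U \<phi>"
    have "(\<integral>x. \<phi> x *\<^sub>R v x \<partial>lebesgue) = (\<integral>x. \<phi> x *\<^sub>R w x \<partial>lebesgue)"
      using v w \<phi> unfolding has_weak_partial_iff[OF U] by fastforce
    then show "(\<integral>x. \<phi> x *\<^sub>R (v x + (-1) * w x) \<partial>lebesgue) = 0"
      using test_integrable[OF l(1) \<phi>] test_integrable[OF l(2) \<phi>] by (simp add: scaleR_diff_right)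
  qed
  then show ?thesis by eventually_elim simp
qed

lemma L2_on_iff:
  assumes "S \<in> sets lebesgue"
  shows "u \<in> L2 (lebesgue_on S) \<longleftrightarrow> (\<lambda>x. indicator S x *\<^sub>R u x) \<in> L2 lebesgue"
proof -
  have "(\<lambda>x. (norm (indicator S x *\<^sub>R u x))\<^sup>2) = (\<lambda>x. indicator S x *\<^sub>R (norm (u x))\<^sup>2)"
    by (auto simp: indicator_def)
  then show ?thesis
    using assms by (simp add: L2_def borel_measurable_restrict_space_iff integrable_restrict_space)
qed

lemma L2_norm_on:
  assumes "S \<in> sets lebesgue"
  shows "L2_norm (lebesgue_on S) u = L2_norm lebesgue (\<lambda>x. indicator S x *\<^sub>R u x)"
proof -
  have "(\<lambda>x. (norm (indicator S x *\<^sub>R u x))\<^sup>2) = (\<lambda>x. indicator S x *\<^sub>R (norm (u x))\<^sup>2)"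
    by (auto simp: indicator_def)
  then show ?thesis
    using assms by (simp add: L2_norm_def integral_restrict_space)
qed

lemma L2_on_subset:
  assumes "S \<in> sets lebesgue" "T \<in> sets lebesgue" "T \<subseteq> S" "u \<in> L2 (lebesgue_on S)"
  shows "u \<in> L2 (lebesgue_on T)" "L2_norm (lebesgue_on T) u \<le> L2_norm (lebesgue_on S) u"
proof -
  have S: "(\<lambda>x. indicator S x *\<^sub>R u x) \<in> L2 lebesgue" using assms L2_on_iff by blast
  have "(\<lambda>x. indicator T x *\<^sub>R (indicator S x *\<^sub>R u x)) \<in> borel_measurable lebesgue"
    using L2_measurable[OF S] assms(2) by measurable
  moreover have "(\<lambda>x. indicator T x *\<^sub>R (indicator S x *\<^sub>R u x)) = (\<lambda>x. indicator T x *\<^sub>R u x)"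
  proof
    show "indicator T x *\<^sub>R (indicator S x *\<^sub>R u x) = indicator T x *\<^sub>R u x" for x
      using assms(3) by (cases "x \<in> T") auto
  qed
  ultimately have m: "(\<lambda>x. indicator T x *\<^sub>R u x) \<in> borel_measurable lebesgue" by simp
  have le: "AE x in lebesgue. norm (indicator T x *\<^sub>R u x) \<le> norm (indicator S x *\<^sub>R u x)"
    using assms(3) by (auto simp: indicator_def)
  show "u \<in> L2 (lebesgue_on T)" "L2_norm (lebesgue_on T) u \<le> L2_norm (lebesgue_on S) u"
    using L2_norm_mono[OF m S le] by (simp_all add: L2_on_iff L2_norm_on assms)
qed

lemma L2_loc_integrable:
  assumes "open U" "u \<in> L2 (lebesgue_on U)" shows "loc_integrable U u"
  unfolding loc_integrable_def
proof (intro allI impI)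
  fix K assume K: "compact K \<and> K \<subseteq> U"
  have "u \<in> L2 (lebesgue_on K)"
    by (rule L2_on_subset(1)[OF open_lebesgue[OF assms(1)] _ _ assms(2)])
       (use K in \<open>auto simp: sets_completionI_sets borel_compact\<close>)
  moreover have "finite_measure (lebesgue_on K)"
    using K by (intro finite_measure_lebesgue_on lmeasurable_compact) auto
  ultimately show "integrable (lebesgue_on K) u" using L2_integrable(1) by blast
qed

lemma test_fun_measurable: "test_fun U \<phi> \<Longrightarrow> \<phi> \<in> borel_measurable (lebesgue_on S)"
  by (intro measurable_restrict_space1 measurable_completion)
     (simp add: borel_measurable_continuous_onI test_fun_continuous)

lemma test_fun_L2:
  assumes \<phi>: "test_fun U \<phi>" and S: "S \<in> sets lebesgue"
  shows "(\<lambda>x. complex_of_real (\<phi> x)) \<in> L2 (lebesgue_on S)"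
proof -
  have one: "loc_integrable U (\<lambda>x. 1 :: real)"
    unfolding loc_integrable_def
  proof (intro allI impI)
    fix K assume "compact K \<and> K \<subseteq> U"
    then interpret finite_measure "lebesgue_on K"
      by (intro finite_measure_lebesgue_on lmeasurable_compact) auto
    show "integrable (lebesgue_on K) (\<lambda>x. 1 :: real)" by simp
  qed
  have "test_fun U (\<lambda>x. \<phi> x * \<phi> x)" using \<phi> by (intro test_fun_mult) (auto simp: test_fun_def)
  from test_integrable[OF one this] have i: "integrable lebesgue (\<lambda>x. (\<phi> x)\<^sup>2)"
    by (simp add: power2_eq_square)
  have "integrable (lebesgue_on S) (\<lambda>x. (\<phi> x)\<^sup>2)"
    using integrable_mult_indicator[OF S i] S by (simp add: integrable_restrict_space)
  then show ?thesis
    unfolding L2_def using test_fun_measurable[OF \<phi>] by simp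
qed

lemma test_pairing_bound:
  assumes U: "open U" and u: "u \<in> L2 (lebesgue_on U)" and \<phi>: "test_fun U \<phi>"
  shows "norm (\<integral>x. \<phi> x *\<^sub>R u x \<partial>lebesgue) \<le> L2_norm (lebesgue_on U) (\<lambda>x. of_real (\<phi> x))
      * L2_norm (lebesgue_on U) u"
proof -
  let ?M = "lebesgue_on U"
  have p: "(\<lambda>x. complex_of_real \<bar>\<phi> x\<bar>) \<in> L2 ?M"
    using test_fun_L2[OF \<phi> open_lebesgue[OF U]] test_fun_measurable[OF \<phi>, of U]
    by (simp add: L2_def)
  have n: "(\<lambda>x. complex_of_real (norm (u x))) \<in> L2 ?M"
    using u by (auto simp: L2_def)
  have "norm (\<integral>x. \<phi> x *\<^sub>R u x \<partial>?M) \<le> (\<integral>x. norm (\<phi> x *\<^sub>R u x) \<partial>?M)"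
    by (rule integral_norm_bound)
  also have "\<dots> = ip ?M (\<lambda>x. of_real \<bar>\<phi> x\<bar>) (\<lambda>x. of_real (norm (u x)))"
    by (simp add: ip_def inner_complex_def)
  also have "\<dots> \<le> L2_norm ?M (\<lambda>x. of_real \<bar>\<phi> x\<bar>) * L2_norm ?M (\<lambda>x. of_real (norm (u x)))"
    using ip_bound[OF p n] by simp
  also have "\<dots> = L2_norm ?M (\<lambda>x. of_real (\<phi> x)) * L2_norm ?M u"
    by (simp add: L2_norm_def)
  finally show ?thesis by (simp add: test_integral[OF U \<phi>])
qed

lemma tendsto_test_pairing:
  assumes U: "open U" and X: "\<And>n. X n \<in> L2 (lebesgue_on U)" and w: "w \<in> L2 (lebesgue_on U)"
    and lim: "(\<lambda>n. L2_norm (lebesgue_on U) (\<lambda>x. X n x - w x)) \<longlonglongrightarrow> 0" and \<phi>: "test_fun U \<phi>"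
  shows "(\<lambda>n. \<integral>x. \<phi> x *\<^sub>R X n x \<partial>lebesgue) \<longlonglongrightarrow> (\<integral>x. \<phi> x *\<^sub>R w x \<partial>lebesgue)"
proof (rule LIM_zero_cancel, rule Lim_null_comparison)
  let ?M = "lebesgue_on U"
  show "\<forall>\<^sub>F n in sequentially. norm ((\<integral>x. \<phi> x *\<^sub>R X n x \<partial>lebesgue) - (\<integral>x. \<phi> x *\<^sub>R w x \<partial>lebesgue)) \<le>
      L2_norm ?M (\<lambda>x. of_real (\<phi> x)) * L2_norm ?M (\<lambda>x. X n x - w x)"
  proof (rule always_eventually, rule allI)
    fix n
    have "(\<integral>x. \<phi> x *\<^sub>R X n x \<partial>lebesgue) - (\<integral>x. \<phi> x *\<^sub>R w x \<partial>lebesgue)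
        = (\<integral>x. \<phi> x *\<^sub>R (X n x - w x) \<partial>lebesgue)"
      using test_integrable[OF L2_loc_integrable[OF U X] \<phi>] test_integrable[OF
          L2_loc_integrable[OF U w] \<phi>]
      by (simp add: scaleR_diff_right)
    then show "norm ((\<integral>x. \<phi> x *\<^sub>R X n x \<partial>lebesgue) - (\<integral>x. \<phi> x *\<^sub>R w x \<partial>lebesgue)) \<le>
      L2_norm ?M (\<lambda>x. of_real (\<phi> x)) * L2_norm ?M (\<lambda>x. X n x - w x)"
      using test_pairing_bound[OF U l2.diff_mem[OF X w] \<phi>] by simp
  qed
  show "(\<lambda>n. L2_norm ?M (\<lambda>x. of_real (\<phi> x)) * L2_norm ?M (\<lambda>x. X n x - w x)) \<longlonglongrightarrow> 0"
    using tendsto_mult_left[OF lim] by simp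
qed

text \<open>Closedness of weak differentiation: both sides of the defining identity are continuous
  in \<open>L2\<close>, because a fixed test function and its derivatives are square
  integrable.\<close>

lemma has_weak_partial_limit:
  assumes U: "open U" and h: "\<And>n. has_weak_partial U j (X n) (Y n)"
    and X: "\<And>n. X n \<in> L2 (lebesgue_on U)" "w \<in> L2 (lebesgue_on U)"
       "(\<lambda>n. L2_norm (lebesgue_on U) (\<lambda>x. X n x - w x)) \<longlonglongrightarrow> 0"
    and Y: "\<And>n. Y n \<in> L2 (lebesgue_on U)" "z \<in> L2 (lebesgue_on U)"
       "(\<lambda>n. L2_norm (lebesgue_on U) (\<lambda>x. Y n x - z x)) \<longlonglongrightarrow> 0"
  shows "has_weak_partial U j w z"
  unfolding has_weak_partial_iff[OF U]
proof (intro conjI allI impI)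
  fix \<phi> assume \<phi>: "test_fun U \<phi>"
  have "(\<lambda>n. \<integral>x. partial_deriv j \<phi> x *\<^sub>R X n x \<partial>lebesgue)
      \<longlonglongrightarrow> (\<integral>x. partial_deriv j \<phi> x *\<^sub>R w x \<partial>lebesgue)"
    by (rule tendsto_test_pairing[OF U X test_fun_partial_deriv[OF \<phi>]])
  moreover have "(\<integral>x. partial_deriv j \<phi> x *\<^sub>R X n x \<partial>lebesgue) = - (\<integral>x. \<phi> x *\<^sub>R Y n x \<partial>lebesgue)"
      for n
    using h \<phi> has_weak_partial_iff[OF U] by blast
  moreover have "(\<lambda>n. - (\<integral>x. \<phi> x *\<^sub>R Y n x \<partial>lebesgue)) \<longlonglongrightarrow> - (\<integral>x. \<phi> x *\<^sub>R z x \<partial>lebesgue)"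
    by (intro tendsto_minus tendsto_test_pairing[OF U Y \<phi>])
  ultimately show "(\<integral>x. partial_deriv j \<phi> x *\<^sub>R w x \<partial>lebesgue) = - (\<integral>x. \<phi> x *\<^sub>R z x \<partial>lebesgue)"
    using LIMSEQ_unique by fastforce
qed (use L2_loc_integrable[OF U] X Y in auto)

lemma weak_partial_works: "has_weak_partial U j u v \<Longrightarrow> has_weak_partial U j u (weak_partial U j u)"
  unfolding weak_partial_def by (rule someI[of "has_weak_partial U j u"])

lemma weak_partial_eq:
  fixes u v :: "real^'n \<Rightarrow> complex"
  assumes "open U" "has_weak_partial U j u v"
  shows "AE x in lebesgue_on U. v x = weak_partial U j u x"
  using assms weak_partial_works has_weak_partial_unique by blast

text \<open>The definition provides some square integrable derivative, while
  \<open>weak_partial\<close> is a choice among all weak derivatives. By uniqueness the two agree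
  almost everywhere, so the choice is square integrable as well.\<close>

lemma sobolev1_iff:
  assumes U: "open U"
  shows "u \<in> sobolev 1 U \<longleftrightarrow> u \<in> L2 (lebesgue_on U) \<and>
    (\<forall>j. has_weak_partial U j u (weak_partial U j u) \<and> weak_partial U j u \<in> L2 (lebesgue_on U))"
proof -
  have "has_weak_partial U j u (weak_partial U j u) \<and> weak_partial U j u \<in> L2 (lebesgue_on U)"
    if v: "v \<in> L2 (lebesgue_on U)" and h: "has_weak_partial U j u v" for v j
  proof
    show "has_weak_partial U j u (weak_partial U j u)" using h by (rule weak_partial_works)
    have ae: "AE x in lebesgue_on U. v x = weak_partial U j u x" using U h by (rule weak_partial_eq)
    show "weak_partial U j u \<in> L2 (lebesgue_on U)"
      by (rule L2_cong_AE(1)[OF v borel_measurable_on_AE[OF open_lebesgue[OF U] L2_measurable[OF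
          v] ae] ae])
  qed
  moreover have "u \<in> sobolev 1 U \<longleftrightarrow> u \<in> L2 (lebesgue_on U) \<and>
      (\<forall>j. \<exists>v\<in>L2 (lebesgue_on U). has_weak_partial U j u v)"
    by simp
  ultimately show ?thesis by meson
qed

lemma sobolev_cong:
  assumes U: "open U" and u: "u \<in> sobolev 1 U" and eq: "AE x in lebesgue_on U. u x = v x"
  shows "v \<in> sobolev 1 U"
proof -
  have uL: "u \<in> L2 (lebesgue_on U)" using u sobolev1_iff[OF U] by blast
  have "v \<in> L2 (lebesgue_on U)"
    by (rule L2_cong_AE(1)[OF uL borel_measurable_on_AE[OF open_lebesgue[OF U] L2_measurable[OF
        uL] eq] eq])
  moreover have "has_weak_partial U j v (weak_partial U j u)" for j
    using has_weak_partial_cong[OF U _ eq] u sobolev1_iff[OF U] by blast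
  ultimately show ?thesis using u unfolding sobolev1_iff[OF U, of u] by auto
qed

lemma sobolev2_D:
  assumes U: "open U" and u: "u \<in> sobolev 2 U"
  shows "u \<in> sobolev 1 U" "weak_partial U m u \<in> sobolev 1 U"
proof -
  have uL: "u \<in> L2 (lebesgue_on U)" and ex: "\<And>j. \<exists>v\<in>sobolev 1 U. has_weak_partial U j u v"
    using u by (auto simp: numeral_2_eq_2)
  show "u \<in> sobolev 1 U" using uL ex by fastforce
  from ex[of m] obtain v where "v \<in> sobolev 1 U" "has_weak_partial U m u v" by blast
  then show "weak_partial U m u \<in> sobolev 1 U"
    using sobolev_cong[OF U] weak_partial_eq[OF U] by blast
qed

definition ip1 :: "(real^'n) set \<Rightarrow> (real^'n \<Rightarrow> complex) \<Rightarrow> (real^'n \<Rightarrow> complex) \<Rightarrow> real" where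
  "ip1 U u v = ip (lebesgue_on U) u v +
     (\<Sum>j\<in>UNIV. ip (lebesgue_on U) (weak_partial U j u) (weak_partial U j v))"

lemma ip_cong_AE:
  assumes "u \<in> L2 M" "v \<in> L2 M" "u' \<in> L2 M" "v' \<in> L2 M" "AE x in M. u x = u' x" "AE x in M. v x
      = v' x"
  shows "ip M u v = ip M u' v'"
  unfolding ip_def
proof (rule integral_cong_AE)
  show "AE x in M. u x \<bullet> v x = u' x \<bullet> v' x" using assms(5,6) by eventually_elim simp
qed (use assms L2_measurable in \<open>auto intro!: borel_measurable_inner\<close>)

lemma sobolev1_D:
  assumes "open U" "u \<in> sobolev 1 U"
  shows "u \<in> L2 (lebesgue_on U)" "has_weak_partial U j u (weak_partial U j u)"
    "weak_partial U j u \<in> L2 (lebesgue_on U)"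
  using assms sobolev1_iff by blast+

lemma sobolev1_I:
  assumes "u \<in> L2 (lebesgue_on U)" "\<And>j. has_weak_partial U j u (v j)" "\<And>j. v j \<in> L2 (lebesgue_on U)"
  shows "u \<in> sobolev 1 U"
  using assms by auto

lemma weak_partial_add:
  assumes U: "open U" and "u \<in> sobolev 1 U" "v \<in> sobolev 1 U"
  shows "AE x in lebesgue_on U. weak_partial U j u x + weak_partial U j v x
      = weak_partial U j (\<lambda>x. u x + v x) x"
  using has_weak_partial_add[OF U sobolev1_D(2)[OF U assms(2)] sobolev1_D(2)[OF U assms(3)]]
      weak_partial_eq[OF U]
  by blast

lemma weak_partial_cmult:
  assumes U: "open U" and "u \<in> sobolev 1 U"
  shows "AE x in lebesgue_on U. c * weak_partial U j u x = weak_partial U j (\<lambda>x. c * u x) x"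
  using has_weak_partial_cmult[OF U sobolev1_D(2)[OF U assms(2)]] weak_partial_eq[OF U] by blast

lemma sobolev1_add:
  assumes U: "open U" and u: "u \<in> sobolev 1 U" and v: "v \<in> sobolev 1 U"
  shows "(\<lambda>x. u x + v x) \<in> sobolev 1 U"
  using sobolev1_D[OF U u] sobolev1_D[OF U v]
  by (intro sobolev1_I[where v = "\<lambda>j x. weak_partial U j u x + weak_partial U j v x"]
      L2_add has_weak_partial_add[OF U]) auto

lemma sobolev1_cmult:
  assumes U: "open U" and u: "u \<in> sobolev 1 U"
  shows "(\<lambda>x. c * u x) \<in> sobolev 1 U"
  using sobolev1_D[OF U u]
  by (intro sobolev1_I[where v = "\<lambda>j x. c * weak_partial U j u x"]
      L2_scale has_weak_partial_cmult[OF U]) auto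

lemma sobolev1_zero: "open U \<Longrightarrow> (\<lambda>x. 0) \<in> sobolev 1 U"
  by (rule sobolev1_I[where v = "\<lambda>j x. 0"])
     (auto simp: L2_zero has_weak_partial_def loc_integrable_def)

text \<open>\<open>weak_partial\<close> is additive and homogeneous only almost everywhere, so the
  algebraic laws are obtained by replacing derivatives with almost everywhere equal functions inside
  the integrals.\<close>

lemma semi_inner_sobolev:
  fixes U :: "(real^'n) set"
  assumes U: "open U" shows "semi_inner (sobolev 1 U) (ip1 U)"
proof
  fix u v w :: "real^'n \<Rightarrow> complex" and c :: complex and r :: real
  note D = sobolev1_D[OF U]
  let ?M = "lebesgue_on U"
  show "(\<lambda>x. 0) \<in> sobolev 1 U" using U by (rule sobolev1_zero)
  show "u \<in> sobolev 1 U \<Longrightarrow> (\<lambda>x. c * u x) \<in> sobolev 1 U" by (rule sobolev1_cmult[OF U])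
  show "u \<in> sobolev 1 U \<Longrightarrow> v \<in> sobolev 1 U \<Longrightarrow> (\<lambda>x. u x + v x) \<in> sobolev 1 U"
    by (rule sobolev1_add[OF U])
  show "ip1 U u v = ip1 U v u" by (simp add: ip1_def ip_def inner_commute)
  have scale: "ip ?M (weak_partial U j (\<lambda>x. c * u x)) z = ip ?M (\<lambda>x. c * weak_partial U j u x) z"
    if "u \<in> sobolev 1 U" "z \<in> L2 ?M" for j c u z
    using D[OF that(1)] D[OF sobolev1_cmult[OF U that(1), of c]] that(2) weak_partial_cmult[OF U
        that(1), of c j]
    by (intro ip_cong_AE L2_scale) (auto elim!: AE_mp)
  show "ip1 U (\<lambda>x. u x + v x) w = ip1 U u w + ip1 U v w"
    if u: "u \<in> sobolev 1 U" and v: "v \<in> sobolev 1 U" and w: "w \<in> sobolev 1 U"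
  proof -
    have "ip ?M (weak_partial U j (\<lambda>x. u x + v x)) (weak_partial U j w) =
        ip ?M (weak_partial U j u) (weak_partial U j w)
            + ip ?M (weak_partial U j v) (weak_partial U j w)" for j
    proof -
      have "ip ?M (weak_partial U j (\<lambda>x. u x + v x)) (weak_partial U j w) =
          ip ?M (\<lambda>x. weak_partial U j u x + weak_partial U j v x) (weak_partial U j w)"
        using D[OF u] D[OF v] D[OF w] D[OF sobolev1_add[OF U u v]] weak_partial_add[OF U u v, of j]
        by (intro ip_cong_AE L2_add) (auto elim!: AE_mp)
      then show ?thesis using D[OF u] D[OF v] D[OF w] by (simp add: l2.add_left)
    qed
    then show ?thesis using D[OF u] D[OF v] D[OF w] by (simp add: ip1_def l2.add_left sum.distrib)
  qed
  show "ip1 U (\<lambda>x. c * u x) v = ip1 U u (\<lambda>x. cnj c * v x)"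
    if u: "u \<in> sobolev 1 U" and v: "v \<in> sobolev 1 U"
  proof -
    have "ip ?M (weak_partial U j (\<lambda>x. c * u x)) (weak_partial U j v) =
        ip ?M (weak_partial U j u) (weak_partial U j (\<lambda>x. cnj c * v x))" for j
    proof -
      have "ip ?M (weak_partial U j u) (weak_partial U j (\<lambda>x. cnj c * v x)) =
          ip ?M (weak_partial U j u) (\<lambda>x. cnj c * weak_partial U j v x)"
        using scale[OF v D(3)[OF u], of j "cnj c" j] by (simp add: ip_def inner_commute)
      then show ?thesis
        using scale[OF u D(3)[OF v], of j c j] D[OF u] D[OF v] by (simp add: l2.cnj_left)
    qed
    then show ?thesis using D[OF u] D[OF v] by (simp add: ip1_def l2.cnj_left)
  qed
  show "ip1 U (\<lambda>x. of_real r * u x) v = r * ip1 U u v"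
    if u: "u \<in> sobolev 1 U" and v: "v \<in> sobolev 1 U"
    using D[OF u] D[OF v] scale[OF u D(3)[OF v]]
    by (simp add: ip1_def l2.real_left sum_distrib_left distrib_left)
  show "0 \<le> ip1 U u u" by (simp add: ip1_def ip_self sum_nonneg)
qed

lemma nrm_sobolev: "open U \<Longrightarrow> semi_inner.nrm (ip1 U) = norm1 U"
  by (rule ext) (simp add: semi_inner.nrm_def[OF semi_inner_sobolev] ip1_def ip_self norm1_def)

lemma norm1_ge:
  "norm0 U u \<le> norm1 U u" "L2_norm (lebesgue_on U) (weak_partial U j u) \<le> norm1 U u"
proof -
  have s: "(L2_norm (lebesgue_on U) (weak_partial U j u))\<^sup>2
      \<le> (\<Sum>j\<in>UNIV. (norm0 U (weak_partial U j u))\<^sup>2)"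
    by (rule member_le_sum) auto
  show "norm0 U u \<le> norm1 U u"
    unfolding norm1_def by (rule real_le_rsqrt) (simp add: sum_nonneg)
  show "L2_norm (lebesgue_on U) (weak_partial U j u) \<le> norm1 U u"
    unfolding norm1_def by (rule real_le_rsqrt) (use s in \<open>simp add: add_increasing\<close>)
qed

text \<open>The difference \<open>u - v\<close> gets its own arbitrary choice of derivative, and the
  norm does not see which one. This allows limits \<open>z j\<close> that are not literally
  \<open>weak_partial\<close>.\<close>

lemma weak_partial_diff_norm:
  assumes U: "open U" and u: "u \<in> sobolev 1 U" and h: "\<And>j. has_weak_partial U j v (z j)"
    and v: "v \<in> L2 (lebesgue_on U)" and z: "\<And>j. z j \<in> L2 (lebesgue_on U)"
  shows "L2_norm (lebesgue_on U) (weak_partial U j (\<lambda>x. u x - v x)) =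
    L2_norm (lebesgue_on U) (\<lambda>x. weak_partial U j u x - z j x)"
proof -
  note D = sobolev1_D[OF U u]
  have "has_weak_partial U j (\<lambda>x. u x + (-1) * v x) (\<lambda>x. weak_partial U j u x + (-1) * z j x)"
    by (intro has_weak_partial_add[OF U] has_weak_partial_cmult[OF U] D h)
  then have ae: "AE x in lebesgue_on U. weak_partial U j u x - z j x
      = weak_partial U j (\<lambda>x. u x - v x) x"
    using weak_partial_eq[OF U] by fastforce
  have L: "(\<lambda>x. weak_partial U j u x - z j x) \<in> L2 (lebesgue_on U)"
    by (intro l2.diff_mem D z)
  show ?thesis
    by (rule L2_cong_AE(2)[OF L borel_measurable_on_AE[OF open_lebesgue[OF U] L2_measurable[OF L]
        ae] ae])
qed

text \<open>The functions and each of their derivatives converge separately in \<open>L2\<close>;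
  closedness of weak differentiation identifies the limits of the derivatives as derivatives of the
  limit.\<close>

theorem sobolev1_complete:
  fixes X :: "nat \<Rightarrow> real^'n \<Rightarrow> complex"
  assumes U: "open U" "bounded U" and X: "\<And>n. X n \<in> sobolev 1 U"
    and Cau: "\<And>e. e > 0 \<Longrightarrow> \<exists>N. \<forall>m\<ge>N. \<forall>n\<ge>N. norm1 U (\<lambda>x. X m x - X n x) < e"
  shows "\<exists>w\<in>sobolev 1 U. (\<lambda>n. norm1 U (\<lambda>x. X n x - w x)) \<longlonglongrightarrow> 0"
proof -
  let ?M = "lebesgue_on U"
  have fin: "finite_measure ?M"
    using U by (intro finite_measure_lebesgue_on lmeasurable_open)
  note D = sobolev1_D[OF U(1) X]
  have "\<exists>w\<in>L2 ?M. (\<lambda>n. L2_norm ?M (\<lambda>x. X n x - w x)) \<longlonglongrightarrow> 0"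
  proof (rule L2_complete[OF fin D(1)])
    fix e :: real assume "e > 0"
    from Cau[OF this] show "\<exists>N. \<forall>m\<ge>N. \<forall>n\<ge>N. L2_norm ?M (\<lambda>x. X m x - X n x) < e"
      using norm1_ge(1) le_less_trans by blast
  qed
  then obtain w where w: "w \<in> L2 ?M" "(\<lambda>n. L2_norm ?M (\<lambda>x. X n x - w x)) \<longlonglongrightarrow> 0" by blast
  have "\<exists>z\<in>L2 ?M. (\<lambda>n. L2_norm ?M (\<lambda>x. weak_partial U j (X n) x - z x)) \<longlonglongrightarrow> 0" for j
  proof (rule L2_complete[OF fin D(3)])
    fix e :: real assume "e > 0"
    have "L2_norm ?M (\<lambda>x. weak_partial U j (X m) x - weak_partial U j (X n) x)
        \<le> norm1 U (\<lambda>x. X m x - X n x)" for m n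
      using weak_partial_diff_norm[OF U(1) X[of m], of "X n"
          "\<lambda>j. weak_partial U j (X n)" j] D norm1_ge(2)[of U j "\<lambda>x. X m x - X n x"] by simp
    with Cau[OF \<open>e > 0\<close>] show "\<exists>N. \<forall>m\<ge>N. \<forall>n\<ge>N. L2_norm ?M (\<lambda>x. weak_partial U j (X m) x
        - weak_partial U j (X n) x) < e"
      using le_less_trans by blast
  qed
  then have "\<forall>j. \<exists>z. z \<in> L2 ?M \<and> (\<lambda>n. L2_norm ?M (\<lambda>x. weak_partial U j (X n) x - z x)) \<longlonglongrightarrow> 0"
    by blast
  from choice[OF this] obtain z where z: "\<And>j. z j \<in> L2 ?M"
    "\<And>j. (\<lambda>n. L2_norm ?M (\<lambda>x. weak_partial U j (X n) x - z j x)) \<longlonglongrightarrow> 0"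
    by blast
  have h: "has_weak_partial U j w (z j)" for j
    by (rule has_weak_partial_limit[OF U(1) D(2) D(1) w D(3) z])
  have wS: "w \<in> sobolev 1 U" using w(1) h z(1) by (rule sobolev1_I)
  have "(\<lambda>n. norm1 U (\<lambda>x. X n x - w x)) = (\<lambda>n. sqrt ((L2_norm ?M (\<lambda>x. X n x - w x))\<^sup>2 +
      (\<Sum>j\<in>UNIV. (L2_norm ?M (\<lambda>x. weak_partial U j (X n) x - z j x))\<^sup>2)))"
    unfolding norm1_def using weak_partial_diff_norm[OF U(1) X h w(1) z(1)] by simp
  moreover have "\<dots> \<longlonglongrightarrow> sqrt (0\<^sup>2 + (\<Sum>j\<in>(UNIV::'n set). 0\<^sup>2))"
    by (intro tendsto_intros w z)
  ultimately have "(\<lambda>n. norm1 U (\<lambda>x. X n x - w x)) \<longlonglongrightarrow> 0" by simp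
  then show ?thesis using wS by blast
qed

section \<open>Translations and integration by parts\<close>

lemma lebesgue_translation_measurable:
  fixes a :: "'a::euclidean_space" shows "(\<lambda>x. x + a) \<in> lebesgue \<rightarrow>\<^sub>M lebesgue"
  using lebesgue_affine_measurable[of "\<lambda>_. 1" a] by (simp add: euclidean_representation add.commute)

lemma distr_lebesgue_translation:
  fixes a :: "'a::euclidean_space" shows "distr lebesgue lebesgue (\<lambda>x. x + a) = lebesgue"
  using lebesgue_affine_euclidean[of "\<lambda>_. 1" a]
  by (simp add: euclidean_representation density_1 add.commute)

lemma integral_lebesgue_translation:
  fixes f :: "'a::euclidean_space \<Rightarrow> 'b::{banach, second_countable_topology}"
  assumes "f \<in> borel_measurable lebesgue"
  shows "(\<integral>x. f (x + a) \<partial>lebesgue) = (\<integral>x. f x \<partial>lebesgue)"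
  using integral_distr[OF lebesgue_translation_measurable assms, of a]
  by (simp add: distr_lebesgue_translation)

lemma L2_translation:
  fixes u :: "'a::euclidean_space \<Rightarrow> complex"
  assumes "u \<in> L2 lebesgue"
  shows "(\<lambda>x. u (x + a)) \<in> L2 lebesgue" "L2_norm lebesgue (\<lambda>x. u (x + a)) = L2_norm lebesgue u"
proof -
  have m: "u \<in> borel_measurable lebesgue" using assms by (rule L2_measurable)
  have i: "integrable (distr lebesgue lebesgue (\<lambda>x. x + a)) (\<lambda>x. (norm (u x))\<^sup>2)"
    using assms by (simp add: distr_lebesgue_translation L2_def)
  show "(\<lambda>x. u (x + a)) \<in> L2 lebesgue"
    using integrable_distr[OF lebesgue_translation_measurable i]
      measurable_compose[OF lebesgue_translation_measurable m] by (simp add: L2_def)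
  show "L2_norm lebesgue (\<lambda>x. u (x + a)) = L2_norm lebesgue u"
    unfolding L2_norm_def using integral_lebesgue_translation[of "\<lambda>x. (norm (u x))\<^sup>2" a] m by simp
qed

text \<open>Serves to split complex functions into real and imaginary parts and, in the other
  direction, to turn a real function into a complex one by
  \<open>r \<mapsto> c * of_real r\<close>.\<close>

lemma has_weak_partial_bounded_linear:
  fixes u v :: "real^'n \<Rightarrow> 'b::euclidean_space" and T :: "'b \<Rightarrow> 'c::euclidean_space"
  assumes U: "open U" and T: "bounded_linear T" and h: "has_weak_partial U j u v"
  shows "has_weak_partial U j (\<lambda>x. T (u x)) (\<lambda>x. T (v x))"
proof -
  have l: "loc_integrable U u" "loc_integrable U v" using h by (auto simp: has_weak_partial_def)
  have l': "loc_integrable U (\<lambda>x. T (f x))" if "loc_integrable U f" for f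
    using that integrable_bounded_linear[OF T] by (auto simp: loc_integrable_def)
  have eq: "(\<integral>x. \<phi> x *\<^sub>R T (f x) \<partial>lebesgue) = T (\<integral>x. \<phi> x *\<^sub>R f x \<partial>lebesgue)"
    if "loc_integrable U f" "test_fun U \<phi>" for f \<phi>
    using integral_bounded_linear[OF T test_integrable[OF that]]
    by (simp add: linear_scale[OF bounded_linear.linear[OF T]])
  show ?thesis
    using h l l'[OF l(1)] l'[OF l(2)] eq[OF l(1) test_fun_partial_deriv] eq[OF l(2)]
    unfolding has_weak_partial_iff[OF U] by (simp add: linear_neg[OF bounded_linear.linear[OF T]])
qed

text \<open>The \<open>t\<close>-derivative falls on the smooth factor alone, so weak derivatives of
  \<open>v\<close> suffice. The chain rule gives one minus sign, the definition of the weak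
  derivative a second one, and the directional derivative ends up on \<open>v\<close>.\<close>

lemma translated_pairing_deriv:
  fixes v :: "real^'n \<Rightarrow> real" and w :: "'n \<Rightarrow> real^'n \<Rightarrow> real"
  assumes \<Omega>: "open \<Omega>" and \<phi>: "test_fun U \<phi>"
    and path: "\<And>x t. x \<in> U \<Longrightarrow> 0 \<le> t \<Longrightarrow> t \<le> h \<Longrightarrow> x + t *\<^sub>R z \<in> \<Omega>"
    and h: "\<And>j. has_weak_partial \<Omega> j v (w j)" and t: "t \<in> {0..h}"
  shows "((\<lambda>t. \<integral>y. \<phi> (y - t *\<^sub>R z) * v y \<partial>lebesgue) has_real_derivative
     (\<integral>y. \<phi> (y - t *\<^sub>R z) * (\<Sum>j\<in>UNIV. z $ j * w j y) \<partial>lebesgue)) (at t within {0..h})"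
proof -
  have lv: "loc_integrable \<Omega> v" "loc_integrable \<Omega> (w j)" for j using h
      by (auto simp: has_weak_partial_def)
  define d where "d x = (\<Sum>j\<in>UNIV. z $ j * partial_deriv j \<phi> x)" for x
  have d_test: "test_fun U d"
  proof -
    have "test_fun U (\<lambda>x. \<Sum>j\<in>J. z $ j * partial_deriv j \<phi> x)" if "finite J" for J
      using that by (induction J) (auto intro!: test_fun_zero test_fun_add test_fun_cmult
          test_fun_partial_deriv \<phi>)
    then show ?thesis by (simp add: d_def[abs_def])
  qed
  obtain M where M: "M \<ge> 0" "\<And>x. \<bar>d x\<bar> \<le> M" using test_fun_bounded[OF d_test] by blast
  have tr: "test_fun \<Omega> (\<lambda>y. f (y - s *\<^sub>R z))" if "test_fun U f" "s \<in> {0..h}" for f s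
    using test_fun_affine[OF that(1), of 1 "s *\<^sub>R z" \<Omega>] path that(2) by (simp add: add.commute)
  have der: "((\<lambda>s. \<phi> (y - s *\<^sub>R z)) has_real_derivative - d (y - s *\<^sub>R z)) (at s within A)"
      for y s A
  proof -
    have "((\<lambda>s. \<phi> (y - s *\<^sub>R z)) has_derivative
        (\<lambda>r. \<Sum>j\<in>UNIV. ((- (r *\<^sub>R z)) $ j) *\<^sub>R partial_deriv j \<phi> (y - s *\<^sub>R z))) (at s within A)"
      by (rule has_derivative_compose[OF _ differentiable_partial_deriv[OF
          test_fun_differentiable[OF \<phi>]]])
         (auto intro!: derivative_eq_intros)
    then show ?thesis
      unfolding has_field_derivative_def
      by (rule has_derivative_eq_rhs) (auto simp: d_def sum_distrib_left sum_negf algebra_simps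
          intro!: ext)
  qed
  have lip: "\<bar>\<phi> (y - a *\<^sub>R z) - \<phi> (y - b *\<^sub>R z)\<bar> \<le> M * \<bar>a - b\<bar>" for y a b
    using field_differentiable_bound[of UNIV "\<lambda>s. \<phi> (y - s *\<^sub>R z)" "\<lambda>s. - d (y
        - s *\<^sub>R z)" M a b] der M
    by simp
  obtain K where K: "compact K" "K \<subseteq> U" "\<And>x. x \<notin> K \<Longrightarrow> \<phi> x = 0" using \<phi> by (auto simp: test_fun_def)
  \<comment> \<open>\<open>K'\<close> is the region swept by the support for \<open>t\<close>
    between \<open>0\<close> and \<open>h\<close>. It is a compact subset of
    \<open>\<Omega>\<close>, so \<open>v\<close> is integrable over it, which together with the
    Lipschitz bound yields the dominating function.\<close>
  define K' where "K' = (\<lambda>(x, t). x + t *\<^sub>R z) ` (K \<times> {0..h})"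
  have K': "compact K'" "K' \<subseteq> \<Omega>"
  proof -
    show "compact K'" unfolding K'_def
      by (intro compact_continuous_image compact_Times K) (auto simp: case_prod_unfold intro!:
          continuous_intros)
    show "K' \<subseteq> \<Omega>" using path K(2) by (auto simp: K'_def)
  qed
  have out: "\<phi> (y - s *\<^sub>R z) = 0" if "y \<notin> K'" "s \<in> {0..h}" for y s
  proof -
    have "y = (\<lambda>(x, t). x + t *\<^sub>R z) (y - s *\<^sub>R z, s)" by simp
    then have "y - s *\<^sub>R z \<notin> K" using that unfolding K'_def by blast
    then show ?thesis by (rule K(3))
  qed
  have iv: "integrable lebesgue (\<lambda>y. \<phi> (y - s *\<^sub>R z) * v y)" if "s \<in> {0..h}" for s
    using test_integrable[OF lv(1) tr[OF \<phi> that]] by simp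
  have idv: "integrable lebesgue (\<lambda>y. d (y - t *\<^sub>R z) * v y)"
    using test_integrable[OF lv(1) tr[OF d_test t]] by simp
  let ?F = "\<lambda>t. \<integral>y. \<phi> (y - t *\<^sub>R z) * v y \<partial>lebesgue"
  have "((\<lambda>s. (?F s - ?F t) / (s - t)) \<longlongrightarrow> (\<integral>y. - d (y - t *\<^sub>R z)
      * v y \<partial>lebesgue)) (at t within {0..h})"
    unfolding tendsto_at_iff_sequentially comp_def
  proof (intro allI impI)
    fix X assume X: "\<forall>i. X i \<in> {0..h} - {t}" "X \<longlonglongrightarrow> t"
    have Xh: "X i \<in> {0..h}" "X i \<noteq> t" for i using X(1) by auto
    have "(?F (X i) - ?F t) / (X i - t) = (\<integral>y. (\<phi> (y - X i *\<^sub>R z) - \<phi> (y - t *\<^sub>R z)) / (X i - t)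
        * v y \<partial>lebesgue)" for i
    proof -
      have "?F (X i) - ?F t = (\<integral>y. \<phi> (y - X i *\<^sub>R z) * v y - \<phi> (y - t *\<^sub>R z) * v y \<partial>lebesgue)"
        using iv[OF Xh(1)] iv[OF t] by simp
      then show ?thesis
        by (simp add: left_diff_distrib flip: integral_divide_zero)
    qed
    moreover have "(\<lambda>i. \<integral>y. (\<phi> (y - X i *\<^sub>R z) - \<phi> (y - t *\<^sub>R z)) / (X i - t) * v y \<partial>lebesgue)
        \<longlonglongrightarrow> (\<integral>y. - d (y - t *\<^sub>R z) * v y \<partial>lebesgue)"
    proof (rule integral_dominated_convergence[where w = "\<lambda>y. M * norm (indicator K' y *\<^sub>R v y)"])
      show "integrable lebesgue (\<lambda>y. M * norm (indicator K' y *\<^sub>R v y))"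
        by (intro integrable_mult_right integrable_norm loc_integrable_indicator[OF lv(1) K'])
      show "(\<lambda>y. - d (y - t *\<^sub>R z) * v y) \<in> borel_measurable lebesgue"
        using borel_measurable_integrable[OF idv] by simp
      have "(\<lambda>y. (\<phi> (y - X i *\<^sub>R z) * v y - \<phi> (y - t *\<^sub>R z) * v y) / (X i
          - t)) \<in> borel_measurable lebesgue" for i
        using iv[OF Xh(1)] iv[OF t] by simp
      then show "(\<lambda>y. (\<phi> (y - X i *\<^sub>R z) - \<phi> (y - t *\<^sub>R z)) / (X i - t)
          * v y) \<in> borel_measurable lebesgue" for i
        by (simp add: left_diff_distrib)
      show "AE y in lebesgue. (\<lambda>i. (\<phi> (y - X i *\<^sub>R z) - \<phi> (y - t *\<^sub>R z)) / (X i - t) * v y)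
          \<longlonglongrightarrow> - d (y - t *\<^sub>R z) * v y"
      proof (rule AE_I2, intro tendsto_mult tendsto_const)
        fix y
        have "((\<lambda>s. (\<phi> (y - s *\<^sub>R z) - \<phi> (y - t *\<^sub>R z)) / (s - t))
            \<longlongrightarrow> - d (y - t *\<^sub>R z)) (at t within {0..h})"
          using der[of y t "{0..h}"] by (simp add: has_field_derivative_iff)
        then show "(\<lambda>i. (\<phi> (y - X i *\<^sub>R z) - \<phi> (y - t *\<^sub>R z)) / (X i - t)) \<longlonglongrightarrow> - d (y - t *\<^sub>R z)"
          using X unfolding tendsto_at_iff_sequentially comp_def by blast
      qed
      show "AE y in lebesgue. norm ((\<phi> (y - X i *\<^sub>R z) - \<phi> (y - t *\<^sub>R z)) / (X i - t) * v y)
          \<le> M * norm (indicator K' y *\<^sub>R v y)" for i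
      proof (rule AE_I2)
        fix y
        have "\<bar>(\<phi> (y - X i *\<^sub>R z) - \<phi> (y - t *\<^sub>R z)) / (X i - t)\<bar> \<le> M"
          using lip[of y "X i" t] Xh(2)[of i] by (simp add: abs_divide pos_divide_le_eq)
        then have "norm ((\<phi> (y - X i *\<^sub>R z) - \<phi> (y - t *\<^sub>R z)) / (X i - t) * v y) \<le> M * \<bar>v y\<bar>"
          unfolding real_norm_def abs_mult by (rule mult_right_mono) simp
        then show "norm ((\<phi> (y - X i *\<^sub>R z) - \<phi> (y - t *\<^sub>R z)) / (X i - t) * v y)
            \<le> M * norm (indicator K' y *\<^sub>R v y)"
          using out[OF _ Xh(1), of y i] out[OF _ t, of y] by (cases "y \<in> K'") simp_all
      qed
    qed
    ultimately show "(\<lambda>i. (?F (X i) - ?F t) / (X i - t)) \<longlonglongrightarrow> (\<integral>y. - d (y - t *\<^sub>R z) * v y \<partial>lebesgue)"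
      by (simp only:)
  qed
  moreover have "(\<integral>y. - d (y - t *\<^sub>R z) * v y \<partial>lebesgue)
      = (\<integral>y. \<phi> (y - t *\<^sub>R z) * (\<Sum>j\<in>UNIV. z $ j * w j y) \<partial>lebesgue)"
  proof -
    let ?f = "\<lambda>y. \<phi> (y - t *\<^sub>R z)"
    have pd: "partial_deriv j ?f = (\<lambda>y. partial_deriv j \<phi> (y - t *\<^sub>R z))" for j
      using partial_deriv_affine(1)[where c = 1 and a
          = "- t *\<^sub>R z", OF test_fun_differentiable[OF \<phi>]]
      by (auto intro!: ext)
    have e: "(\<integral>y. partial_deriv j \<phi> (y - t *\<^sub>R z) * v y \<partial>lebesgue)
        = - (\<integral>y. ?f y * w j y \<partial>lebesgue)" for j
    proof -
      have "(\<integral>y. partial_deriv j ?f y * v y \<partial>lebesgue) = - (\<integral>y. ?f y * w j y \<partial>lebesgue)"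
        using h[of j] tr[OF \<phi> t] unfolding has_weak_partial_iff[OF \<Omega>] by simp
      then show ?thesis unfolding pd .
    qed
    have i1: "integrable lebesgue (\<lambda>y. partial_deriv j \<phi> (y - t *\<^sub>R z) * v y)" for j
      using test_integrable[OF lv(1) tr[OF test_fun_partial_deriv[OF \<phi>] t]] by simp
    have i2: "integrable lebesgue (\<lambda>y. ?f y * w j y)" for j
      using test_integrable[OF lv(2) tr[OF \<phi> t]] by simp
    have "(\<integral>y. - d (y - t *\<^sub>R z) * v y \<partial>lebesgue)
        = - (\<integral>y. (\<Sum>j\<in>UNIV. z $ j * (partial_deriv j \<phi> (y - t *\<^sub>R z) * v y)) \<partial>lebesgue)"
      by (simp add: d_def sum_distrib_right mult.assoc)
    also have "\<dots> = - (\<Sum>j\<in>UNIV. z $ j * (\<integral>y. partial_deriv j \<phi> (y - t *\<^sub>R z) * v y \<partial>lebesgue))"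
      using i1 by (simp add: Bochner_Integration.integral_sum)
    also have "\<dots> = (\<Sum>j\<in>UNIV. z $ j * (\<integral>y. ?f y * w j y \<partial>lebesgue))"
      by (simp add: e sum_negf)
    also have "\<dots> = (\<integral>y. (\<Sum>j\<in>UNIV. z $ j * (?f y * w j y)) \<partial>lebesgue)"
      using i2 by (simp add: Bochner_Integration.integral_sum)
    finally show ?thesis by (simp add: sum_distrib_left mult.left_commute)
  qed
  ultimately show ?thesis by (simp add: has_field_derivative_iff)
qed

section \<open>Complex test functions and duality in L2\<close>

definition test_space :: "(real^'n) set \<Rightarrow> (real^'n \<Rightarrow> complex) set" where
  "test_space U = {\<lambda>x. Complex (\<phi> x) (\<psi> x) | \<phi> \<psi>. test_fun U \<phi> \<and> test_fun U \<psi>}"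

lemma Complex_fun_eq: "(\<lambda>x. Complex (f x) (g x))
    = (\<lambda>x. complex_of_real (f x) + \<i> * complex_of_real (g x))"
  by (simp add: complex_eq_iff fun_eq_iff)

lemma test_space_L2:
  assumes "\<psi> \<in> test_space U" "S \<in> sets lebesgue" shows "\<psi> \<in> L2 (lebesgue_on S)"
  using assms unfolding test_space_def Complex_fun_eq by (auto intro!: L2_add L2_scale test_fun_L2)

lemma lebesgue_on_UNIV: "lebesgue_on UNIV = lebesgue"
  by (rule measure_eqI) (simp_all add: emeasure_restrict_space sets_restrict_space)

lemma test_spaceI: "test_fun U \<phi> \<Longrightarrow> test_fun U \<psi> \<Longrightarrow> (\<lambda>x. Complex (\<phi> x) (\<psi> x)) \<in> test_space U"
  by (auto simp: test_space_def)

lemma test_space_zero: "(\<lambda>x. 0) \<in> test_space U"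
  unfolding test_space_def using test_fun_zero by (fastforce simp: complex_eq_iff)

lemma test_space_add:
  assumes "u \<in> test_space U" "v \<in> test_space U" shows "(\<lambda>x. u x + v x) \<in> test_space U"
proof -
  from assms obtain a b c d where "u = (\<lambda>x. Complex (a x) (b x))" "v = (\<lambda>x. Complex (c x) (d x))"
    "test_fun U a" "test_fun U b" "test_fun U c" "test_fun U d" by (auto simp: test_space_def)
  then show ?thesis unfolding test_space_def
    by (intro CollectI exI[of _ "\<lambda>x. a x + c x"] exI[of _ "\<lambda>x. b x
        + d x"]) (auto intro: test_fun_add simp: complex_eq_iff)
qed

lemma test_space_scale:
  assumes "u \<in> test_space U" shows "(\<lambda>x. of_real r * u x) \<in> test_space U"
proof -
  from assms obtain a b where "u = (\<lambda>x. Complex (a x) (b x))" "test_fun U a" "test_fun U b"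
    by (auto simp: test_space_def)
  then show ?thesis unfolding test_space_def
    by (intro CollectI exI[of _ "\<lambda>x. r * a x"] exI[of _ "\<lambda>x. r
        * b x"]) (auto intro: test_fun_cmult simp: complex_eq_iff)
qed

text \<open>The projection onto the closure of the test functions differs from \<open>g\<close> by a function
  orthogonal to all test functions, which vanishes by the fundamental lemma.\<close>

theorem test_space_dense:
  assumes U: "open U" "bounded U" and g: "g \<in> L2 (lebesgue_on U)" and e: "e > 0"
  shows "\<exists>\<psi>\<in>test_space U. L2_norm (lebesgue_on U) (\<lambda>x. g x - \<psi> x) < e"
proof -
  let ?M = "lebesgue_on U"
  have fin: "finite_measure ?M" using U by (intro finite_measure_lebesgue_on lmeasurable_open)
  have V: "test_space U \<subseteq> L2 ?M" using test_space_L2 open_lebesgue[OF U(1)] by blast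
  obtain w where w: "w \<in> L2 ?M" "\<And>e. e > 0 \<Longrightarrow> \<exists>v\<in>test_space U. L2_norm ?M (\<lambda>x. w x - v x) < e"
    "\<And>v. v \<in> test_space U \<Longrightarrow> ip ?M w v = ip ?M g v"
  proof (rule l2.Riesz_on_subspace[of ?M "test_space U" "ip ?M g" "L2_norm ?M g"])
    show "\<exists>w\<in>L2 ?M. (\<lambda>n. semi_inner.nrm (ip ?M) (\<lambda>x. X n x - w x)) \<longlonglongrightarrow> 0"
      if "\<And>n. X n \<in> L2 ?M" "\<And>e. 0 < e \<Longrightarrow> \<exists>M. \<forall>m\<ge>M. \<forall>n\<ge>M. semi_inner.nrm (ip ?M) (\<lambda>x. X m x
          - X n x) < e" for X :: "nat \<Rightarrow> _"
      using L2_complete[OF fin that(1)] that(2) by simp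
    show "\<bar>ip ?M g u\<bar> \<le> L2_norm ?M g * semi_inner.nrm (ip ?M) u" if "u \<in> test_space U" for u
      using ip_bound[OF g] V that by auto
    show "ip ?M g (\<lambda>x. u x + v x) = ip ?M g u + ip ?M g v"
        if "u \<in> test_space U" "v \<in> test_space U" for u v
      using that V g by (intro l2.add_right) auto
    show "ip ?M g (\<lambda>x. of_real r * u x) = r * ip ?M g u" if "u \<in> test_space U" for u r
      using that V g by (intro l2.real_right) auto
  qed (use V in \<open>auto intro: test_space_zero test_space_add test_space_scale\<close>)
  have d: "(\<lambda>x. g x - w x) \<in> L2 ?M" by (intro l2.diff_mem g w)
  have "AE x in ?M. g x - w x = 0"
  proof (rule fundamental_lemma[OF U(1) L2_loc_integrable[OF U(1) d]])
    fix \<phi> assume \<phi>: "test_fun U \<phi>"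
    let ?I = "\<integral>x. \<phi> x *\<^sub>R (g x - w x) \<partial>?M"
    have int: "integrable ?M (\<lambda>x. \<phi> x *\<^sub>R (g x - w x))"
      using L2_integrable_mult[OF test_fun_L2[OF \<phi> open_lebesgue[OF U(1)]] d]
          by (simp add: scaleR_conv_of_real)
    have "ip ?M (\<lambda>x. g x - w x) v = 0" if "v \<in> test_space U" for v
      using w that V g by (subst l2.diff_left) auto
    \<comment> \<open>The form \<open>ip\<close> yields real parts only; placing
      \<open>\<phi>\<close> in the real and in the imaginary slot tests both parts of
      \<open>g - w\<close>.\<close>
    from this[OF test_spaceI[OF \<phi> test_fun_zero]] this[OF test_spaceI[OF test_fun_zero \<phi>]]
    have "(\<integral>x. Re (\<phi> x *\<^sub>R (g x - w x)) \<partial>?M) = 0" "(\<integral>x. Im (\<phi> x *\<^sub>R (g x - w x)) \<partial>?M) = 0"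
      by (simp_all add: ip_def inner_complex_def mult.commute)
    then have "Re ?I = 0" "Im ?I = 0"
      using integral_Re[OF int] integral_Im[OF int] by simp_all
    then show "(\<integral>x. \<phi> x *\<^sub>R (g x - w x) \<partial>lebesgue) = 0"
      unfolding test_integral[OF U(1) \<phi>, symmetric] by (simp add: complex_eq_iff)
  qed
  then have z: "L2_norm ?M (\<lambda>x. g x - w x) = 0" using L2_norm_zero_AE[OF d] by simp
  from w(2)[OF e] obtain v where v: "v \<in> test_space U" "L2_norm ?M (\<lambda>x. w x - v x) < e" by blast
  have "L2_norm ?M (\<lambda>x. g x - v x) \<le> L2_norm ?M (\<lambda>x. g x - w x) + L2_norm ?M (\<lambda>x. w x - v x)"
    using l2.nrm_triangle_diff[of g ?M w v] g w(1) v(1) V by auto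
  then show ?thesis using v z by (intro bexI[of _ v]) simp_all
qed

lemma nonpos_if_le_all_multiples:
  fixes a c :: real assumes "\<And>e. e > 0 \<Longrightarrow> a \<le> c * e" "c \<ge> 0" shows "a \<le> 0"
proof (rule field_le_epsilon)
  fix e :: real assume "e > 0"
  have "a \<le> c * (e / (c + 1))" using \<open>e > 0\<close> assms(2) by (intro assms(1)) (simp add: add_nonneg_pos)
  also have "\<dots> \<le> e" using \<open>e > 0\<close> assms(2) by (simp add: divide_simps)
  finally show "a \<le> 0 + e" by simp
qed

text \<open>The optimal test function would be \<open>g\<close> itself. Density replaces it by a
  test function at distance less than \<open>e\<close>, and the squared norm of \<open>g\<close> is
  at most \<open>A\<close> times the norm plus a multiple of \<open>e\<close>.\<close>

lemma L2_norm_le_by_test_space: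
  assumes U: "open U" "bounded U" and g: "g \<in> L2 (lebesgue_on U)"
    and A: "\<And>\<psi>. \<psi> \<in> test_space U \<Longrightarrow> \<bar>ip (lebesgue_on U) g \<psi>\<bar> \<le> A * L2_norm (lebesgue_on U) \<psi>"
    and A0: "A \<ge> 0"
  shows "L2_norm (lebesgue_on U) g \<le> A"
proof -
  let ?M = "lebesgue_on U" let ?n = "L2_norm ?M g"
  have "?n\<^sup>2 \<le> A * ?n + (?n + A) * e" if e: "e > 0" for e
  proof -
    obtain v where v: "v \<in> test_space U" "L2_norm ?M (\<lambda>x. g x - v x) < e"
      using test_space_dense[OF U g e] by blast
    have vL: "v \<in> L2 ?M" using v test_space_L2 open_lebesgue[OF U(1)] by blast
    have d: "(\<lambda>x. g x - v x) \<in> L2 ?M" by (intro l2.diff_mem g vL)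
    have vn: "L2_norm ?M v \<le> ?n + e"
      using l2.nrm_le_diff_add[OF vL g] l2.nrm_minus_commute[OF vL g] v(2) by simp
    have "?n\<^sup>2 = ip ?M g (\<lambda>x. g x - v x) + ip ?M g v"
      using l2.diff_right[OF g vL g] by (simp add: ip_self)
    also have "\<dots> \<le> ?n * L2_norm ?M (\<lambda>x. g x - v x) + A * L2_norm ?M v"
      using ip_bound[OF g d] A[OF v(1)] by linarith
    also have "\<dots> \<le> ?n * e + A * (?n + e)"
      using v(2) vn A0 by (intro add_mono mult_left_mono) auto
    finally show ?thesis by (simp add: algebra_simps)
  qed
  then have "?n\<^sup>2 - A * ?n \<le> (?n + A) * e" if "e > 0" for e using that by fastforce
  moreover have "?n + A \<ge> 0" using A0 by simp
  ultimately have "?n\<^sup>2 - A * ?n \<le> 0"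
    by (rule nonpos_if_le_all_multiples)
  then have "?n * (?n - A) \<le> 0" by (simp add: power2_eq_square algebra_simps)
  then show ?thesis
    using A0 L2_norm_nonneg[of ?M g] by (smt (verit) mult_pos_pos)
qed

lemma ip_on:
  assumes "S \<in> sets lebesgue" "\<And>x. x \<notin> S \<Longrightarrow> v x = 0"
  shows "ip (lebesgue_on S) u v = ip lebesgue u v"
proof -
  have eq: "(\<lambda>x. indicator S x *\<^sub>R (u x \<bullet> v x)) = (\<lambda>x. u x \<bullet> v x)"
  proof
    show "indicator S x *\<^sub>R (u x \<bullet> v x) = u x \<bullet> v x" for x
      using assms(2)[of x] by (cases "x \<in> S") auto
  qed
  show ?thesis
    unfolding ip_def by (subst integral_restrict_space) (use assms(1) in \<open>simp_all only: eq
        space_completion space_lborel space_borel Int_UNIV_right\<close>)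
qed

lemma ip_cong_on:
  assumes "\<And>x. x \<in> S \<Longrightarrow> u x = u' x" "\<And>x. x \<in> S \<Longrightarrow> v x = v' x"
  shows "ip (lebesgue_on S) u v = ip (lebesgue_on S) u' v'"
  unfolding ip_def using assms by (intro Bochner_Integration.integral_cong) auto

section \<open>Translations of weakly differentiable functions\<close>

lemma ip_translation:
  fixes u v :: "'a::euclidean_space \<Rightarrow> complex"
  assumes "u \<in> L2 lebesgue" "v \<in> L2 lebesgue"
  shows "ip lebesgue u (\<lambda>x. v (x - a)) = ip lebesgue (\<lambda>x. u (x + a)) v"
proof -
  have m: "v \<in> borel_measurable lebesgue" "u \<in> borel_measurable lebesgue"
      using assms L2_measurable by auto
  have "(\<lambda>x. v (x - a)) \<in> borel_measurable lebesgue"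
    using measurable_compose[OF lebesgue_translation_measurable[of "-a"] m(1)] by simp
  then show ?thesis
    unfolding ip_def using m(2) integral_lebesgue_translation[of "\<lambda>x. u x \<bullet> v (x - a)" a]
    by simp
qed

text \<open>\<open>ip\<close> pairs real part with real part and imaginary part with imaginary part,
  so the real statement is applied twice.\<close>

lemma translation_flow_deriv:
  fixes v :: "real^'n \<Rightarrow> complex"
  assumes \<Omega>: "open \<Omega>" and \<psi>: "\<psi> \<in> test_space U"
    and v: "v \<in> L2 lebesgue" and w: "\<And>j. w j \<in> L2 lebesgue" and h:
        "\<And>j. has_weak_partial \<Omega> j v (w j)"
    and path: "\<And>x t. x \<in> U \<Longrightarrow> 0 \<le> t \<Longrightarrow> t \<le> h \<Longrightarrow> x + t *\<^sub>R z \<in> \<Omega>" and t: "t \<in> {0..h}"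
  shows "((\<lambda>t. ip lebesgue v (\<lambda>y. \<psi> (y - t *\<^sub>R z))) has_real_derivative
      ip lebesgue (\<lambda>y. \<Sum>j\<in>UNIV. of_real (z $ j) * w j y) (\<lambda>y. \<psi> (y
          - t *\<^sub>R z))) (at t within {0..h})"
proof -
  from \<psi> obtain \<phi>1 \<phi>2 where \<psi>_eq: "\<psi> = (\<lambda>x. Complex (\<phi>1 x) (\<phi>2 x))" and \<phi>: "test_fun U \<phi>1"
      "test_fun U \<phi>2"
    by (auto simp: test_space_def)
  have split: "ip lebesgue u (\<lambda>y. \<psi> (y - s *\<^sub>R z)) =
      (\<integral>y. \<phi>1 (y - s *\<^sub>R z) * Re (u y) \<partial>lebesgue) + (\<integral>y. \<phi>2 (y - s *\<^sub>R z) * Im (u y) \<partial>lebesgue)"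
    if u: "u \<in> L2 lebesgue" for u s
  proof -
    have L: "(\<lambda>y. of_real (f (y - s *\<^sub>R z))) \<in> L2 lebesgue" if "test_fun U f" for f
      using L2_translation(1)[of "\<lambda>x. of_real (f x)" "- s *\<^sub>R z"] test_fun_L2[OF that, of UNIV]
      by (simp add: lebesgue_on_UNIV)
    have "integrable lebesgue (\<lambda>y. \<phi>1 (y - s *\<^sub>R z) * Re (u y))"
      using integrable_Re[OF L2_integrable_mult[OF L[OF \<phi>(1)] u]] by simp
    moreover have "integrable lebesgue (\<lambda>y. \<phi>2 (y - s *\<^sub>R z) * Im (u y))"
      using integrable_Im[OF L2_integrable_mult[OF L[OF \<phi>(2)] u]] by simp
    ultimately show ?thesis
      unfolding ip_def \<psi>_eq by (simp add: inner_complex_def mult.commute)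
  qed
  define W where "W y = (\<Sum>j\<in>UNIV. of_real (z $ j) * w j y)" for y
  have W: "W \<in> L2 lebesgue" unfolding W_def by (intro L2_sum L2_scale w)
  have hR: "has_weak_partial \<Omega> j (\<lambda>x. Re (v x)) (\<lambda>x. Re (w j x))"
    and hI: "has_weak_partial \<Omega> j (\<lambda>x. Im (v x)) (\<lambda>x. Im (w j x))" for j
    using has_weak_partial_bounded_linear[OF \<Omega> bounded_linear_Re h]
      has_weak_partial_bounded_linear[OF \<Omega> bounded_linear_Im h] by auto
  have "((\<lambda>t. (\<integral>y. \<phi>1 (y - t *\<^sub>R z) * Re (v y) \<partial>lebesgue) + (\<integral>y. \<phi>2 (y - t *\<^sub>R z)
      * Im (v y) \<partial>lebesgue)) has_real_derivative
      (\<integral>y. \<phi>1 (y - t *\<^sub>R z) * (\<Sum>j\<in>UNIV. z $ j * Re (w j y)) \<partial>lebesgue) +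
      (\<integral>y. \<phi>2 (y - t *\<^sub>R z) * (\<Sum>j\<in>UNIV. z $ j * Im (w j y)) \<partial>lebesgue)) (at t within {0..h})"
    by (intro DERIV_add translated_pairing_deriv[OF \<Omega> \<phi>(1) path hR t] translated_pairing_deriv[OF
        \<Omega> \<phi>(2) path hI t])
  then show ?thesis
    unfolding W_def[symmetric] split[OF v] split[OF W] by (simp add: W_def)
qed

text \<open>Mean value inequality for the pairing as a function of the shift: its derivative is
  bounded uniformly, as translations preserve the \<open>L2\<close> norm of
  \<open>\<psi>\<close>.\<close>

lemma translation_pairing_bound:
  fixes v :: "real^'n \<Rightarrow> complex"
  assumes \<Omega>: "open \<Omega>" and \<psi>: "\<psi> \<in> test_space U"
    and v: "v \<in> L2 lebesgue" and w: "\<And>j. w j \<in> L2 lebesgue" and hw: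
        "\<And>j. has_weak_partial \<Omega> j v (w j)"
    and path: "\<And>x t. x \<in> U \<Longrightarrow> 0 \<le> t \<Longrightarrow> t \<le> h \<Longrightarrow> x + t *\<^sub>R z \<in> \<Omega>" and h: "0 \<le> h"
  shows "\<bar>ip lebesgue (\<lambda>x. v (x + h *\<^sub>R z) - v x) \<psi>\<bar>
     \<le> h * L2_norm lebesgue (\<lambda>y. \<Sum>j\<in>UNIV. of_real (z $ j) * w j y) * L2_norm lebesgue \<psi>"
proof -
  define W where "W y = (\<Sum>j\<in>UNIV. of_real (z $ j) * w j y)" for y
  have W: "W \<in> L2 lebesgue" unfolding W_def by (intro L2_sum L2_scale w)
  have \<psi>L: "\<psi> \<in> L2 lebesgue" using test_space_L2[OF \<psi>, of UNIV] by (simp add: lebesgue_on_UNIV)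
  let ?F = "\<lambda>t. ip lebesgue v (\<lambda>y. \<psi> (y - t *\<^sub>R z))"
  have "norm (?F h - ?F 0) \<le> (L2_norm lebesgue W * L2_norm lebesgue \<psi>) * norm (h - 0)"
  proof (rule field_differentiable_bound)
    show "convex {0..h}" by (rule convex_real_interval)
    fix t assume t: "t \<in> {0..h}"
    show "(?F has_real_derivative ip lebesgue W (\<lambda>y. \<psi> (y - t *\<^sub>R z))) (at t within {0..h})"
      unfolding W_def by (rule translation_flow_deriv[OF \<Omega> \<psi> v w hw path t])
    show "norm (ip lebesgue W (\<lambda>y. \<psi> (y - t *\<^sub>R z))) \<le> L2_norm lebesgue W * L2_norm lebesgue \<psi>"
      using ip_bound[OF W L2_translation(1)[OF \<psi>L, of "- t *\<^sub>R z"]] L2_translation(2)[OF \<psi>L, of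
          "- t *\<^sub>R z"] by simp
  qed (use h in auto)
  moreover have "?F h - ?F 0 = ip lebesgue (\<lambda>x. v (x + h *\<^sub>R z) - v x) \<psi>"
    using ip_translation[OF v \<psi>L, of "h *\<^sub>R z"] l2.diff_left[OF L2_translation(1)[OF v] v \<psi>L]
        by simp
  ultimately show ?thesis using h unfolding W_def[abs_def, symmetric] by (simp add: mult_ac)
qed

text \<open>By duality with test functions \<open>\<psi>\<close> it suffices to follow \<open>t \<mapsto> \<integral> v \<psi>(\<cdot> - t z)\<close>, whose
  derivative falls on the smooth factor.\<close>

locale translation_domain =
  fixes \<Omega> U :: "(real^'n) set" and h :: real and z :: "real^'n"
    and v :: "real^'n \<Rightarrow> complex" and w :: "'n \<Rightarrow> real^'n \<Rightarrow> complex"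
  assumes \<Omega>: "open \<Omega>" and U: "open U" "bounded U"
    and v: "v \<in> L2 (lebesgue_on \<Omega>)" and w: "\<And>j. w j \<in> L2 (lebesgue_on \<Omega>)"
    and hw: "\<And>j. has_weak_partial \<Omega> j v (w j)"
    and path: "\<And>x t. x \<in> U \<Longrightarrow> 0 \<le> t \<Longrightarrow> t \<le> h \<Longrightarrow> x + t *\<^sub>R z \<in> \<Omega>"
begin

definition W where "W y = (\<Sum>j\<in>UNIV. of_real (z $ j) * w j y)"
definition v0 where "v0 y = indicator \<Omega> y *\<^sub>R v y"
definition w0 where "w0 j y = indicator \<Omega> y *\<^sub>R w j y"
definition W0 where "W0 y = (\<Sum>j\<in>UNIV. of_real (z $ j) * w0 j y)"

lemma W_L2: "W \<in> L2 (lebesgue_on \<Omega>)"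
  unfolding W_def by (intro L2_sum L2_scale w)

lemma W0_eq: "W0 = (\<lambda>y. indicator \<Omega> y *\<^sub>R W y)"
  by (simp add: W0_def W_def w0_def scaleR_sum_right fun_eq_iff)

lemma v0_L2: "v0 \<in> L2 lebesgue" and w0_L2: "w0 j \<in> L2 lebesgue" and W0_L2: "W0 \<in> L2 lebesgue"
  using v w W_L2 L2_on_iff[OF open_lebesgue[OF \<Omega>]]
      unfolding v0_def[abs_def] w0_def[abs_def] W0_eq by auto

text \<open>Derivatives are taken inside \<open>\<Omega>\<close>, so the jump of the extension
  across the boundary does not enter.\<close>

lemma hw0: "has_weak_partial \<Omega> j v0 (w0 j)"
  by (rule has_weak_partial_cong[OF \<Omega> hw]) (auto simp: v0_def w0_def AE_lebesgue_on_iff[OF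
      open_lebesgue[OF \<Omega>]])

lemma difference_eq:
  assumes "0 \<le> t" "t \<le> h" "x \<in> U" shows "v0 (x + t *\<^sub>R z) - v0 x = v (x + t *\<^sub>R z) - v x"
  using path[OF assms(3,1,2)] path[OF assms(3), of 0] assms by (simp add: v0_def)

lemma restrict_UNIV:
  assumes "u \<in> L2 lebesgue" shows "u \<in> L2 (lebesgue_on U)" "L2_norm (lebesgue_on U) u
      \<le> L2_norm lebesgue u"
  using L2_on_subset[of UNIV U u] open_lebesgue[OF U(1)] assms by (simp_all add: lebesgue_on_UNIV)

lemma difference_L2:
  assumes "0 \<le> t" "t \<le> h" shows "(\<lambda>x. v (x + t *\<^sub>R z) - v x) \<in> L2 (lebesgue_on U)"
proof -
  have "(\<lambda>x. v0 (x + t *\<^sub>R z) - v0 x) \<in> L2 (lebesgue_on U)"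
    by (intro restrict_UNIV l2.diff_mem L2_translation v0_L2)
  moreover have "(\<lambda>x. indicator U x *\<^sub>R (v0 (x + t *\<^sub>R z) - v0 x))
      = (\<lambda>x. indicator U x *\<^sub>R (v (x + t *\<^sub>R z) - v x))"
    using difference_eq[OF assms] by (auto simp: indicator_def fun_eq_iff)
  ultimately show ?thesis by (simp add: L2_on_iff open_lebesgue U)
qed

lemma test_space_outside: "\<psi> \<in> test_space U \<Longrightarrow> x \<notin> U \<Longrightarrow> \<psi> x = 0"
  by (auto simp: test_space_def test_fun_def complex_eq_iff)

lemma ip_difference:
  assumes "0 \<le> t" "t \<le> h" "\<And>x. x \<notin> U \<Longrightarrow> g x = 0"
  shows "ip (lebesgue_on U) (\<lambda>x. v (x + t *\<^sub>R z) - v x) g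
      = ip lebesgue (\<lambda>x. v0 (x + t *\<^sub>R z) - v0 x) g"
proof -
  have "ip (lebesgue_on U) (\<lambda>x. v (x + t *\<^sub>R z) - v x) g
      = ip (lebesgue_on U) (\<lambda>x. v0 (x + t *\<^sub>R z) - v0 x) g"
    using difference_eq[OF assms(1,2)] by (intro ip_cong_on) auto
  also have "\<dots> = ip lebesgue (\<lambda>x. v0 (x + t *\<^sub>R z) - v0 x) g"
    using assms(3) by (intro ip_on open_lebesgue U)
  finally show ?thesis .
qed

lemma L2_norm_test: "\<psi> \<in> test_space U \<Longrightarrow> L2_norm lebesgue \<psi> = L2_norm (lebesgue_on U) \<psi>"
  using test_space_outside[of \<psi>]
  by (auto simp: L2_norm_on[OF open_lebesgue[OF U(1)]] indicator_def intro!: arg_cong[where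
      f="L2_norm lebesgue"])

text \<open>The bound concerns \<open>v\<close> on \<open>U\<close>, whereas the pairings are
  computed with the extension on the whole space; for test functions of \<open>U\<close> the two
  coincide.\<close>

theorem translation_estimate:
  assumes t: "0 \<le> t" "t \<le> h"
  shows "L2_norm (lebesgue_on U) (\<lambda>x. v (x + t *\<^sub>R z) - v x) \<le> t * L2_norm (lebesgue_on \<Omega>) W"
proof (rule L2_norm_le_by_test_space[OF U difference_L2[OF t]])
  fix \<psi> assume \<psi>: "\<psi> \<in> test_space U"
  have "\<bar>ip lebesgue (\<lambda>x. v0 (x + t *\<^sub>R z) - v0 x) \<psi>\<bar>
      \<le> t * L2_norm lebesgue W0 * L2_norm lebesgue \<psi>"
    unfolding W0_def[abs_def]
    by (rule translation_pairing_bound[OF \<Omega> \<psi> v0_L2 w0_L2 hw0 _ t(1)]) (use path t in auto)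
  then show "\<bar>ip (lebesgue_on U) (\<lambda>x. v (x + t *\<^sub>R z) - v x) \<psi>\<bar>
      \<le> t * L2_norm (lebesgue_on \<Omega>) W * L2_norm (lebesgue_on U) \<psi>"
    using ip_difference[OF t test_space_outside[OF \<psi>]] L2_norm_test[OF \<psi>]
    by (simp add: W0_eq L2_norm_on[OF open_lebesgue[OF \<Omega>]])
qed (use t in auto)

text \<open>For a test function in place of \<open>g\<close> this is the derivative of the
  translation flow at \<open>0\<close>. A general \<open>g\<close> is approximated by test
  functions; the error is uniform in \<open>t\<close> since \<open>translation_estimate\<close>
  bounds the difference quotients.\<close>

theorem difference_quotient_weak_limit:
  assumes h: "h > 0" and g: "g \<in> L2 (lebesgue_on U)"
  shows "((\<lambda>t. ip (lebesgue_on U) (\<lambda>x. v (x + t *\<^sub>R z) - v x) g / t)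
      \<longlongrightarrow> ip (lebesgue_on U) W g) (at_right 0)"
proof (rule tendstoI)
  fix e :: real assume e: "e > 0"
  let ?M = "lebesgue_on U"
  define D where "D t = (\<lambda>x. v (x + t *\<^sub>R z) - v x)" for t
  define B where "B = L2_norm (lebesgue_on \<Omega>) W"
  have B0: "B \<ge> 0" by (simp add: B_def)
  have UO: "U \<subseteq> \<Omega>" using path[of _ 0] h by auto
  have WU: "W \<in> L2 ?M" "L2_norm ?M W \<le> B"
    unfolding B_def by (intro L2_on_subset[OF open_lebesgue[OF \<Omega>] open_lebesgue[OF U(1)] UO W_L2])+
  \<comment> \<open>\<open>g - \<psi>\<close> is paired with the quotient and with \<open>W\<close>,
    each of norm at most \<open>B\<close>: two errors \<open>B * e'\<close>, together at most
    \<open>e / 2\<close>. The summand \<open>1\<close> covers \<open>B = 0\<close>.\<close>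
  define e' where "e' = e / (4 * (B + 1))"
  have e': "e' > 0" "2 * (B * e') \<le> e / 2"
    using e B0 by (auto simp: e'_def divide_simps)
  obtain \<psi> where \<psi>: "\<psi> \<in> test_space U" "L2_norm ?M (\<lambda>x. g x - \<psi> x) < e'"
    using test_space_dense[OF U g e'(1)] by blast
  have \<psi>L: "\<psi> \<in> L2 ?M" using \<psi>(1) test_space_L2 open_lebesgue[OF U(1)] by blast
  have dL: "(\<lambda>x. g x - \<psi> x) \<in> L2 ?M" by (intro l2.diff_mem g \<psi>L)
  let ?F = "\<lambda>t. ip lebesgue v0 (\<lambda>y. \<psi> (y - t *\<^sub>R z))"
  have "(?F has_real_derivative ip lebesgue W0 (\<lambda>y. \<psi> (y - 0 *\<^sub>R z))) (at 0 within {0..h})"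
    unfolding W0_def[abs_def]
    by (rule translation_flow_deriv[OF \<Omega> \<psi>(1) v0_L2 w0_L2 hw0 path]) (use h in auto)
  then have lim: "((\<lambda>t. (?F t - ?F 0) / t) \<longlongrightarrow> ip lebesgue W0 \<psi>) (at_right 0)"
    using h by (simp add: has_field_derivative_iff at_within_Icc_at_right)
  have WW0: "ip lebesgue W0 \<psi> = ip ?M W \<psi>"
  proof -
    have "ip ?M W \<psi> = ip ?M W0 \<psi>" using UO by (intro ip_cong_on) (auto simp: W0_eq)
    also have "\<dots> = ip lebesgue W0 \<psi>" using test_space_outside[OF \<psi>(1)]
        by (intro ip_on open_lebesgue U)
    finally show ?thesis by simp
  qed
  have \<psi>L': "\<psi> \<in> L2 lebesgue" using test_space_L2[OF \<psi>(1), of UNIV] by (simp add: lebesgue_on_UNIV)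
  have FD: "?F t - ?F 0 = ip ?M (D t) \<psi>" if "0 < t" "t < h" for t
    using ip_translation[OF v0_L2 \<psi>L', of "t *\<^sub>R z"] l2.diff_left[OF L2_translation(1)[OF v0_L2]
        v0_L2 \<psi>L']
      ip_difference[of t \<psi>] test_space_outside[OF \<psi>(1)] that by (simp add: D_def)
  have "\<forall>\<^sub>F t in at_right 0. dist ((?F t - ?F 0) / t) (ip lebesgue W0 \<psi>) < e / 2"
    using tendstoD[OF lim, of "e / 2"] e by simp
  moreover have "\<forall>\<^sub>F t in at_right 0. t \<in> {0<..<h}" by (rule eventually_at_rightI[OF _ h])
  ultimately show "\<forall>\<^sub>F t in at_right 0. dist (ip ?M (\<lambda>x. v (x + t *\<^sub>R z)
      - v x) g / t) (ip ?M W g) < e"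
  proof eventually_elim
    case (elim t)
    then have t: "0 < t" "t < h" by auto
    have DL: "D t \<in> L2 ?M" unfolding D_def using t by (intro difference_L2) auto
    have "L2_norm ?M (D t) \<le> t * B" unfolding D_def B_def using t
        by (intro translation_estimate) auto
    then have 1: "\<bar>ip ?M (D t) (\<lambda>x. g x - \<psi> x)\<bar> \<le> t * B * e'"
      using ip_bound[OF DL dL] \<psi>(2) B0 t
      by (meson less_imp_le mult_mono L2_norm_nonneg mult_nonneg_nonneg order_trans)
    have "\<bar>ip ?M (D t) (\<lambda>x. g x - \<psi> x) / t\<bar> = \<bar>ip ?M (D t) (\<lambda>x. g x - \<psi> x)\<bar> / t" using t
        by (simp add: abs_divide)
    also have "\<dots> \<le> t * B * e' / t" using 1 t by (intro divide_right_mono) auto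
    finally have 1: "\<bar>ip ?M (D t) (\<lambda>x. g x - \<psi> x) / t\<bar> \<le> B * e'" using t by simp
    have 2: "\<bar>ip ?M W (\<lambda>x. g x - \<psi> x)\<bar> \<le> B * e'"
      using ip_bound[OF WU(1) dL] \<psi>(2) WU(2) B0
      by (meson less_imp_le mult_mono L2_norm_nonneg order_trans)
    have 3: "\<bar>ip ?M (D t) \<psi> / t - ip ?M W \<psi>\<bar> < e / 2"
      using elim(1) unfolding FD[OF t] WW0 by (simp add: dist_real_def)
    have "ip ?M (D t) g = ip ?M (D t) (\<lambda>x. g x - \<psi> x) + ip ?M (D t) \<psi>"
      using l2.diff_right[OF g \<psi>L DL] by simp
    moreover have "ip ?M W g = ip ?M W (\<lambda>x. g x - \<psi> x) + ip ?M W \<psi>"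
      using l2.diff_right[OF g \<psi>L WU(1)] by simp
    ultimately have "ip ?M (D t) g / t - ip ?M W g =
        ip ?M (D t) (\<lambda>x. g x - \<psi> x) / t + (ip ?M (D t) \<psi> / t - ip ?M W \<psi>) - ip ?M W (\<lambda>x. g x - \<psi> x)"
      by (simp add: add_divide_distrib)
    then have "\<bar>ip ?M (D t) g / t - ip ?M W g\<bar> < e" using 1 2 3 e'(2) by linarith
    then show ?case by (simp add: dist_real_def D_def)
  qed
qed

end

text \<open>A difference quotient can be moved from one factor to the other, and the quotients of both
  factors converge weakly.\<close>

theorem integration_by_parts:
  fixes v g :: "real^'n \<Rightarrow> complex"
  assumes \<Omega>: "open \<Omega>" "bounded \<Omega>"
    and v: "v \<in> L2 (lebesgue_on \<Omega>)" "\<And>j. w j \<in> L2 (lebesgue_on \<Omega>)"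
        "\<And>j. has_weak_partial \<Omega> j v (w j)"
    and g: "g \<in> L2 lebesgue" "\<And>j. g' j \<in> L2 lebesgue" "\<And>j. has_weak_partial UNIV j g (g' j)"
    and K: "compact K" "K \<subseteq> \<Omega>" "\<And>x. x \<notin> K \<Longrightarrow> g x = 0"
  shows "ip (lebesgue_on \<Omega>) (w j) g = - ip (lebesgue_on \<Omega>) v (g' j)"
proof -
  obtain e where e: "e > 0" "(\<Union>x\<in>K. ball x e) \<subseteq> \<Omega>"
    using compact_subset_open_imp_ball_epsilon_subset[OF K(1) \<Omega>(1) K(2)] by blast
  \<comment> \<open>Points of \<open>U\<close> are within \<open>e / 2\<close> of \<open>K\<close>
    and shifts have length at most \<open>e / 3\<close>, so shifted points are within
    \<open>e\<close> of \<open>K\<close>, hence in \<open>\<Omega>\<close>.\<close>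
  define U where "U = (\<Union>x\<in>K. ball x (e / 2))"
  define h where "h = e / 3"
  have h: "h > 0" using e by (simp add: h_def)
  have U: "open U" by (auto simp: U_def)
  have KU: "K \<subseteq> U" using e by (auto simp: U_def)
  have path: "x + t *\<^sub>R axis j 1 \<in> \<Omega>" if x: "x \<in> U" and t: "0 \<le> t" "t \<le> h" for x t
  proof -
    from x obtain y where y: "y \<in> K" "dist y x < e / 2" by (auto simp: U_def)
    have "dist x (x + t *\<^sub>R axis j 1) = t" using t by (simp add: dist_norm norm_axis_1)
    then have "dist y (x + t *\<^sub>R axis j 1) < e"
      using dist_triangle[of y "x + t *\<^sub>R axis j 1" x] y(2) t e(1) by (simp add: h_def)
    then have "x + t *\<^sub>R axis j 1 \<in> ball y e" by simp
    then show ?thesis using e(2) y(1) by blast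
  qed
  have UO: "U \<subseteq> \<Omega>" using path[of _ 0] h by auto
  have bU: "bounded U" using bounded_subset[OF \<Omega>(2) UO] .
  have u0: "lebesgue_on UNIV = (lebesgue :: (real^'n) measure)" by (rule lebesgue_on_UNIV)
  \<comment> \<open>\<open>A\<close> shifts \<open>v\<close> forward from a neighbourhood of
    \<open>K\<close>; \<open>C\<close> shifts \<open>g\<close> backward, for which the whole space
    is available because \<open>g\<close> is weakly differentiable everywhere. The minus sign of the
    theorem is that of \<open>- axis j 1\<close>.\<close>
  interpret A: translation_domain \<Omega> U h "axis j 1" v w
    by unfold_locales (use \<Omega> U bU v path in auto)
  interpret C: translation_domain UNIV \<Omega> h "- axis j 1" g g'
    by unfold_locales (use \<Omega> g in \<open>auto simp: u0\<close>)
  have gU: "g \<in> L2 (lebesgue_on U)" by (rule A.restrict_UNIV[OF g(1)])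
  have AW: "A.W = w j"
  proof
    fix y
    have "A.W y = (\<Sum>i\<in>UNIV. if i = j then w i y else 0)"
      unfolding A.W_def by (rule sum.cong) (auto simp: axis_def)
    then show "A.W y = w j y" by simp
  qed
  have CW: "C.W = (\<lambda>x. - 1 * g' j x)"
  proof
    fix y
    have "C.W y = (\<Sum>i\<in>UNIV. if i = j then - g' i y else 0)"
      unfolding C.W_def by (rule sum.cong) (auto simp: axis_def)
    then show "C.W y = - 1 * g' j y" by simp
  qed
  have l1: "((\<lambda>t. ip (lebesgue_on U) (\<lambda>x. v (x + t *\<^sub>R axis j 1) - v x) g / t)
      \<longlongrightarrow> ip (lebesgue_on U) (w j) g) (at_right 0)"
    using A.difference_quotient_weak_limit[OF h gU] by (simp add: AW)
  have l2: "((\<lambda>t. ip (lebesgue_on \<Omega>) (\<lambda>x. g (x + t *\<^sub>R (- axis j 1)) - g x) v / t)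
      \<longlongrightarrow> ip (lebesgue_on \<Omega>) (\<lambda>x. - 1 * g' j x) v) (at_right 0)"
    using C.difference_quotient_weak_limit[OF h v(1)] unfolding CW .
  have gout: "g x = 0" if "x \<notin> U" for x using K(3) KU that by blast
  \<comment> \<open>Substitution moves the shift from \<open>v\<close> to \<open>g\<close> exactly,
    so the two quotients agree for every small \<open>t\<close> and have the same limit.\<close>
  have "\<forall>\<^sub>F t in at_right 0. ip (lebesgue_on \<Omega>) (\<lambda>x. g (x + t *\<^sub>R (- axis j 1)) - g x) v / t =
      ip (lebesgue_on U) (\<lambda>x. v (x + t *\<^sub>R axis j 1) - v x) g / t"
  proof (rule eventually_at_rightI[OF _ h])
    fix t assume "t \<in> {0<..<h}"
    then have t: "0 \<le> t" "t \<le> h" by auto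
    let ?a = "t *\<^sub>R (axis j 1 :: real^'n)"
    have gt: "(\<lambda>x. g (x - ?a)) \<in> L2 lebesgue" using L2_translation(1)[OF g(1), of "- ?a"] by simp
    have "ip (lebesgue_on U) (\<lambda>x. v (x + ?a) - v x) g = ip lebesgue (\<lambda>x. A.v0 (x + ?a) - A.v0 x) g"
      using gout by (rule A.ip_difference[OF t])
    also have "\<dots> = ip lebesgue A.v0 (\<lambda>x. g (x - ?a)) - ip lebesgue A.v0 g"
      using l2.diff_left[OF L2_translation(1)[OF A.v0_L2] A.v0_L2 g(1)] ip_translation[OF A.v0_L2
          g(1)] by simp
    also have "\<dots> = ip lebesgue A.v0 (\<lambda>x. g (x - ?a) - g x)"
      using l2.diff_right[OF gt g(1) A.v0_L2] by simp
    also have "\<dots> = ip lebesgue (\<lambda>x. g (x - ?a) - g x) A.v0" by (simp add: ip_def inner_commute)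
    also have "\<dots> = ip (lebesgue_on \<Omega>) (\<lambda>x. g (x - ?a) - g x) A.v0"
      by (rule ip_on[symmetric]) (auto simp: A.v0_def open_lebesgue \<Omega>)
    also have "\<dots> = ip (lebesgue_on \<Omega>) (\<lambda>x. g (x - ?a) - g x) v"
      by (rule ip_cong_on) (auto simp: A.v0_def)
    finally show "ip (lebesgue_on \<Omega>) (\<lambda>x. g (x + t *\<^sub>R (- axis j 1)) - g x) v / t =
      ip (lebesgue_on U) (\<lambda>x. v (x + ?a) - v x) g / t" by simp
  qed
  then have "((\<lambda>t. ip (lebesgue_on U) (\<lambda>x. v (x + t *\<^sub>R axis j 1) - v x) g / t)
      \<longlongrightarrow> ip (lebesgue_on \<Omega>) (\<lambda>x. - 1 * g' j x) v) (at_right 0)"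
    by (rule Lim_transform_eventually[OF l2])
  then have "ip (lebesgue_on U) (w j) g = ip (lebesgue_on \<Omega>) (\<lambda>x. - 1 * g' j x) v"
    by (rule tendsto_unique[OF trivial_limit_at_right_real l1])
  moreover have "ip (lebesgue_on U) (w j) g = ip lebesgue (w j) g"
    by (rule ip_on[OF open_lebesgue[OF U] gout])
  moreover have "ip (lebesgue_on \<Omega>) (w j) g = ip lebesgue (w j) g"
    by (rule ip_on[OF open_lebesgue[OF \<Omega>(1)]]) (use gout UO in blast)
  moreover have "ip (lebesgue_on \<Omega>) (\<lambda>x. - 1 * g' j x) v = - ip (lebesgue_on \<Omega>) v (g' j)"
    by (simp add: ip_def inner_commute)
  ultimately show ?thesis by simp
qed

section \<open>The equation in weak form\<close>

lemma integrable_lebesgue_on: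
  fixes f :: "'a::euclidean_space \<Rightarrow> 'b::{banach, second_countable_topology}"
  shows "integrable lebesgue f \<Longrightarrow> S \<in> sets lebesgue \<Longrightarrow> integrable (lebesgue_on S) f"
  by (simp add: integrable_restrict_space integrable_mult_indicator)

text \<open>The definition for \<open>a\<close> is tested with \<open>\<psi> \<phi>\<close>, to
  which the product rule applies. The factor \<open>\<phi>\<close> confines everything to a compact
  part of \<open>\<Omega>\<close>, so the product has a weak derivative on the whole space, as
  \<open>integration_by_parts\<close> demands of its second factor.\<close>

lemma has_weak_partial_test_mult:
  fixes a a' :: "real^'n \<Rightarrow> real"
  assumes \<Omega>: "open \<Omega>" and a: "has_weak_partial \<Omega> j a a'" and \<phi>: "test_fun \<Omega> \<phi>"
  shows "has_weak_partial UNIV j (\<lambda>x. \<phi> x * a x) (\<lambda>x. \<phi> x * a' x + partial_deriv j \<phi> x * a x)"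
  unfolding has_weak_partial_iff[OF open_UNIV]
proof (intro conjI allI impI)
  have l: "loc_integrable \<Omega> a" "loc_integrable \<Omega> a'" using a by (auto simp: has_weak_partial_def)
  note ti = test_integrable[OF l(1), simplified] test_integrable[OF l(2), simplified]
  have i: "integrable lebesgue (\<lambda>x. \<phi> x * a x)" "integrable lebesgue (\<lambda>x. \<phi> x * a' x)"
    "integrable lebesgue (\<lambda>x. partial_deriv j \<phi> x * a x)"
    by (intro ti \<phi> test_fun_partial_deriv)+
  show "loc_integrable UNIV (\<lambda>x. \<phi> x * a x)"
    "loc_integrable UNIV (\<lambda>x. \<phi> x * a' x + partial_deriv j \<phi> x * a x)"
    using i by (auto simp: loc_integrable_def sets_completionI_sets borel_compact intro!:
        integrable_lebesgue_on)
  fix \<psi> :: "real^'n \<Rightarrow> real" assume \<psi>: "test_fun UNIV \<psi>"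
  have sm: "smooth_fun \<psi>" "smooth_fun (partial_deriv j \<psi>)"
    using \<psi> test_fun_partial_deriv[OF \<psi>] by (auto simp: test_fun_def)
  have t: "test_fun \<Omega> (\<lambda>x. \<psi> x * \<phi> x)" by (rule test_fun_mult[OF \<phi> sm(1)])
  have pd: "partial_deriv j (\<lambda>x. \<psi> x * \<phi> x) = (\<lambda>x. partial_deriv j \<psi> x * \<phi> x + \<psi> x
      * partial_deriv j \<phi> x)"
    by (rule ext) (rule partial_deriv_mult[OF test_fun_differentiable[OF \<psi>]
        test_fun_differentiable[OF \<phi>]])
  have j1: "integrable lebesgue (\<lambda>x. partial_deriv j \<psi> x * \<phi> x * a x)"
    by (intro ti test_fun_mult[OF \<phi> sm(2)])
  have j2: "integrable lebesgue (\<lambda>x. \<psi> x * partial_deriv j \<phi> x * a x)"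
    by (intro ti test_fun_mult[OF test_fun_partial_deriv[OF \<phi>] sm(1)])
  have j3: "integrable lebesgue (\<lambda>x. \<psi> x * \<phi> x * a' x)" by (intro ti t)
  have "(\<integral>x. partial_deriv j (\<lambda>x. \<psi> x * \<phi> x) x * a x \<partial>lebesgue)
      = - (\<integral>x. \<psi> x * \<phi> x * a' x \<partial>lebesgue)"
    using a t unfolding has_weak_partial_iff[OF \<Omega>] by auto
  then have "(\<integral>x. partial_deriv j \<psi> x * \<phi> x * a x \<partial>lebesgue) =
      - ((\<integral>x. \<psi> x * \<phi> x * a' x \<partial>lebesgue) + (\<integral>x. \<psi> x * partial_deriv j \<phi> x * a x \<partial>lebesgue))"
    unfolding pd using j1 j2 by (simp add: distrib_right)
  also have "\<dots> = - (\<integral>x. \<psi> x * (\<phi> x * a' x + partial_deriv j \<phi> x * a x) \<partial>lebesgue)"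
    using j2 j3 by (simp add: distrib_left mult.assoc)
  finally show "(\<integral>x. partial_deriv j \<psi> x *\<^sub>R (\<phi> x * a x) \<partial>lebesgue) =
      - (\<integral>x. \<psi> x *\<^sub>R (\<phi> x * a' x + partial_deriv j \<phi> x * a x) \<partial>lebesgue)"
    by (simp add: mult.assoc)
qed

lemma test_mult_Linf_L2:
  fixes a :: "real^'n \<Rightarrow> real"
  assumes \<Omega>: "open \<Omega>" and \<phi>: "test_fun \<Omega> \<phi>" and a: "a \<in> Linf (lebesgue_on \<Omega>)"
  shows "(\<lambda>x. complex_of_real (\<phi> x * a x)) \<in> L2 lebesgue"
proof -
  have "(\<lambda>x. complex_of_real (a x)) \<in> Linf (lebesgue_on \<Omega>)" using a by (auto simp: Linf_def)
  from L2_mult_Linf[OF this test_fun_L2[OF \<phi> open_lebesgue[OF \<Omega>]]]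
  have "(\<lambda>x. complex_of_real (\<phi> x * a x)) \<in> L2 (lebesgue_on \<Omega>)" by (simp add: mult.commute)
  moreover have "(\<lambda>x. indicator \<Omega> x *\<^sub>R complex_of_real (\<phi> x * a x))
      = (\<lambda>x. complex_of_real (\<phi> x * a x))"
  proof
    show "indicator \<Omega> x *\<^sub>R complex_of_real (\<phi> x * a x) = complex_of_real (\<phi> x * a x)" for x
      using \<phi> by (cases "x \<in> \<Omega>") (auto simp: test_fun_def)
  qed
  ultimately show ?thesis by (simp only: L2_on_iff[OF open_lebesgue[OF \<Omega>]])
qed

text \<open>\<open>F\<close> is the formal \<open>j\<close>-th derivative of
  \<open>\<phi> a v\<close>, with the derivative of \<open>v\<close> kept apart from that of
  \<open>\<phi> a\<close>. Integration by parts with second factor \<open>c \<phi> a\<close>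
  annihilates the real part of the integral for \<open>c = 1\<close> and the imaginary part for
  \<open>c = \<i>\<close>.\<close>

theorem product_integration_by_parts:
  fixes v :: "real^'n \<Rightarrow> complex" and a :: "real^'n \<Rightarrow> real" and j :: 'n
  assumes \<Omega>: "open \<Omega>" "bounded \<Omega>" and v: "v \<in> sobolev 1 \<Omega>"
    and a: "a \<in> Linf (lebesgue_on \<Omega>)" "\<And>p. a' p \<in> Linf (lebesgue_on \<Omega>)"
        "\<And>p. has_weak_partial \<Omega> p a (a' p)"
    and \<phi>: "test_fun \<Omega> \<phi>"
  defines "F \<equiv> \<lambda>x. of_real (\<phi> x * a x) * weak_partial \<Omega> j v x +
      of_real (\<phi> x * a' j x + partial_deriv j \<phi> x * a x) * v x"
  shows "integrable (lebesgue_on \<Omega>) F" "(\<integral>x. F x \<partial>lebesgue_on \<Omega>) = 0"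
proof -
  note D = sobolev1_D[OF \<Omega>(1) v]
  define g where "g x = \<phi> x * a x" for x
  define g' where "g' p x = \<phi> x * a' p x + partial_deriv p \<phi> x * a x" for p x
  have gL: "(\<lambda>x. complex_of_real (g x)) \<in> L2 lebesgue"
    unfolding g_def by (rule test_mult_Linf_L2[OF \<Omega>(1) \<phi> a(1)])
  have g'L: "(\<lambda>x. complex_of_real (g' p x)) \<in> L2 lebesgue" for p
    using L2_add[OF test_mult_Linf_L2[OF \<Omega>(1) \<phi> a(2)] test_mult_Linf_L2[OF \<Omega>(1)
        test_fun_partial_deriv[OF \<phi>] a(1)]]
    by (simp add: g'_def)
  have h: "has_weak_partial UNIV p g (g' p)" for p
    using has_weak_partial_test_mult[OF \<Omega>(1) a(3) \<phi>] unfolding g_def[abs_def] g'_def[abs_def] .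
  obtain K where K: "compact K" "K \<subseteq> \<Omega>" "\<And>x. x \<notin> K \<Longrightarrow> g x = 0"
    using \<phi> by (auto simp: test_fun_def g_def)
  have on: "f \<in> L2 (lebesgue_on \<Omega>)" if "f \<in> L2 lebesgue" for f
    using L2_on_subset(1)[of UNIV \<Omega> f] that open_lebesgue[OF \<Omega>(1)] by (simp add: lebesgue_on_UNIV)
  have i1: "integrable (lebesgue_on \<Omega>) (\<lambda>x. of_real (g x) * weak_partial \<Omega> j v x)"
    by (rule L2_integrable_mult[OF on[OF gL] D(3)])
  have i2: "integrable (lebesgue_on \<Omega>) (\<lambda>x. of_real (g' j x) * v x)"
    by (rule L2_integrable_mult[OF on[OF g'L] D(1)])
  have F: "F = (\<lambda>x. of_real (g x) * weak_partial \<Omega> j v x + of_real (g' j x) * v x)"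
    by (simp add: F_def g_def g'_def)
  show iF: "integrable (lebesgue_on \<Omega>) F" unfolding F using i1 i2 by simp
  have ibp: "ip (lebesgue_on \<Omega>) (weak_partial \<Omega> j v) (\<lambda>x. c * of_real (g x)) =
      - ip (lebesgue_on \<Omega>) v (\<lambda>x. c * of_real (g' j x))" for c
  proof (rule integration_by_parts[OF \<Omega> D(1,3,2)])
    show "(\<lambda>x. c * of_real (g x)) \<in> L2 lebesgue" "(\<lambda>x. c * of_real (g' p x)) \<in> L2 lebesgue" for p
      by (intro L2_scale gL g'L)+
    show "has_weak_partial UNIV p (\<lambda>x. c * of_real (g x)) (\<lambda>x. c * of_real (g' p x))" for p
      by (rule has_weak_partial_bounded_linear[OF open_UNIV _ h, of "\<lambda>r. c * of_real r"])
         (auto intro!: bounded_linear_intros bounded_linear_of_real)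
  qed (use K in auto)
  have "(\<integral>x. Re (F x) \<partial>lebesgue_on \<Omega>) = ip (lebesgue_on \<Omega>) (weak_partial \<Omega> j v) (\<lambda>x. 1
      * of_real (g x)) + ip (lebesgue_on \<Omega>) v (\<lambda>x. 1 * of_real (g' j x))"
    unfolding ip_def F using integrable_Re[OF i1] integrable_Re[OF i2]
    by (simp add: inner_complex_def mult.commute)
  then have R: "Re (\<integral>x. F x \<partial>lebesgue_on \<Omega>) = 0" using ibp[of 1] integral_Re[OF iF] by simp
  have "(\<integral>x. Im (F x) \<partial>lebesgue_on \<Omega>) = ip (lebesgue_on \<Omega>) (weak_partial \<Omega> j v) (\<lambda>x. \<i>
      * of_real (g x)) + ip (lebesgue_on \<Omega>) v (\<lambda>x. \<i> * of_real (g' j x))"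
    unfolding ip_def F using integrable_Im[OF i1] integrable_Im[OF i2]
    by (simp add: inner_complex_def mult.commute)
  then have "Im (\<integral>x. F x \<partial>lebesgue_on \<Omega>) = 0" using ibp[of "\<i>"] integral_Im[OF iF] by simp
  with R show "(\<integral>x. F x \<partial>lebesgue_on \<Omega>) = 0" by (simp add: complex_eq_iff)
qed

text \<open>The weak derivatives \<open>da\<close> are fixed once, and one constant \<open>B\<close>
  serves for all coefficients. It bounds the derivatives \<open>da j j m\<close>, because
  integrating the term with \<open>a2 j m\<close> by parts in direction \<open>j\<close> puts
  exactly these on the coefficients.\<close>

locale elliptic =
  fixes \<Omega> :: "(real^'n) set" and a2 :: "'n \<Rightarrow> 'n \<Rightarrow> real^'n \<Rightarrow> real" and da ::
      "'n \<Rightarrow> 'n \<Rightarrow> 'n \<Rightarrow> real^'n \<Rightarrow> real"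
    and a1 :: "'n \<Rightarrow> real^'n \<Rightarrow> complex" and a a0 :: "real^'n \<Rightarrow> complex" and B :: real
  assumes \<Omega>: "open \<Omega>" "bounded \<Omega>"
    and a2: "\<And>j m. a2 j m \<in> Linf (lebesgue_on \<Omega>)"
    and da: "\<And>p j m. da p j m \<in> Linf (lebesgue_on \<Omega>)"
        "\<And>p j m. has_weak_partial \<Omega> p (a2 j m) (da p j m)"
    and a1: "\<And>j. a1 j \<in> Linf (lebesgue_on \<Omega>)"
    and a: "a \<in> Linf (lebesgue_on \<Omega>)" and a0: "a0 \<in> Linf (lebesgue_on \<Omega>)"
    and B: "B \<ge> 0" "\<And>j m. AE x in lebesgue_on \<Omega>. \<bar>a2 j m x\<bar>
        \<le> B" "\<And>j m. AE x in lebesgue_on \<Omega>. \<bar>da j j m x\<bar> \<le> B"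
      "\<And>j. AE x in lebesgue_on \<Omega>. norm (a1 j x) \<le> B" "AE x in lebesgue_on \<Omega>. norm (a x) \<le> B"
      "AE x in lebesgue_on \<Omega>. norm (a0 x) \<le> B"
begin

definition solves :: "real \<Rightarrow> (real^'n \<Rightarrow> complex) \<Rightarrow> (real^'n \<Rightarrow> complex) \<Rightarrow> bool" where
  "solves k f u \<longleftrightarrow> u \<in> sobolev 2 \<Omega> \<and> (AE x in lebesgue_on \<Omega>.
     op_A \<Omega> a2 a1 a u x - \<i> * a0 x * of_real k * u x + of_real (k\<^sup>2) * u x = f x)"

text \<open>Up to constants and one factor \<open>k\<close>, this majorises all that is left of the
  tested equation once its second derivatives have been integrated away.\<close>

definition data_fun :: "(real^'n \<Rightarrow> complex) \<Rightarrow> (real^'n \<Rightarrow> complex) \<Rightarrow> real^'n \<Rightarrow> real" where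
  "data_fun f u x = norm (f x) + (\<Sum>m\<in>UNIV. norm (weak_partial \<Omega> m u x)) + norm (u x)"

lemma L2_op_A:
  assumes "u \<in> sobolev 2 \<Omega>"
  shows "(\<lambda>x. op_A \<Omega> a2 a1 a u x - \<i> * a0 x * of_real k * u x + of_real (k\<^sup>2)
      * u x) \<in> L2 (lebesgue_on \<Omega>)"
proof -
  note D = sobolev2_D[OF \<Omega>(1) assms]
  have "(\<lambda>x. complex_of_real (a2 j m x)) \<in> Linf (lebesgue_on \<Omega>)" for j m
    using a2[of j m] by (auto simp: Linf_def)
  then have "(\<lambda>x. \<Sum>j\<in>UNIV. \<Sum>m\<in>UNIV. of_real (a2 j m x)
      * weak_partial \<Omega> j (weak_partial \<Omega> m u) x) \<in> L2 (lebesgue_on \<Omega>)"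
    by (intro L2_sum L2_mult_Linf sobolev1_D(3)[OF \<Omega>(1)] D)
  moreover have "(\<lambda>x. \<Sum>j\<in>UNIV. a1 j x * weak_partial \<Omega> j u x) \<in> L2 (lebesgue_on \<Omega>)"
    by (intro L2_sum L2_mult_Linf a1 sobolev1_D(3)[OF \<Omega>(1)] D)
  moreover have "(\<lambda>x. a x * u x) \<in> L2 (lebesgue_on \<Omega>)"
    by (intro L2_mult_Linf a sobolev1_D(1)[OF \<Omega>(1)] D)
  moreover have "(\<lambda>x. \<i> * a0 x * of_real k * u x) \<in> L2 (lebesgue_on \<Omega>)"
    using L2_scale[OF L2_mult_Linf[OF a0 sobolev1_D(1)[OF \<Omega>(1) D(1)]], of "\<i> * of_real k"]
        by (simp add: mult_ac)
  moreover have "(\<lambda>x. of_real (k\<^sup>2) * u x) \<in> L2 (lebesgue_on \<Omega>)"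
    by (intro L2_scale sobolev1_D(1)[OF \<Omega>(1)] D)
  ultimately show ?thesis
    unfolding op_A_def by (intro L2_add l2.diff_mem)
qed

text \<open>The equation makes \<open>f\<close> equal almost everywhere to an expression in
  \<open>u\<close>, its derivatives up to order two and bounded coefficients.\<close>

lemma solves_L2: "solves k f u \<Longrightarrow> f \<in> L2 (lebesgue_on \<Omega>)"
  using L2_cong_AE(1)[OF L2_op_A borel_measurable_on_AE[OF open_lebesgue[OF \<Omega>(1)]
      L2_measurable[OF L2_op_A]]]
  unfolding solves_def by blast

lemma data_fun_L2:
  assumes "solves k f u"
  shows "(\<lambda>x. complex_of_real (data_fun f u x)) \<in> L2 (lebesgue_on \<Omega>)"
    "L2_norm (lebesgue_on \<Omega>) (\<lambda>x. complex_of_real (data_fun f u x))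
        \<le> (real CARD('n) + 1) * (norm0 \<Omega> f + norm1 \<Omega> u)"
proof -
  let ?M = "lebesgue_on \<Omega>"
  have u: "u \<in> sobolev 1 \<Omega>" using assms sobolev2_D[OF \<Omega>(1)] by (simp add: solves_def)
  note D = sobolev1_D[OF \<Omega>(1) u]
  have n: "(\<lambda>x. complex_of_real (norm (g x))) \<in> L2 ?M"
      "L2_norm ?M (\<lambda>x. complex_of_real (norm (g x))) = L2_norm ?M g"
    if "g \<in> L2 ?M" for g using that by (auto simp: L2_def L2_norm_def)
  define s where "s x = (\<Sum>m\<in>UNIV. complex_of_real (norm (weak_partial \<Omega> m u x)))" for x
  have s: "s \<in> L2 ?M" unfolding s_def by (intro L2_sum n D)
  have "L2_norm ?M s \<le> (\<Sum>m\<in>(UNIV::'n set). norm1 \<Omega> u)"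
    unfolding s_def using n(2)[OF D(3)] norm1_ge(2)
    by (intro order_trans[OF L2_norm_sum[OF n(1)[OF D(3)]]] sum_mono) simp
  then have sn: "L2_norm ?M s \<le> real CARD('n) * norm1 \<Omega> u" by simp
  have eq: "(\<lambda>x. complex_of_real (data_fun f u x)) =
      (\<lambda>x. complex_of_real (norm (f x)) + (s x + complex_of_real (norm (u x))))"
    by (simp add: data_fun_def s_def fun_eq_iff)
  have fL: "f \<in> L2 ?M" using assms by (rule solves_L2)
  have su: "(\<lambda>x. s x + complex_of_real (norm (u x))) \<in> L2 ?M" by (intro L2_add s n D)
  show "(\<lambda>x. complex_of_real (data_fun f u x)) \<in> L2 ?M" unfolding eq by (intro L2_add n fL su)
  have "L2_norm ?M (\<lambda>x. complex_of_real (data_fun f u x))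
      \<le> L2_norm ?M f + (L2_norm ?M s + L2_norm ?M u)"
    unfolding eq using L2_norm_triangle[OF n(1)[OF fL] su] L2_norm_triangle[OF s n(1)[OF D(1)]]
    by (simp add: n(2)[OF fL] n(2)[OF D(1)])
  also have "\<dots> \<le> norm0 \<Omega> f + (real CARD('n) * norm1 \<Omega> u + norm1 \<Omega> u)"
    using sn norm1_ge(1) by (intro add_mono) auto
  also have "\<dots> \<le> (real CARD('n) + 1) * (norm0 \<Omega> f + norm1 \<Omega> u)"
    by (simp add: algebra_simps)
  finally show "L2_norm ?M (\<lambda>x. complex_of_real (data_fun f u x))
      \<le> (real CARD('n) + 1) * (norm0 \<Omega> f + norm1 \<Omega> u)" .
qed

text \<open>With \<open>n\<close> for the dimension, the bound below has coefficients
  \<open>1\<close> at \<open>f\<close>, \<open>B + 2 n k B\<close> at the gradient and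
  \<open>B + k B\<close> at \<open>u\<close>; for \<open>k \<ge> 1\<close> each is at most
  \<open>k * C1\<close>.\<close>

definition C1 :: real where "C1 = 1 + B * (2 * real CARD('n) + 2)"

text \<open>The weights of \<open>\<phi>\<close> and its gradient are those of a bump of width \<open>1 / k\<close>.  The second
  derivatives of \<open>u\<close> disappear through \<open>T\<close>, whose integral is zero.\<close>

theorem weak_form_bound:
  assumes sol: "solves k f u" and k: "k \<ge> 1" and \<phi>: "test_fun \<Omega> \<phi>"
    and m: "\<And>x. \<bar>\<phi> x\<bar> \<le> m * indicator S x" "\<And>j x. \<bar>partial_deriv j \<phi> x\<bar>
        \<le> k * m * indicator S x" "m \<ge> 0"
    and S: "S \<in> sets lebesgue"
  shows "integrable (lebesgue_on \<Omega>) (\<lambda>x. indicator S x * data_fun f u x)"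
    "k * norm (\<integral>x. \<phi> x *\<^sub>R u x \<partial>lebesgue_on \<Omega>)
        \<le> m * C1 * (\<integral>x. indicator S x * data_fun f u x \<partial>lebesgue_on \<Omega>)"
proof -
  let ?M = "lebesgue_on \<Omega>"
  have fin: "finite_measure ?M" using \<Omega> by (intro finite_measure_lebesgue_on lmeasurable_open)
  have u2: "u \<in> sobolev 2 \<Omega>" using sol by (simp add: solves_def)
  note D2 = sobolev2_D[OF \<Omega>(1) u2]
  note D = sobolev1_D[OF \<Omega>(1) D2(1)]
  \<comment> \<open>\<open>T j l\<close> is the derivative in direction \<open>j\<close> of
    \<open>\<phi> * a2 j l\<close> times the \<open>l\<close>-th derivative of \<open>u\<close>, so
    it integrates to zero; its first summand is a second-order term of the operator multiplied by
    \<open>\<phi>\<close>.\<close>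
  define T where "T j l x = of_real (\<phi> x * a2 j l x) * weak_partial \<Omega> j (weak_partial \<Omega> l u) x +
      of_real (\<phi> x * da j j l x + partial_deriv j \<phi> x * a2 j l x) * weak_partial \<Omega> l u x" for j l x
  have T: "integrable ?M (T j l)" "(\<integral>x. T j l x \<partial>?M) = 0" for j l
    using product_integration_by_parts[OF \<Omega> D2(2) a2 da \<phi>, where j = j] unfolding T_def[abs_def]
        by auto
  \<comment> \<open>Adding the \<open>T j l\<close> does not change the integral. Pointwise their
    second-order parts join \<open>k\<^sup>2 u\<close> to form the leading part of the
    equation.\<close>
  define R where "R x = of_real (k\<^sup>2) * (\<phi> x *\<^sub>R u x) + (\<Sum>j\<in>UNIV. \<Sum>l\<in>UNIV. T j l x)" for x
  have \<phi>u: "integrable ?M (\<lambda>x. \<phi> x *\<^sub>R u x)"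
    using L2_integrable_mult[OF test_fun_L2[OF \<phi> open_lebesgue[OF \<Omega>(1)]] D(1)]
        by (simp add: scaleR_conv_of_real)
  have R_int: "integrable ?M R"
    unfolding R_def by (intro Bochner_Integration.integrable_add integrable_mult_right \<phi>u
        Bochner_Integration.integrable_sum T)
  have R_eq: "(\<integral>x. R x \<partial>?M) = of_real (k\<^sup>2) * (\<integral>x. \<phi> x *\<^sub>R u x \<partial>?M)"
  proof -
    have "(\<integral>x. R x \<partial>?M) = (\<integral>x. of_real (k\<^sup>2) * (\<phi> x *\<^sub>R u x) \<partial>?M)
        + (\<integral>x. (\<Sum>j\<in>UNIV. \<Sum>l\<in>UNIV. T j l x) \<partial>?M)"
      unfolding R_def by (intro Bochner_Integration.integral_add integrable_mult_right \<phi>u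
          Bochner_Integration.integrable_sum T)
    also have "(\<integral>x. (\<Sum>j\<in>UNIV. \<Sum>l\<in>UNIV. T j l x) \<partial>?M) = (\<Sum>j\<in>UNIV. \<Sum>l\<in>UNIV. \<integral>x. T j l x \<partial>?M)"
      using T(1) by (simp add: Bochner_Integration.integral_sum)
    finally show ?thesis using T(2) by (simp del: mult_scaleR_right)
  qed
  have dL: "integrable ?M (data_fun f u)"
    using integrable_Re[OF L2_integrable(1)[OF fin data_fun_L2(1)[OF sol]]] by simp
  have Sm: "S \<inter> \<Omega> \<in> sets ?M"
    using S open_lebesgue[OF \<Omega>(1)] by (auto simp: sets_restrict_space)
  have "integrable ?M (\<lambda>x. indicator (S \<inter> \<Omega>) x *\<^sub>R data_fun f u x)"
    by (rule integrable_mult_indicator[OF Sm dL])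
  moreover have "integrable ?M (\<lambda>x. indicator S x * data_fun f u x)
      \<longleftrightarrow> integrable ?M (\<lambda>x. indicator (S \<inter> \<Omega>) x *\<^sub>R data_fun f u x)"
    by (rule Bochner_Integration.integrable_cong) (auto simp: indicator_def)
  ultimately show i: "integrable ?M (\<lambda>x. indicator S x * data_fun f u x)" by simp
  have "AE x in ?M. \<forall>j\<in>UNIV. \<forall>l\<in>UNIV. \<bar>a2 j l x\<bar> \<le> B \<and> \<bar>da j j l x\<bar> \<le> B"
    by (intro AE_finite_allI finite AE_conjI B)
  moreover have "AE x in ?M. \<forall>j\<in>UNIV. norm (a1 j x) \<le> B" by (intro AE_finite_allI finite B)
  moreover have "AE x in ?M. op_A \<Omega> a2 a1 a u x - \<i> * a0 x * of_real k * u x + of_real (k\<^sup>2)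
      * u x = f x"
    using sol by (simp add: solves_def)
  ultimately have bound: "AE x in ?M. norm (R x) \<le> k * m * C1 * (indicator S x * data_fun f u x)"
    using B(5,6)
  proof eventually_elim
    case (elim x)
    let ?D = "\<lambda>l. weak_partial \<Omega> l u x"
    define s :: real where "s = indicator S x"
    define N where "N = (\<Sum>l\<in>UNIV. norm (?D l))"
    have s: "0 \<le> s" by (simp add: s_def)
    have N: "0 \<le> N" by (simp add: N_def sum_nonneg)
    have p: "\<bar>\<phi> x\<bar> \<le> m * s" "\<And>j. \<bar>partial_deriv j \<phi> x\<bar> \<le> k * m * s" using m by (auto simp: s_def)
    have ms: "0 \<le> m * s" using m(3) s by simp
    have kms: "0 \<le> k * m * s" using ms k by (simp add: mult.assoc)
    have sum: "(\<Sum>j\<in>UNIV. \<Sum>l\<in>UNIV. T j l x) = of_real (\<phi> x)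
        * (\<Sum>j\<in>UNIV. \<Sum>l\<in>UNIV. of_real (a2 j l x) * weak_partial \<Omega> j (weak_partial \<Omega> l u) x) +
       (\<Sum>j\<in>UNIV. \<Sum>l\<in>UNIV. of_real (\<phi> x * da j j l x + partial_deriv j \<phi> x * a2 j l x) * ?D l)"
      by (simp add: T_def sum.distrib sum_distrib_left mult.assoc)
    have "R x = of_real (\<phi> x) * (of_real (k\<^sup>2) * u x + (\<Sum>j\<in>UNIV. \<Sum>l\<in>UNIV. of_real (a2 j l x)
        * weak_partial \<Omega> j (weak_partial \<Omega> l u) x)) +
       (\<Sum>j\<in>UNIV. \<Sum>l\<in>UNIV. of_real (\<phi> x * da j j l x + partial_deriv j \<phi> x * a2 j l x) * ?D l)"
      unfolding R_def sum by (simp add: scaleR_conv_of_real algebra_simps)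
    \<comment> \<open>Here the equation enters and removes the second derivatives.\<close>
    also have "of_real (k\<^sup>2) * u x + (\<Sum>j\<in>UNIV. \<Sum>l\<in>UNIV. of_real (a2 j l x)
        * weak_partial \<Omega> j (weak_partial \<Omega> l u) x) =
       f x - (\<Sum>j\<in>UNIV. a1 j x * ?D j) - a x * u x + \<i> * a0 x * of_real k * u x"
      unfolding elim(3)[symmetric] op_A_def by (simp add: algebra_simps)
    finally have Rx: "R x = of_real (\<phi> x) * (f x - (\<Sum>j\<in>UNIV. a1 j x * ?D j) - a x * u x + \<i>
        * a0 x * of_real k * u x) +
       (\<Sum>j\<in>UNIV. \<Sum>l\<in>UNIV. of_real (\<phi> x * da j j l x + partial_deriv j \<phi> x * a2 j l x) * ?D l)" .
    have 1: "norm (\<Sum>j\<in>UNIV. a1 j x * ?D j) \<le> B * N"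
      unfolding N_def sum_distrib_left
      by (rule sum_norm_le) (use elim(2) in \<open>auto simp: norm_mult intro!: mult_right_mono\<close>)
    have 2: "norm (a x * u x) \<le> B * norm (u x)" "norm (\<i> * a0 x * of_real k * u x)
        \<le> k * B * norm (u x)"
      using elim(4,5) k by (auto simp: norm_mult mult.commute[of k] intro!: mult_right_mono)
    have "norm (f x - (\<Sum>j\<in>UNIV. a1 j x * ?D j) - a x * u x + \<i> * a0 x * of_real k * u x)
        \<le> norm (f x) + B * N + B * norm (u x) + k * B * norm (u x)"
      using 1 2 by (smt (verit) norm_triangle_ineq norm_triangle_ineq4)
    then have A: "norm (of_real (\<phi> x) * (f x - (\<Sum>j\<in>UNIV. a1 j x * ?D j) - a x * u x + \<i> * a0 x
        * of_real k * u x))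
        \<le> m * s * (norm (f x) + B * N + B * norm (u x) + k * B * norm (u x))"
      unfolding norm_mult norm_of_real using p(1) ms by (intro mult_mono) auto
    have "norm (of_real (\<phi> x * da j j l x + partial_deriv j \<phi> x * a2 j l x) * ?D l)
        \<le> (2 * k * m * s * B) * norm (?D l)" for j l
    proof -
      have "\<bar>\<phi> x * da j j l x\<bar> \<le> m * s * B" "\<bar>partial_deriv j \<phi> x * a2 j l x\<bar> \<le> k * m * s * B"
        unfolding abs_mult using p elim(1) ms kms B(1) by (auto intro!: mult_mono)
      \<comment> \<open>The term with \<open>\<phi>\<close> itself lacks the factor \<open>k\<close>
        that a derivative of \<open>\<phi>\<close> brings; \<open>k \<ge> 1\<close> puts both on the
        same footing.\<close>
      moreover have "m * s * B \<le> k * (m * s * B)"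
        using k ms B(1) mult_right_mono[of 1 k "m * s * B"] by simp
      ultimately have "\<bar>\<phi> x * da j j l x + partial_deriv j \<phi> x * a2 j l x\<bar> \<le> 2 * k * m * s * B"
        by (simp add: mult.assoc)
      then show ?thesis unfolding norm_mult norm_of_real by (rule mult_right_mono) simp
    qed
    then have "norm (\<Sum>j\<in>(UNIV::'n set). \<Sum>l\<in>UNIV. of_real (\<phi> x * da j j l x + partial_deriv j \<phi> x
        * a2 j l x) * ?D l) \<le> (\<Sum>j\<in>(UNIV::'n set). \<Sum>l\<in>UNIV. (2 * k * m * s * B) * norm (?D l))"
      by (intro sum_norm_le)
    also have "\<dots> = real CARD('n) * (2 * k * m * s * B * N)"
      by (simp add: N_def sum_distrib_left)
    finally have "norm (R x) \<le> m * s * (norm (f x) + B * N + B * norm (u x) + k * B * norm (u x))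
        + real CARD('n) * (2 * k * m * s * B * N)"
      unfolding Rx using A by (intro order_trans[OF norm_triangle_ineq] add_mono)
    also have "\<dots> = (m * s) * (norm (f x) + B * N + B * norm (u x) + k * B * norm (u x) + 2
        * real CARD('n) * k * B * N)"
      by (simp add: algebra_simps)
    also have "\<dots> \<le> (m * s) * (k * C1 * (norm (f x) + N + norm (u x)))"
    proof (rule mult_left_mono[OF _ ms])
      define n where "n = real CARD('n)"
      have n: "n \<ge> 0" by (simp add: n_def)
      have q: "0 \<le> k - 1" "0 \<le> norm (f x)" "0 \<le> norm (u x)" "0 \<le> k" using k by auto
      have "k * C1 * (norm (f x) + N + norm (u x)) - (norm (f x) + B * N + B * norm (u x) + k * B
          * norm (u x) + 2 * n * k * B * N)
        = (k - 1) * norm (f x) + k * B * (2 * n + 2) * norm (f x) + k * N + (k - 1) * B * N + k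
            * B * N + k * norm (u x)
          + k * B * 2 * n * norm (u x) + (k - 1) * B * norm (u x)"
        unfolding C1_def n_def[symmetric] by (simp add: algebra_simps)
      also have "\<dots> \<ge> 0"
        using q n N B(1) by (intro add_nonneg_nonneg mult_nonneg_nonneg) auto
      finally show "norm (f x) + B * N + B * norm (u x) + k * B * norm (u x) + 2 * real CARD('n)
          * k * B * N \<le> k * C1 * (norm (f x) + N + norm (u x))"
        by (simp add: n_def)
    qed
    also have "\<dots> = k * m * C1 * (indicator S x * data_fun f u x)"
      by (simp add: data_fun_def s_def N_def)
    finally show ?case .
  qed
  \<comment> \<open>The left side carries \<open>k\<^sup>2\<close>, the pointwise bound only one
    factor \<open>k\<close>; cancelling it is the gain on which the estimate rests.\<close>
  have "k * (k * norm (\<integral>x. \<phi> x *\<^sub>R u x \<partial>?M)) = norm (\<integral>x. R x \<partial>?M)"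
    unfolding R_eq using k by (simp add: norm_mult norm_power power2_eq_square)
  also have "\<dots> \<le> (\<integral>x. norm (R x) \<partial>?M)" by (rule integral_norm_bound)
  also have "\<dots> \<le> (\<integral>x. k * m * C1 * (indicator S x * data_fun f u x) \<partial>?M)"
    using R_int i bound by (intro integral_mono_AE) auto
  also have "\<dots> = k * (m * C1 * (\<integral>x. indicator S x * data_fun f u x \<partial>?M))" by simp
  finally show "k * norm (\<integral>x. \<phi> x *\<^sub>R u x \<partial>?M) \<le> m * C1 * (\<integral>x. indicator S x * data_fun f u x \<partial>?M)"
    using k by simp
qed

end

section \<open>Kernel averages\<close>

lemma nn_integral_lborel_translation:
  fixes g :: "'a::euclidean_space \<Rightarrow> ennreal"
  assumes [measurable]: "g \<in> borel_measurable borel"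
  shows "(\<integral>\<^sup>+x. g (a + x) \<partial>lborel) = (\<integral>\<^sup>+x. g x \<partial>lborel)"
proof -
  have "(\<integral>\<^sup>+x. g x \<partial>lborel) = (\<integral>\<^sup>+x. g x \<partial>distr lborel borel ((+) a))"
    by (simp add: lborel_distr_plus)
  also have "\<dots> = (\<integral>\<^sup>+x. g (a + x) \<partial>lborel)" by (rule nn_integral_distr) simp_all
  finally show ?thesis by simp
qed

lemma nn_integral_lborel_scaling:
  fixes g :: "'a::euclidean_space \<Rightarrow> ennreal"
  assumes [measurable]: "g \<in> borel_measurable borel" and k: "k > 0"
  shows "(\<integral>\<^sup>+x. ennreal (k ^ DIM('a)) * g (k *\<^sub>R x) \<partial>lborel) = (\<integral>\<^sup>+x. g x \<partial>lborel)"
proof -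
  have "(\<integral>\<^sup>+x. g x \<partial>lborel) = (\<integral>\<^sup>+x. g x \<partial>density (distr lborel borel (\<lambda>x. 0
      + k *\<^sub>R x)) (\<lambda>_. \<bar>k\<bar> ^ DIM('a)))"
    using k by (subst lborel_affine[of k 0]) auto
  also have "\<dots> = (\<integral>\<^sup>+x. ennreal (k ^ DIM('a)) * g x \<partial>distr lborel borel (\<lambda>x. k *\<^sub>R x))"
    using k by (subst nn_integral_density) auto
  also have "\<dots> = (\<integral>\<^sup>+x. ennreal (k ^ DIM('a)) * g (k *\<^sub>R x) \<partial>lborel)"
    by (subst nn_integral_distr) auto
  finally show ?thesis by simp
qed

text \<open>The weight is split as \<open>sqrt \<rho> * sqrt \<rho>\<close> between the two
  factors.\<close>

lemma nn_integral_weighted_Cauchy_Schwarz: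
  fixes \<rho> g :: "'a \<Rightarrow> real"
  assumes [measurable]: "\<rho> \<in> borel_measurable M" "g \<in> borel_measurable M"
    and nn: "\<And>x. 0 \<le> \<rho> x" "\<And>x. 0 \<le> g x"
  shows "(\<integral>\<^sup>+x. ennreal (\<rho> x * g x) \<partial>M)\<^sup>2 \<le> (\<integral>\<^sup>+x. ennreal (\<rho> x) \<partial>M) * (\<integral>\<^sup>+x. ennreal (\<rho> x
      * (g x)\<^sup>2) \<partial>M)"
proof -
  have "(\<integral>\<^sup>+x. ennreal (\<rho> x * g x) \<partial>M)\<^sup>2 = (\<integral>\<^sup>+x. ennreal (sqrt (\<rho> x)) * ennreal (sqrt (\<rho> x)
      * g x) \<partial>M)\<^sup>2"
    using nn by (simp add: mult.assoc flip: ennreal_mult mult.assoc)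
  also have "\<dots> \<le> (\<integral>\<^sup>+x. (ennreal (sqrt (\<rho> x)))\<^sup>2 \<partial>M) * (\<integral>\<^sup>+x. (ennreal (sqrt (\<rho> x) * g x))\<^sup>2 \<partial>M)"
    by (rule Cauchy_Schwarz_nn_integral) simp_all
  also have "\<dots> = (\<integral>\<^sup>+x. ennreal (\<rho> x) \<partial>M) * (\<integral>\<^sup>+x. ennreal (\<rho> x * (g x)\<^sup>2) \<partial>M)"
    using nn by (simp add: ennreal_power power_mult_distrib)
  finally show ?thesis .
qed

text \<open>Tonelli's theorem reduces the average to its slices. The bound is asked for slices with
  \<open>\<rho> t \<noteq> 0\<close>, which matters because other shifts \<open>t\<close> may leave
  the domain.\<close>

lemma nn_integral_kernel_average:
  fixes \<rho> :: "'a::euclidean_space \<Rightarrow> ennreal"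
  assumes [measurable]: "\<rho> \<in> borel_measurable borel"
      "(\<lambda>(x, t). G x t) \<in> borel_measurable (lborel \<Otimes>\<^sub>M lborel)"
    and A: "\<And>t. \<rho> t \<noteq> 0 \<Longrightarrow> (\<integral>\<^sup>+x. G x t \<partial>lborel) \<le> A"
  shows "(\<integral>\<^sup>+x. (\<integral>\<^sup>+t. \<rho> t * G x t \<partial>lborel) \<partial>lborel) \<le> (\<integral>\<^sup>+t. \<rho> t \<partial>lborel) * A"
proof -
  have "(\<integral>\<^sup>+x. (\<integral>\<^sup>+t. \<rho> t * G x t \<partial>lborel) \<partial>lborel) = (\<integral>\<^sup>+t. (\<integral>\<^sup>+x. \<rho> t * G x t \<partial>lborel) \<partial>lborel)"
    by (rule lborel_pair.Fubini'[symmetric]) measurable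
  also have "\<dots> = (\<integral>\<^sup>+t. \<rho> t * (\<integral>\<^sup>+x. G x t \<partial>lborel) \<partial>lborel)"
    by (intro nn_integral_cong nn_integral_cmult) measurable
  also have "\<dots> \<le> (\<integral>\<^sup>+t. \<rho> t * A \<partial>lborel)"
  proof (rule nn_integral_mono)
    fix t show "\<rho> t * (\<integral>\<^sup>+x. G x t \<partial>lborel) \<le> \<rho> t * A"
      using A[of t] by (cases "\<rho> t = 0") (auto intro: mult_left_mono)
  qed
  also have "\<dots> = (\<integral>\<^sup>+t. \<rho> t \<partial>lborel) * A" by (rule nn_integral_multc) simp
  finally show ?thesis .
qed

text \<open>Jensen's inequality for the probability density \<open>\<kappa>\<close>: up to sign the
  deviation is the average of \<open>u (x + t) - u x\<close>, and Cauchy-Schwarz against total mass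
  one brings the square inside.\<close>

lemma kernel_average_deviation:
  fixes \<kappa> :: "'a::euclidean_space \<Rightarrow> real" and u :: "'a \<Rightarrow> complex"
  assumes [measurable]: "\<kappa> \<in> borel_measurable borel" "u \<in> borel_measurable borel"
    and nn: "\<And>t. 0 \<le> \<kappa> t" and one: "(\<integral>\<^sup>+t. ennreal (\<kappa> t) \<partial>lborel) = 1"
    and i: "integrable lborel (\<lambda>t. \<kappa> t *\<^sub>R u (x + t))"
  shows "ennreal ((norm (u x - (\<integral>t. \<kappa> t *\<^sub>R u (x + t) \<partial>lborel)))\<^sup>2)
    \<le> (\<integral>\<^sup>+t. ennreal (\<kappa> t) * ennreal ((norm (u (x + t) - u x))\<^sup>2) \<partial>lborel)"
proof -
  have \<kappa>i: "integrable lborel \<kappa>"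
    by (rule integrableI_nonneg) (use nn one in auto)
  have \<kappa>1: "(\<integral>t. \<kappa> t \<partial>lborel) = 1"
    using nn_integral_eq_integral[OF \<kappa>i] nn one by simp
  have iu: "integrable lborel (\<lambda>t. \<kappa> t *\<^sub>R u x)" using \<kappa>i by (rule integrable_scaleR_left)
  have ux: "(\<integral>t. \<kappa> t *\<^sub>R u x \<partial>lborel) = u x" using \<kappa>i \<kappa>1
      by (simp del: integral_scaleR_left add: integral_scaleR_left[OF \<kappa>i])
  have id: "integrable lborel (\<lambda>t. \<kappa> t *\<^sub>R (u (x + t) - u x))"
    using Bochner_Integration.integrable_diff[OF i iu] by (simp add: scaleR_diff_right)
  have "(\<integral>t. \<kappa> t *\<^sub>R (u (x + t) - u x) \<partial>lborel) = (\<integral>t. \<kappa> t *\<^sub>R u (x + t) \<partial>lborel) - u x"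
    using Bochner_Integration.integral_diff[OF i iu] unfolding ux by (simp add: scaleR_diff_right)
  then have "ennreal (norm (u x - (\<integral>t. \<kappa> t *\<^sub>R u (x + t) \<partial>lborel)))
      = ennreal (norm (\<integral>t. \<kappa> t *\<^sub>R (u (x + t) - u x) \<partial>lborel))"
    by (simp add: norm_minus_commute)
  also have "\<dots> \<le> (\<integral>\<^sup>+t. ennreal (norm (\<kappa> t *\<^sub>R (u (x + t) - u x))) \<partial>lborel)"
    by (rule integral_norm_bound_ennreal[OF id])
  also have "\<dots> = (\<integral>\<^sup>+t. ennreal (\<kappa> t * norm (u (x + t) - u x)) \<partial>lborel)" using nn by simp
  finally have "(ennreal (norm (u x - (\<integral>t. \<kappa> t *\<^sub>R u (x + t) \<partial>lborel))))\<^sup>2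
      \<le> (\<integral>\<^sup>+t. ennreal (\<kappa> t * norm (u (x + t) - u x)) \<partial>lborel)\<^sup>2"
    by (rule power_mono) simp
  also have "\<dots> \<le> (\<integral>\<^sup>+t. ennreal (\<kappa> t) \<partial>lborel) * (\<integral>\<^sup>+t. ennreal (\<kappa> t * (norm (u (x + t)
      - u x))\<^sup>2) \<partial>lborel)"
    by (rule nn_integral_weighted_Cauchy_Schwarz) (use nn in simp_all)
  also have "\<dots> = (\<integral>\<^sup>+t. ennreal (\<kappa> t) * ennreal ((norm (u (x + t) - u x))\<^sup>2) \<partial>lborel)"
    using nn by (simp add: one ennreal_mult)
  finally show ?thesis by (simp add: ennreal_power)
qed

lemma bump_kernel:
  fixes c :: "real^'n"
  assumes \<delta>: "\<delta> > 0"
  obtains \<eta> where "test_fun (ball c \<delta>) \<eta>" "\<And>x. 0 \<le> \<eta> x" "(\<integral>\<^sup>+x. ennreal (\<eta> x) \<partial>lborel) = 1"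
proof -
  \<comment> \<open>The Euclidean norm is at most the sum of the absolute values of the coordinates,
    so a cube of half-width \<open>e\<close> has points at distance at most \<open>n e\<close> from
    its centre, with \<open>n\<close> the dimension; the denominator \<open>n + 1\<close> makes this
    less than \<open>\<delta>\<close>.\<close>
  define e where "e = \<delta> / (real CARD('n) + 1)"
  have e: "e > 0" "real CARD('n) * e < \<delta>" using \<delta> by (auto simp: e_def divide_simps)
  define p where "p = (\<chi> i. c $ i - e)" define q where "q = (\<chi> i. c $ i + e)"
  have sub: "cbox p q \<subseteq> ball c \<delta>"
  proof
    fix x assume x: "x \<in> cbox p q"
    have "norm (x - c) \<le> (\<Sum>i\<in>UNIV. \<bar>(x - c) $ i\<bar>)" by (rule norm_le_l1_cart)
    also have "\<dots> \<le> (\<Sum>i\<in>(UNIV::'n set). e)"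
    proof (rule sum_mono)
      fix i show "\<bar>(x - c) $ i\<bar> \<le> e"
        using x by (auto simp: mem_box_cart p_def q_def abs_le_iff dest!: spec[of _ i])
    qed
    also have "\<dots> < \<delta>" using e by simp
    finally show "x \<in> ball c \<delta>" by (simp add: dist_norm norm_minus_commute)
  qed
  have cbx: "c \<in> box p q" using e by (simp add: mem_box_cart p_def q_def)
  obtain \<psi> :: "nat \<Rightarrow> real^'n \<Rightarrow> real" where \<psi>: "\<And>n. smooth_fun (\<psi> n)" "\<And>n x. x \<notin> cbox p q
      \<Longrightarrow> \<psi> n x = 0"
    "\<And>n x. 0 \<le> \<psi> n x" "\<And>n x. \<psi> n x \<le> 1" "\<And>x. x \<in> box p q \<Longrightarrow> 0 < \<psi> 1 x"
    using box_bumps[of p q] by metis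
  define \<theta> where "\<theta> = \<psi> 1"
  have t: "test_fun (ball c \<delta>) \<theta>"
    unfolding test_fun_def \<theta>_def using \<psi>(1,2) sub by (intro conjI exI[of _ "cbox p q"]) auto
  have [measurable]: "\<theta> \<in> borel_measurable borel"
    by (rule borel_measurable_continuous_onI[OF test_fun_continuous[OF t]])
  define I where "I = (\<integral>\<^sup>+x. ennreal (\<theta> x) \<partial>lborel)"
  have "I \<le> (\<integral>\<^sup>+x. indicator (cbox p q) x \<partial>lborel)"
    unfolding I_def using \<psi>(2,4) by (intro nn_integral_mono) (auto simp: \<theta>_def indicator_def)
  also have "\<dots> < \<infinity>" by (simp add: emeasure_lborel_cbox_eq)
  finally have fin: "I < \<infinity>" .
  \<comment> \<open>The bump is positive on a non-empty open box, so it can be normalised.\<close>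
  have pos: "I \<noteq> 0"
  proof
    assume "I = 0"
    then have "AE x in lborel. ennreal (\<theta> x) = 0"
      using nn_integral_0_iff_AE[of "\<lambda>x. ennreal (\<theta> x)" lborel] by (simp add: I_def)
    then have "AE x in lborel. x \<notin> box p q"
    proof eventually_elim
      case (elim x)
      then show ?case using \<psi>(5)[of x] by (auto simp: \<theta>_def ennreal_eq_0_iff)
    qed
    then have "box p q \<in> null_sets lborel" by (simp add: AE_iff_null_sets)
    then have "negligible (box p q)" by (simp add: negligible_iff_null_sets null_sets_completionI)
    then show False using cbx by (auto simp: negligible_interval)
  qed
  define J where "J = enn2real I"
  have J: "I = ennreal J" "J > 0"
    using fin pos by (auto simp: J_def enn2real_positive_iff less_top zero_less_iff_neq_zero)
  show ?thesis
  proof (rule that[of "\<lambda>x. (1 / J) * \<theta> x"])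
    show "test_fun (ball c \<delta>) (\<lambda>x. (1 / J) * \<theta> x)" by (rule test_fun_cmult[OF t])
    show "0 \<le> (1 / J) * \<theta> x" for x using J \<psi>(3) by (simp add: \<theta>_def)
    have "(\<integral>\<^sup>+x. ennreal ((1 / J) * \<theta> x) \<partial>lborel) = ennreal (1 / J) * I"
      unfolding I_def using J by (subst nn_integral_cmult[symmetric]) (auto simp: ennreal_mult'
          simp del: times_divide_eq_left mult_1)
    also have "\<dots> = 1" using J by (simp add: J(1) flip: ennreal_mult)
    finally show "(\<integral>\<^sup>+x. ennreal ((1 / J) * \<theta> x) \<partial>lborel) = 1" .
  qed
qed

text \<open>Tonelli's theorem for \<open>(x, t) \<mapsto> u (x + t)\<close> on the product of Borel
  spaces asks for a Borel function; Sobolev functions are only Lebesgue measurable.\<close>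

lemma borel_representative:
  fixes w :: "'a::euclidean_space \<Rightarrow> complex"
  assumes "w \<in> borel_measurable lebesgue"
  obtains w' where "w' \<in> borel_measurable borel" "AE x in lborel. w x = w' x"
proof -
  have "(\<lambda>x. Re (w x)) \<in> borel_measurable lebesgue" "(\<lambda>x. Im (w x)) \<in> borel_measurable lebesgue"
    using assms by auto
  from this[THEN completion_ex_borel_measurable_real] obtain r i where
    "r \<in> borel_measurable lborel" "AE x in lborel. Re (w x) = r x"
    "i \<in> borel_measurable lborel" "AE x in lborel. Im (w x) = i x" by blast
  then have "(\<lambda>x. complex_of_real (r x) + \<i> * complex_of_real (i x)) \<in> borel_measurable borel"
    "AE x in lborel. w x = complex_of_real (r x) + \<i> * complex_of_real (i x)"
    by (auto simp: complex_eq_iff elim!: AE_mp)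
  then show ?thesis by (rule that)
qed

section \<open>The L2 estimate\<close>

lemma L2_norm_nn_representative:
  assumes "w \<in> L2 (lebesgue_on S)" "S \<in> sets lebesgue" "AE x in lborel. indicator S x *\<^sub>R w x
      = wb x"
  shows "(\<integral>\<^sup>+x. ennreal ((norm (wb x))\<^sup>2) \<partial>lborel) \<le> ennreal ((L2_norm (lebesgue_on S) w)\<^sup>2)"
proof -
  have "(\<integral>\<^sup>+x. ennreal ((norm (wb x))\<^sup>2) \<partial>lborel)
      = (\<integral>\<^sup>+x. ennreal ((norm (w x))\<^sup>2) * indicator S x \<partial>lborel)"
    by (rule nn_integral_cong_AE) (use assms(3) in \<open>eventually_elim, auto simp: indicator_def\<close>)
  also have "\<dots> = (\<integral>\<^sup>+x. ennreal ((norm (w x))\<^sup>2) * indicator S x \<partial>lebesgue)"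
    by (rule nn_integral_completion[symmetric])
  also have "\<dots> = (\<integral>\<^sup>+x. ennreal ((norm (w x))\<^sup>2) \<partial>lebesgue_on S)"
    by (rule nn_integral_restrict_space[symmetric]) (use assms(2) in simp)
  also have "\<dots> \<le> ennreal ((L2_norm (lebesgue_on S) w)\<^sup>2)"
    using L2_norm_le_iff_nn[OF L2_measurable[OF assms(1)] L2_norm_nonneg] assms(1) by blast
  finally show ?thesis .
qed

context elliptic
begin

text \<open>This is \<open>translation_estimate\<close> for a Borel representative. The derivative
  along \<open>z\<close> is a sum over the coordinate directions, each with coefficient at most
  \<open>D\<close> and norm at most \<open>norm1 \<Omega> u\<close>.\<close>

lemma translation_bound_nn:
  assumes U: "open U" "bounded U" and u: "u \<in> sobolev 1 \<Omega>"
    and path: "\<And>x s. x \<in> U \<Longrightarrow> 0 \<le> s \<Longrightarrow> s \<le> h \<Longrightarrow> x + s *\<^sub>R z \<in> \<Omega>" and h: "0 \<le> h"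
    and ub: "ub \<in> borel_measurable borel" "AE x in lborel. indicator \<Omega> x *\<^sub>R u x = ub x"
    and z: "norm z \<le> D" "0 \<le> D"
  shows "(\<integral>\<^sup>+x. indicator U x * ennreal ((norm (ub (x + h *\<^sub>R z) - ub x))\<^sup>2) \<partial>lborel)
      \<le> ennreal ((h * (real CARD('n) * D * norm1 \<Omega> u))\<^sup>2)"
proof -
  note Du = sobolev1_D[OF \<Omega>(1) u]
  interpret td: translation_domain \<Omega> U h z u "\<lambda>j. weak_partial \<Omega> j u"
    by unfold_locales (use \<Omega> U Du path in auto)
  let ?W = "L2_norm (lebesgue_on \<Omega>) td.W"
  have "?W \<le> (\<Sum>j\<in>UNIV. L2_norm (lebesgue_on \<Omega>) (\<lambda>y. of_real (z $ j) * weak_partial \<Omega> j u y))"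
    unfolding td.W_def[abs_def] by (rule L2_norm_sum) (intro L2_scale Du)
  also have "\<dots> = (\<Sum>j\<in>UNIV. \<bar>z $ j\<bar> * L2_norm (lebesgue_on \<Omega>) (weak_partial \<Omega> j u))"
    by (simp add: L2_norm_scale[OF Du(3)])
  also have "\<dots> \<le> (\<Sum>j\<in>(UNIV::'n set). D * norm1 \<Omega> u)"
  proof (intro sum_mono mult_mono norm1_ge)
    show "\<bar>z $ j\<bar> \<le> D" for j using component_le_norm_cart[of z j] z by linarith
  qed (use z in auto)
  finally have W: "?W \<le> real CARD('n) * D * norm1 \<Omega> u" by simp
  define g where "g x = u (x + h *\<^sub>R z) - u x" for x
  have gL: "g \<in> L2 (lebesgue_on U)" unfolding g_def by (rule td.difference_L2[OF h order_refl])
  have "L2_norm (lebesgue_on U) g \<le> h * ?W"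
    unfolding g_def by (rule td.translation_estimate[OF h order_refl])
  also have "\<dots> \<le> h * (real CARD('n) * D * norm1 \<Omega> u)" using W h by (rule mult_left_mono)
  finally have g: "L2_norm (lebesgue_on U) g \<le> h * (real CARD('n) * D * norm1 \<Omega> u)" .
  have UL: "U \<inter> space lebesgue \<in> sets lebesgue" using open_lebesgue[OF U(1)] by simp
  have "(\<integral>\<^sup>+x. ennreal ((norm (g x))\<^sup>2) \<partial>lebesgue_on U)
      \<le> ennreal ((h * (real CARD('n) * D * norm1 \<Omega> u))\<^sup>2)"
    using L2_norm_le_iff_nn[OF L2_measurable[OF gL], of "h * (real CARD('n) * D * norm1 \<Omega> u)"] gL g
      order_trans[OF L2_norm_nonneg g] by blast
  also have "(\<integral>\<^sup>+x. ennreal ((norm (g x))\<^sup>2) \<partial>lebesgue_on U)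
      = (\<integral>\<^sup>+x. ennreal ((norm (g x))\<^sup>2) * indicator U x \<partial>lebesgue)"
    by (rule nn_integral_restrict_space[OF UL])
  also have "\<dots> = (\<integral>\<^sup>+x. ennreal ((norm (g x))\<^sup>2) * indicator U x \<partial>lborel)"
    by (rule nn_integral_completion)
  also have "\<dots> = (\<integral>\<^sup>+x. indicator U x * ennreal ((norm (ub (x + h *\<^sub>R z) - ub x))\<^sup>2) \<partial>lborel)"
  proof (rule nn_integral_cong_AE)
    \<comment> \<open>The representative must also be correct at the shifted points: translation
      invariance carries the exceptional null set along.\<close>
    have "AE x in distr lborel borel ((+) (h *\<^sub>R z)). indicator \<Omega> x *\<^sub>R u x = ub x"
      by (subst lborel_distr_plus) (rule ub(2))
    then have "AE x in lborel. indicator \<Omega> (h *\<^sub>R z + x) *\<^sub>R u (h *\<^sub>R z + x) = ub (h *\<^sub>R z + x)"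
      by (rule AE_distrD[rotated]) simp
    with ub(2) show "AE x in lborel. ennreal ((norm (g x))\<^sup>2) * indicator U x =
        indicator U x * ennreal ((norm (ub (x + h *\<^sub>R z) - ub x))\<^sup>2)"
    proof eventually_elim
      case (elim x)
      show ?case
      proof (cases "x \<in> U")
        case True
        then have "x \<in> \<Omega>" "x + h *\<^sub>R z \<in> \<Omega>" using path[OF True, of 0] path[OF True, of h] h by auto
        then show ?thesis using elim True by (simp add: g_def add.commute)
      qed simp
    qed
  qed
  finally show ?thesis .
qed

text \<open>\<open>u\<close> is compared with its average \<open>I\<close> over the shifted ball \<open>x + ball (c / k) (\<delta> / k)\<close>: the
  deviation is controlled by translations, the average by the equation tested with the averaging
  kernel.\<close>

theorem local_estimate:
  assumes U: "open U" "bounded U" and \<delta>: "\<delta> > 0" and h0: "h0 > 0"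
    and path: "\<And>x z t. x \<in> U \<Longrightarrow> z \<in> ball c \<delta> \<Longrightarrow> 0 \<le> t \<Longrightarrow> t \<le> h0 \<Longrightarrow> x + t *\<^sub>R z \<in> \<Omega>"
  shows "\<exists>K\<ge>0. \<forall>k f u. k \<ge> 1 \<and> 1 / k \<le> h0 \<and> solves k f u \<longrightarrow>
    k * L2_norm (lebesgue_on U) u \<le> K * (norm0 \<Omega> f + norm1 \<Omega> u)"
proof -
  define n where "n = CARD('n)"
  obtain \<eta> :: "real^'n \<Rightarrow> real" where \<eta>: "test_fun (ball c \<delta>) \<eta>" "\<And>x. 0
      \<le> \<eta> x" "(\<integral>\<^sup>+x. ennreal (\<eta> x) \<partial>lborel) = 1"
    using bump_kernel[OF \<delta>] by blast
  have [measurable]: "\<eta> \<in> borel_measurable borel"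
    by (rule borel_measurable_continuous_onI[OF test_fun_continuous[OF \<eta>(1)]])
  have UO: "U \<subseteq> \<Omega>" using path[of _ c 0] \<delta> h0 by auto
  \<comment> \<open>One bound for the kernel and all its first derivatives, so that both are
    dominated by the same multiple of the indicator of the ball; the sum over directions stands in
    for a maximum.\<close>
  obtain M where M: "M \<ge> 0" "\<And>x. \<bar>\<eta> x\<bar> \<le> M" "\<And>j x. \<bar>partial_deriv j \<eta> x\<bar> \<le> M"
  proof -
    have "\<forall>j. \<exists>M. M \<ge> 0 \<and> (\<forall>x. \<bar>partial_deriv j \<eta> x\<bar> \<le> M)"
      using test_fun_bounded[OF test_fun_partial_deriv[OF \<eta>(1)]] by metis
    then obtain N where N: "\<And>j. N j \<ge> 0" "\<And>j x. \<bar>partial_deriv j \<eta> x\<bar> \<le> N j" by metis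
    obtain M0 where M0: "M0 \<ge> 0" "\<And>x. \<bar>\<eta> x\<bar> \<le> M0" using test_fun_bounded[OF \<eta>(1)] by blast
    have "N j \<le> M0 + (\<Sum>j\<in>UNIV. N j)" for j
      using member_le_sum[of j UNIV N] N(1) M0(1) by fastforce
    moreover have "0 \<le> (\<Sum>j\<in>UNIV. N j)" by (simp add: N(1) sum_nonneg)
    ultimately show ?thesis
      using N(2) M0 by (intro that[of "M0 + (\<Sum>j\<in>UNIV. N j)"]) (auto intro: order_trans
          add_increasing2)
  qed
  define \<rho>1 where "\<rho>1 t = (indicator (ball c \<delta>) t :: real)" for t
  define R where "R = measure lborel (ball c \<delta>)"
  have \<rho>1R: "(\<integral>\<^sup>+t. ennreal (\<rho>1 t) \<partial>lborel) = ennreal R"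
    unfolding \<rho>1_def R_def using emeasure_lborel_ball_finite[of c \<delta>]
    by (simp add: ennreal_indicator emeasure_eq_ennreal_measure top.not_eq_extremum)
  define D where "D = norm c + \<delta>"
  have D: "0 \<le> D" "\<And>z. z \<in> ball c \<delta> \<Longrightarrow> norm z \<le> D"
  proof -
    show "0 \<le> D" using \<delta> by (simp add: D_def)
    show "norm z \<le> D" if "z \<in> ball c \<delta>" for z
      using that norm_triangle_ineq[of c "z - c"] by (simp add: D_def dist_norm norm_minus_commute)
  qed
  have C1: "C1 \<ge> 0" using B(1) by (simp add: C1_def)
  define Q where "Q = M * C1"
  have Q: "Q \<ge> 0" using M C1 by (simp add: Q_def)
  \<comment> \<open>With \<open>X\<close> for the sum of the norms on the right, the squared norm of
    \<open>u\<close> on \<open>U\<close> is at most twice the contribution of the deviation,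
    \<open>(n D X / k)\<^sup>2\<close>, plus twice that of the average,
    \<open>(Q R (n + 1) X / k)\<^sup>2\<close>. Of the two factors \<open>R\<close> under the
    square, one comes from Cauchy-Schwarz and one from averaging over \<open>\<rho>\<close>.\<close>
  define K where "K = sqrt (2 * (real n * D)\<^sup>2 + 2 * Q\<^sup>2 * R\<^sup>2 * (real n + 1)\<^sup>2)"
  have main: "k * L2_norm (lebesgue_on U) u \<le> K * (norm0 \<Omega> f + norm1 \<Omega> u)"
    if k: "k \<ge> 1" "1 / k \<le> h0" and sol: "solves k f u" for k f u
  proof -
    define X where "X = norm0 \<Omega> f + norm1 \<Omega> u"
    have n1: "0 \<le> norm1 \<Omega> u" using order_trans[OF L2_norm_nonneg norm1_ge(1)] .
    have X: "norm1 \<Omega> u \<le> X" "0 \<le> X" using n1 by (auto simp: X_def)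
    have k0: "k > 0" using k by simp
    have u2: "u \<in> sobolev 2 \<Omega>" using sol by (simp add: solves_def)
    note u1 = sobolev2_D(1)[OF \<Omega>(1) u2]
    note Du = sobolev1_D[OF \<Omega>(1) u1]
    \<comment> \<open>\<open>kn\<close> is the Jacobian of the scaling by \<open>k\<close>:
      \<open>\<kappa>\<close> keeps total mass \<open>1\<close>, and \<open>\<rho>\<close>, the flat
      kernel on the same ball, keeps mass \<open>R\<close>.\<close>
    define kn where "kn = k ^ n"
    have kn: "kn > 0" using k0 by (simp add: kn_def)
    define \<kappa> where "\<kappa> t = kn * \<eta> (k *\<^sub>R t)" for t
    define \<rho> where "\<rho> t = kn * \<rho>1 (k *\<^sub>R t)" for t
    have [measurable]: "\<rho>1 \<in> borel_measurable borel"
      unfolding \<rho>1_def[abs_def] by (intro borel_measurable_indicator) simp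
    have [measurable]: "\<kappa> \<in> borel_measurable borel" "\<rho> \<in> borel_measurable borel"
      unfolding \<kappa>_def[abs_def] \<rho>_def[abs_def] by measurable
    have \<rho>10: "0 \<le> \<rho>1 t" for t by (simp add: \<rho>1_def)
    have \<kappa>0: "0 \<le> \<kappa> t" and \<rho>0: "0 \<le> \<rho> t" for t using \<eta>(2) kn by (auto simp: \<kappa>_def \<rho>_def \<rho>1_def)
    have \<kappa>1: "(\<integral>\<^sup>+t. ennreal (\<kappa> t) \<partial>lborel) = 1" and \<rho>R: "(\<integral>\<^sup>+t. ennreal (\<rho> t) \<partial>lborel) = ennreal R"
      using nn_integral_lborel_scaling[of "\<lambda>t. ennreal (\<eta> t)" k] nn_integral_lborel_scaling[of
          "\<lambda>t. ennreal (\<rho>1 t)" k] \<eta>(2,3) \<rho>1R k0 kn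
      by (simp_all add: \<kappa>_def \<rho>_def \<rho>10 ennreal_mult kn_def n_def)
    obtain ub where ub: "ub \<in> borel_measurable borel" "AE x in lborel. indicator \<Omega> x *\<^sub>R u x = ub x"
      using borel_representative[OF L2_measurable] Du(1) L2_on_iff[OF open_lebesgue[OF \<Omega>(1)]]
          by blast
    note dL = data_fun_L2[OF sol]
    obtain hb where hb: "hb \<in> borel_measurable borel"
        "AE x in lborel. indicator \<Omega> x *\<^sub>R complex_of_real (data_fun f u x) = hb x"
      using borel_representative[OF L2_measurable] dL(1) L2_on_iff[OF open_lebesgue[OF \<Omega>(1)]]
          by blast
    note [measurable] = ub(1) hb(1)
    have d0: "data_fun f u x \<ge> 0" for x by (simp add: data_fun_def sum_nonneg)
    have pt: "ennreal ((norm (ub x))\<^sup>2) \<le>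
        2 * (\<integral>\<^sup>+t. ennreal (\<kappa> t) * ennreal ((norm (ub (x + t) - ub x))\<^sup>2) \<partial>lborel) +
        2 * ennreal ((Q / k)\<^sup>2) * (ennreal R * (\<integral>\<^sup>+t. ennreal (\<rho> t) * ennreal ((norm (hb (x
            + t)))\<^sup>2) \<partial>lborel))"
      if x: "x \<in> U" for x
    proof -
      define \<phi> where "\<phi> y = \<kappa> (y - x)" for y
      define S where "S = {y. k *\<^sub>R (y - x) \<in> ball c \<delta>}"
      have Sb: "S \<in> sets borel"
      proof -
        have "open S" unfolding S_def mem_ball by (intro open_Collect_less continuous_intros)
        then show ?thesis by simp
      qed
      then have SL: "S \<in> sets lebesgue" by (simp add: sets_completionI_sets)
      \<comment> \<open>The cone condition with \<open>t = 1 / k \<le> h0\<close> puts the support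
        of the kernel at \<open>x\<close> inside \<open>\<Omega>\<close>, however close
        \<open>x\<close> is to the boundary.\<close>
      have t0: "test_fun \<Omega> (\<lambda>y. \<eta> (k *\<^sub>R (y - x)))"
        using test_fun_affine[OF \<eta>(1), of "1 / k" x \<Omega>] path[OF x] k k0 by simp
      have \<phi>eq: "\<phi> = (\<lambda>y. kn * \<eta> (k *\<^sub>R (y - x)))" by (simp add: \<phi>_def \<kappa>_def fun_eq_iff)
      have \<phi>: "test_fun \<Omega> \<phi>" unfolding \<phi>eq by (rule test_fun_cmult[OF t0])
      have pd: "partial_deriv j \<phi> y = kn * (k * partial_deriv j \<eta> (k *\<^sub>R (y - x)))" for j y
      proof -
        have "partial_deriv j (\<lambda>y. \<eta> (k *\<^sub>R y + - k *\<^sub>R x)) y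
            = k * partial_deriv j \<eta> (k *\<^sub>R y + - k *\<^sub>R x)"
          by (rule partial_deriv_affine(1)[OF test_fun_differentiable[OF \<eta>(1)]])
        then have "partial_deriv j (\<lambda>y. \<eta> (k *\<^sub>R (y - x))) y
            = k * partial_deriv j \<eta> (k *\<^sub>R (y - x))"
          by (simp add: scaleR_diff_right)
        moreover have "partial_deriv j (\<lambda>y. kn) y = 0"
            by (simp add: partial_deriv_eq[OF has_derivative_const])
        ultimately show ?thesis
          unfolding \<phi>eq using partial_deriv_mult[of "\<lambda>y. kn" y "\<lambda>y. \<eta> (k *\<^sub>R (y
              - x))" j] test_fun_differentiable[OF t0]
          by simp
      qed
      have out_eta: "\<eta> y = 0" "partial_deriv j \<eta> y = 0" if "y \<notin> ball c \<delta>" for y j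
        using \<eta>(1) test_fun_partial_deriv[OF \<eta>(1), of j] that by (auto simp: test_fun_def)
      have b1: "\<bar>\<phi> y\<bar> \<le> kn * M * indicator S y" for y
        using M(2)[of "k *\<^sub>R (y - x)"] out_eta(1)[of "k *\<^sub>R (y - x)"] kn
        by (cases "y \<in> S") (auto simp: \<phi>eq S_def abs_mult simp del: mem_ball)
      have b2: "\<bar>partial_deriv j \<phi> y\<bar> \<le> k * (kn * M) * indicator S y" for j y
        using M(3)[of j "k *\<^sub>R (y - x)"] out_eta(2)[of "k *\<^sub>R (y - x)" j] kn k0
        by (cases "y \<in> S") (auto simp: pd S_def abs_mult simp del: mem_ball)
      note wf = weak_form_bound[OF sol k(1) \<phi> b1 b2 mult_nonneg_nonneg[OF less_imp_le[OF kn]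
          M(1)] SL]
      define I where "I = (\<integral>t. \<kappa> t *\<^sub>R ub (x + t) \<partial>lborel)"
      have ai: "integrable lborel (\<lambda>t. \<kappa> t *\<^sub>R ub (x + t)) \<and> I = (\<integral>y. \<phi> y *\<^sub>R u y \<partial>lebesgue_on \<Omega>)"
      proof -
        have i1: "integrable lebesgue (\<lambda>y. \<phi> y *\<^sub>R u y)"
          using test_integrable[OF L2_loc_integrable[OF \<Omega>(1) Du(1)] \<phi>] .
        have out: "\<phi> y = 0" if "y \<notin> \<Omega>" for y using \<phi> that by (auto simp: test_fun_def)
        have ae: "AE y in lborel. \<phi> y *\<^sub>R u y = \<phi> y *\<^sub>R ub y"
          using ub(2)
        proof eventually_elim
          case (elim y)
          then show ?case using out[of y] by (cases "y \<in> \<Omega>") simp_all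
        qed
        have [measurable]: "\<phi> \<in> borel_measurable borel" unfolding \<phi>_def[abs_def] by measurable
        have m2: "(\<lambda>y. \<phi> y *\<^sub>R ub y) \<in> borel_measurable lebesgue"
            by (rule measurable_completion) simp
        have i2: "integrable lebesgue (\<lambda>y. \<phi> y *\<^sub>R ub y)"
          by (rule integrable_cong_AE_imp[OF i1 m2]) (use AE_completion[OF ae] in
              eventually_elim, simp)
        have i3: "integrable lborel (\<lambda>y. \<phi> y *\<^sub>R ub y)"
          using i2 by (subst (asm) integrable_completion) simp_all
        have "(\<integral>y. \<phi> y *\<^sub>R u y \<partial>lebesgue_on \<Omega>) = (\<integral>y. \<phi> y *\<^sub>R u y \<partial>lebesgue)"
            by (rule test_integral[OF \<Omega>(1) \<phi>])
        also have "\<dots> = (\<integral>y. \<phi> y *\<^sub>R ub y \<partial>lebesgue)"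
          using i1 i2 ae by (intro integral_cong_AE) (auto intro: AE_completion)
        also have "\<dots> = (\<integral>y. \<phi> y *\<^sub>R ub y \<partial>lborel)" by (rule integral_completion) simp
        finally have e1: "(\<integral>y. \<phi> y *\<^sub>R u y \<partial>lebesgue_on \<Omega>) = (\<integral>y. \<phi> y *\<^sub>R ub y \<partial>lborel)" .
        have sh: "(\<lambda>t. \<phi> (x + t) *\<^sub>R ub (x + t)) = (\<lambda>t. \<kappa> t *\<^sub>R ub (x + t))" by (simp add: \<phi>_def)
        have "integrable (distr lborel borel ((+) x)) (\<lambda>y. \<phi> y *\<^sub>R ub y)" using i3
            by (simp add: lborel_distr_plus)
        then have "integrable lborel (\<lambda>t. \<phi> (x + t) *\<^sub>R ub (x + t))"
            by (subst (asm) integrable_distr_eq) simp_all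
        moreover have "(\<integral>y. \<phi> y *\<^sub>R ub y \<partial>lborel) = (\<integral>t. \<phi> (x + t) *\<^sub>R ub (x + t) \<partial>lborel)"
          using integral_distr[of "(+) x" lborel borel "\<lambda>y. \<phi> y *\<^sub>R ub y"]
              by (simp add: lborel_distr_plus)
        ultimately show ?thesis unfolding sh I_def e1 by simp
      qed
      define Y where "Y = (\<integral>\<^sup>+t. ennreal (\<rho> t * norm (hb (x + t))) \<partial>lborel)"
      \<comment> \<open>The factor \<open>kn\<close> of the kernel bound joins the indicator of
        \<open>S\<close> to form \<open>\<rho>\<close>, so that no power of \<open>k\<close> other
        than \<open>1 / k\<close> survives.\<close>
      have Iy: "ennreal (norm I) \<le> ennreal (Q / k) * Y"
      proof -
        let ?J = "\<integral>y. indicator S y * data_fun f u y \<partial>lebesgue_on \<Omega>"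
        have "k * norm I \<le> kn * M * C1 * ?J" using wf(2) ai by simp
        then have "norm I \<le> Q / k * (kn * ?J)" using k0 by (simp add: field_simps Q_def)
        then have "ennreal (norm I) \<le> ennreal (Q / k) * (ennreal kn * ennreal ?J)"
          using Q k0 kn d0 by (simp add: ennreal_leI flip: ennreal_mult)
        also have "ennreal ?J = (\<integral>\<^sup>+y. ennreal (indicator S y * data_fun f u y) \<partial>lebesgue_on \<Omega>)"
          using d0 by (intro nn_integral_eq_integral[symmetric] wf(1)) auto
        also have "\<dots> = (\<integral>\<^sup>+y. ennreal (indicator S y * data_fun f u y) * indicator \<Omega> y \<partial>lebesgue)"
          by (rule nn_integral_restrict_space) (simp add: open_lebesgue \<Omega>)
        also have "\<dots> = (\<integral>\<^sup>+y. ennreal (indicator S y * data_fun f u y) * indicator \<Omega> y \<partial>lborel)"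
          by (rule nn_integral_completion)
        also have "\<dots> = (\<integral>\<^sup>+y. ennreal (indicator S y * norm (hb y)) \<partial>lborel)"
        proof (rule nn_integral_cong_AE, use hb(2) in eventually_elim)
          case (elim y)
          have "norm (hb y) = indicator \<Omega> y * data_fun f u y"
            unfolding elim[symmetric] using d0 by (simp add: norm_mult)
          then show ?case by (auto simp: indicator_def)
        qed
        also have "\<dots> = (\<integral>\<^sup>+t. ennreal (indicator S (x + t) * norm (hb (x + t))) \<partial>lborel)"
          using Sb by (subst nn_integral_lborel_translation[where a = x]) simp_all
        also have "ennreal kn * \<dots> = (\<integral>\<^sup>+t. ennreal kn * ennreal (indicator S (x + t)
            * norm (hb (x + t))) \<partial>lborel)"
          using Sb by (subst nn_integral_cmult) simp_all
        also have "\<dots> = Y"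
          unfolding Y_def using kn
          by (intro nn_integral_cong) (auto simp: \<rho>_def \<rho>1_def S_def indicator_def ennreal_mult)
        finally show ?thesis .
      qed
      have Y2: "Y\<^sup>2 \<le> ennreal R * (\<integral>\<^sup>+t. ennreal (\<rho> t) * ennreal ((norm (hb (x + t)))\<^sup>2) \<partial>lborel)"
        using nn_integral_weighted_Cauchy_Schwarz[of \<rho> lborel "\<lambda>t. norm (hb (x + t))"] \<rho>0
        by (simp add: Y_def \<rho>R ennreal_mult)
      have "(ennreal (norm I))\<^sup>2 \<le> (ennreal (Q / k) * Y)\<^sup>2" using Iy by (rule power_mono) simp
      also have "\<dots> = ennreal ((Q / k)\<^sup>2) * Y\<^sup>2" using Q k0
          by (simp add: power_mult_distrib ennreal_power)
      also have "\<dots> \<le> ennreal ((Q / k)\<^sup>2) * (ennreal R * (\<integral>\<^sup>+t. ennreal (\<rho> t)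
          * ennreal ((norm (hb (x + t)))\<^sup>2) \<partial>lborel))"
        using Y2 by (rule mult_left_mono) simp
      finally have I2: "ennreal ((norm I)\<^sup>2) \<le> ennreal ((Q / k)\<^sup>2) * (ennreal R
          * (\<integral>\<^sup>+t. ennreal (\<rho> t) * ennreal ((norm (hb (x + t)))\<^sup>2) \<partial>lborel))"
        by (simp add: ennreal_power)
      have dev: "ennreal ((norm (ub x - I))\<^sup>2)
          \<le> (\<integral>\<^sup>+t. ennreal (\<kappa> t) * ennreal ((norm (ub (x + t) - ub x))\<^sup>2) \<partial>lborel)"
        unfolding I_def by (rule kernel_average_deviation) (use \<kappa>0 \<kappa>1 ai in auto)
      have "(norm (ub x))\<^sup>2 \<le> 2 * (norm (ub x - I))\<^sup>2 + 2 * (norm I)\<^sup>2"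
      proof -
        have "norm (ub x) \<le> norm (ub x - I) + norm I" using norm_triangle_ineq[of "ub x - I" I]
            by simp
        then have "(norm (ub x))\<^sup>2 \<le> (norm (ub x - I) + norm I)\<^sup>2" by (intro power_mono) auto
        then show ?thesis using sum_squares_bound[of "norm (ub x - I)" "norm I"]
            by (simp add: power2_sum)
      qed
      then have "ennreal ((norm (ub x))\<^sup>2) \<le> 2 * ennreal ((norm (ub x - I))\<^sup>2) + 2
          * ennreal ((norm I)\<^sup>2)"
        by (simp add: ennreal_leI flip: ennreal_numeral ennreal_mult ennreal_plus)
      also have "\<dots> \<le> 2 * (\<integral>\<^sup>+t. ennreal (\<kappa> t) * ennreal ((norm (ub (x + t) - ub x))\<^sup>2) \<partial>lborel) +
        2 * (ennreal ((Q / k)\<^sup>2) * (ennreal R * (\<integral>\<^sup>+t. ennreal (\<rho> t) * ennreal ((norm (hb (x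
            + t)))\<^sup>2) \<partial>lborel)))"
        by (intro add_mono mult_left_mono dev I2) auto
      finally show ?thesis by (simp add: mult.assoc)
    qed
    have Ub: "U \<in> sets borel" using U by simp
    note [measurable] = Ub
    define T1 where "T1 x = (\<integral>\<^sup>+t. ennreal (\<kappa> t) * (indicator U x * ennreal ((norm (ub (x + t)
        - ub x))\<^sup>2)) \<partial>lborel)" for x
    define T2 where "T2 x = (\<integral>\<^sup>+t. ennreal (\<rho> t) * (indicator U x * ennreal ((norm (hb (x
        + t)))\<^sup>2)) \<partial>lborel)" for x
    have [measurable]: "T1 \<in> borel_measurable borel" "T2 \<in> borel_measurable borel"
      unfolding T1_def[abs_def] T2_def[abs_def] by measurable
    have A1: "(\<integral>\<^sup>+x. T1 x \<partial>lborel) \<le> ennreal ((1 / k * (real n * D * X))\<^sup>2)"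
    proof -
      have "(\<integral>\<^sup>+x. T1 x \<partial>lborel) \<le> (\<integral>\<^sup>+t. ennreal (\<kappa> t) \<partial>lborel) * ennreal ((1 / k * (real n * D
          * X))\<^sup>2)"
        unfolding T1_def
      proof (rule nn_integral_kernel_average)
        fix t assume "ennreal (\<kappa> t) \<noteq> 0"
        then have "\<eta> (k *\<^sub>R t) \<noteq> 0" by (auto simp: \<kappa>_def)
        then have z: "k *\<^sub>R t \<in> ball c \<delta>" using \<eta>(1) by (auto simp: test_fun_def)
        \<comment> \<open>The shift \<open>t\<close> is reached by travelling along
          \<open>k t\<close>, a direction in the cone, for the time \<open>1 / k\<close>; this stays
          in the domain because \<open>1 / k \<le> h0\<close>.\<close>
        have pz: "x + s *\<^sub>R (k *\<^sub>R t) \<in> \<Omega>" if "x \<in> U" "0 \<le> s" "s \<le> 1 / k" for x s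
          by (rule path[OF that(1) z that(2)]) (use that(3) k(2) in linarith)
        have "(\<integral>\<^sup>+x. indicator U x * ennreal ((norm (ub (x + (1 / k) *\<^sub>R (k *\<^sub>R t))
            - ub x))\<^sup>2) \<partial>lborel)
            \<le> ennreal ((1 / k * (real CARD('n) * D * norm1 \<Omega> u))\<^sup>2)"
          by (rule translation_bound_nn[OF U u1 pz _ ub D(2)[OF z] D(1)]) (use k0 in simp_all)
        also have "\<dots> \<le> ennreal ((1 / k * (real n * D * X))\<^sup>2)"
          unfolding n_def using k0 D(1) X n1 by (intro ennreal_leI power_mono mult_left_mono) auto
        finally show "(\<integral>\<^sup>+x. indicator U x * ennreal ((norm (ub (x + t) - ub x))\<^sup>2) \<partial>lborel)
            \<le> ennreal ((1 / k * (real n * D * X))\<^sup>2)"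
          using k0 by simp
      qed measurable
      then show ?thesis by (simp add: \<kappa>1)
    qed
    have A2: "(\<integral>\<^sup>+x. T2 x \<partial>lborel) \<le> ennreal R * ennreal (((real n + 1) * X)\<^sup>2)"
    proof -
      have "(\<integral>\<^sup>+x. T2 x \<partial>lborel) \<le> (\<integral>\<^sup>+t. ennreal (\<rho> t) \<partial>lborel) * ennreal (((real n + 1) * X)\<^sup>2)"
        unfolding T2_def
      proof (rule nn_integral_kernel_average)
        fix t
        have "(\<integral>\<^sup>+x. indicator U x * ennreal ((norm (hb (x + t)))\<^sup>2) \<partial>lborel)
            \<le> (\<integral>\<^sup>+x. ennreal ((norm (hb (t + x)))\<^sup>2) \<partial>lborel)"
          by (intro nn_integral_mono) (auto simp: indicator_def add.commute)
        also have "\<dots> = (\<integral>\<^sup>+x. ennreal ((norm (hb x))\<^sup>2) \<partial>lborel)"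
          by (rule nn_integral_lborel_translation) measurable
        also have "\<dots> \<le> ennreal ((L2_norm (lebesgue_on \<Omega>) (\<lambda>x. complex_of_real (data_fun f u x)))\<^sup>2)"
          by (rule L2_norm_nn_representative[OF dL(1) open_lebesgue[OF \<Omega>(1)] hb(2)])
        also have "\<dots> \<le> ennreal (((real n + 1) * X)\<^sup>2)"
          using dL(2) unfolding X_def n_def by (intro ennreal_leI power_mono) auto
        finally show "(\<integral>\<^sup>+x. indicator U x * ennreal ((norm (hb (x + t)))\<^sup>2) \<partial>lborel)
            \<le> ennreal (((real n + 1) * X)\<^sup>2)" .
      qed measurable
      then show ?thesis by (simp add: \<rho>R)
    qed
    have R0: "R \<ge> 0" by (simp add: R_def)
    have K2: "K\<^sup>2 = 2 * (real n * D)\<^sup>2 + 2 * Q\<^sup>2 * R\<^sup>2 * (real n + 1)\<^sup>2"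
      unfolding K_def by (rule real_sqrt_pow2) (intro add_nonneg_nonneg mult_nonneg_nonneg
          zero_le_power2, simp_all)
    have "(\<integral>\<^sup>+x. ennreal ((norm (u x))\<^sup>2) \<partial>lebesgue_on U)
        = (\<integral>\<^sup>+x. ennreal ((norm (u x))\<^sup>2) * indicator U x \<partial>lebesgue)"
      by (rule nn_integral_restrict_space) (simp add: open_lebesgue U)
    also have "\<dots> = (\<integral>\<^sup>+x. ennreal ((norm (u x))\<^sup>2) * indicator U x \<partial>lborel)"
        by (rule nn_integral_completion)
    also have "\<dots> \<le> (\<integral>\<^sup>+x. 2 * T1 x + 2 * ennreal ((Q / k)\<^sup>2) * (ennreal R * T2 x) \<partial>lborel)"
    proof (rule nn_integral_mono_AE, use ub(2) in eventually_elim)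
      case (elim x)
      show ?case
      proof (cases "x \<in> U")
        case True
        then have "ub x = u x" using elim UO by auto
        then show ?thesis using pt[OF True] True by (simp add: T1_def T2_def)
      qed simp
    qed
    also have "\<dots> = 2 * (\<integral>\<^sup>+x. T1 x \<partial>lborel) + 2 * ennreal ((Q / k)\<^sup>2) * (ennreal R
        * (\<integral>\<^sup>+x. T2 x \<partial>lborel))"
      by (simp add: nn_integral_add nn_integral_cmult)
    also have "\<dots> \<le> 2 * ennreal ((1 / k * (real n * D * X))\<^sup>2) + 2 * ennreal ((Q / k)\<^sup>2)
        * (ennreal R * (ennreal R * ennreal (((real n + 1) * X)\<^sup>2)))"
      by (intro add_mono mult_left_mono A1 A2) auto
    also have "\<dots> = ennreal (2 * (1 / k * (real n * D * X))\<^sup>2 + 2 * (Q / k)\<^sup>2 * (R * (R * ((real n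
        + 1) * X)\<^sup>2)))"
      using R0 by (simp add: ennreal_mult mult.assoc flip: ennreal_numeral)
    also have "2 * (1 / k * (real n * D * X))\<^sup>2 + 2 * (Q / k)\<^sup>2 * (R * (R * ((real n + 1)
        * X)\<^sup>2)) = (K * X / k)\<^sup>2"
      unfolding power_divide power_mult_distrib K2 using k0
          by (simp add: field_simps power2_eq_square)
    finally have nn: "(\<integral>\<^sup>+x. ennreal ((norm (u x))\<^sup>2) \<partial>lebesgue_on U) \<le> ennreal ((K * X / k)\<^sup>2)" .
    have K0: "K \<ge> 0" by (simp add: K_def)
    have uU: "u \<in> L2 (lebesgue_on U)"
      by (rule L2_on_subset(1)[OF open_lebesgue[OF \<Omega>(1)] open_lebesgue[OF U(1)] UO Du(1)])
    have "L2_norm (lebesgue_on U) u \<le> K * X / k"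
      using L2_norm_le_iff_nn[OF L2_measurable[OF uU], of "K * X / k"] nn K0 X k0 by auto
    then show ?thesis using k0 by (simp add: field_simps X_def)
  qed
  have "K \<ge> 0" by (simp add: K_def)
  then show ?thesis using main by blast
qed

end

section \<open>The cone property of C2 domains\<close>

lemma Ck2_Lipschitz_on_cball:
  fixes \<gamma> :: "real^'n \<Rightarrow> real"
  assumes "Ck_on 2 UNIV \<gamma>"
  obtains L where "L \<ge> 0" "\<And>x y. x \<in> cball a r \<Longrightarrow> y \<in> cball a r \<Longrightarrow> \<bar>\<gamma> x - \<gamma> y\<bar> \<le> L * norm (x - y)"
proof -
  have d: "\<gamma> differentiable (at x)" and dd: "partial_deriv j \<gamma> differentiable (at x)" for x j
    using assms by (auto simp: numeral_2_eq_2)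
  have "\<exists>M\<ge>0. \<forall>x\<in>cball a r. \<bar>partial_deriv j \<gamma> x\<bar> \<le> M" for j
  proof -
    have "continuous_on (cball a r) (partial_deriv j \<gamma>)"
      using dd by (intro continuous_at_imp_continuous_on ballI differentiable_imp_continuous_within)
    then have "bounded (partial_deriv j \<gamma> ` cball a r)"
      by (intro compact_imp_bounded compact_continuous_image) auto
    then obtain M where "\<forall>x\<in>cball a r. \<bar>partial_deriv j \<gamma> x\<bar> \<le> M" by (auto simp: bounded_iff)
    then have "\<forall>x\<in>cball a r. \<bar>partial_deriv j \<gamma> x\<bar> \<le> \<bar>M\<bar>" by (meson abs_ge_self order_trans)
    then show ?thesis by (intro exI[of _ "\<bar>M\<bar>"]) auto
  qed
  then obtain M where M: "\<And>j. M j \<ge> 0" "\<And>j x. x \<in> cball a r \<Longrightarrow> \<bar>partial_deriv j \<gamma> x\<bar> \<le> M j"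
    by metis
  define L where "L = (\<Sum>j\<in>UNIV. M j)"
  show ?thesis
  proof (rule that[of L])
    show "L \<ge> 0" unfolding L_def by (simp add: M(1) sum_nonneg)
    fix x y assume xy: "x \<in> cball a r" "y \<in> cball a r"
    have "norm (\<gamma> x - \<gamma> y) \<le> L * norm (x - y)"
    proof (rule differentiable_bound[OF convex_cball _ _ xy])
      fix z assume z: "z \<in> cball a r"
      let ?D = "\<lambda>h. \<Sum>j\<in>UNIV. (h $ j) *\<^sub>R partial_deriv j \<gamma> z"
      show "(\<gamma> has_derivative ?D) (at z within cball a r)"
        by (rule has_derivative_at_withinI[OF differentiable_partial_deriv[OF d]])
      show "onorm ?D \<le> L"
      proof (rule onorm_le)
        fix h :: "real^'n"
        have "norm (?D h) \<le> (\<Sum>j\<in>UNIV. M j * norm h)"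
        proof (rule sum_norm_le)
          fix j
          have "\<bar>h $ j\<bar> * \<bar>partial_deriv j \<gamma> z\<bar> \<le> norm h * M j"
            using component_le_norm_cart[of h j] M z by (intro mult_mono) auto
          then show "norm ((h $ j) *\<^sub>R partial_deriv j \<gamma> z) \<le> M j * norm h"
              by (simp add: abs_mult mult.commute)
        qed
        then show "norm (?D h) \<le> L * norm h" by (simp add: L_def sum_distrib_right)
      qed
    qed
    then show "\<bar>\<gamma> x - \<gamma> y\<bar> \<le> L * norm (x - y)" by simp
  qed
qed

text \<open>At a boundary point the domain is locally the region on one side of a Lipschitz graph.
  Directions near the axis gain height faster than the graph can rise, so one ball of directions and
  one length work for all nearby points of the domain.\<close>

lemma uniform_cone_property:
  fixes \<Omega> :: "(real^'n) set"
  assumes \<Omega>: "open \<Omega>" "C2_boundary \<Omega>" and x0: "x0 \<in> closure \<Omega>"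
  shows "\<exists>r c \<delta> h0. r > 0 \<and> \<delta> > 0 \<and> h0 > 0 \<and>
    (\<forall>x z t. x \<in> \<Omega> \<inter> ball x0 r \<longrightarrow> z \<in> ball c \<delta> \<longrightarrow> 0 \<le> t \<longrightarrow> t \<le> h0 \<longrightarrow> x + t *\<^sub>R z \<in> \<Omega>)"
proof (cases "x0 \<in> \<Omega>")
  case True
  then obtain r where r: "r > 0" "ball x0 r \<subseteq> \<Omega>" using \<Omega>(1) by (meson openE)
  \<comment> \<open>An interior point has no preferred direction, so the unit ball around
    \<open>0\<close> serves as the set of directions.\<close>
  have "x + t *\<^sub>R z \<in> \<Omega>" if x: "x \<in> ball x0 (r / 2)" and z: "z \<in> ball 0 1" and t: "0 \<le> t" "t
      \<le> r / 2" for x z t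
  proof -
    have "norm (t *\<^sub>R z) \<le> r / 2"
      using mult_mono[of t "r / 2" "norm z" 1] z t r by simp
    then have "dist x0 (x + t *\<^sub>R z) < r"
      using x dist_triangle_add[of x0 0 x "t *\<^sub>R z"] by simp
    then show ?thesis using r(2) by auto
  qed
  then show ?thesis
    using r(1) by (intro exI[of _ "r / 2"] exI[of _ 0] exI[of _ 1] exI[of _ "r / 2"]) auto
next
  case False
  then have "x0 \<in> frontier \<Omega>" using x0 \<Omega>(1) by (simp add: frontier_def interior_open)
  then obtain r j s \<gamma> where r: "r > 0" and s: "s \<in> {1, -1 :: real}" and \<gamma>:
      "Ck_on 2 UNIV (\<gamma> :: real^'n \<Rightarrow> real)"
    and inv: "\<And>x t. \<gamma> (x + t *\<^sub>R axis j 1) = \<gamma> x" and eq: "\<Omega> \<inter> ball x0 r = {x \<in> ball x0 r. \<gamma> x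
        < s * x $ j}"
    using \<Omega>(2) unfolding C2_boundary_def by meson
  obtain L where L: "L \<ge> 0" "\<And>x y. x \<in> cball x0 r \<Longrightarrow> y \<in> cball x0 r \<Longrightarrow> \<bar>\<gamma> x - \<gamma> y\<bar> \<le> L * norm (x - y)"
    using Ck2_Lipschitz_on_cball[OF \<gamma>] by blast
  \<comment> \<open>Along \<open>z\<close> the height grows at a rate of at least
    \<open>1 - \<delta>\<close>, the graph at a rate of at most \<open>L \<delta>\<close>;
    \<open>(L + 1) \<delta> = 1 / 2\<close> keeps the second below the first.\<close>
  define \<delta> where "\<delta> = 1 / (2 * (L + 1))"
  have \<delta>: "\<delta> > 0" "\<delta> \<le> 1" "(L + 1) * \<delta> = 1 / 2" using L(1) by (auto simp: \<delta>_def divide_simps)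
  define c where "c = s *\<^sub>R (axis j 1 :: real^'n)"
  have nc: "norm c = 1" using s by (auto simp: c_def)
  have "x + t *\<^sub>R z \<in> \<Omega>" if x: "x \<in> \<Omega>" "x \<in> ball x0 (r / 2)" and z: "z \<in> ball c \<delta>" and t: "0
      \<le> t" "t \<le> r / 4" for x z t
  proof -
    have zc: "norm (z - c) < \<delta>" using z by (simp add: dist_norm norm_minus_commute)
    have nz: "norm z < 2" using norm_triangle_ineq[of "z - c" c] zc nc \<delta> by simp
    have in_ball: "x + t *\<^sub>R y \<in> ball x0 r" if y: "norm y < 2" for y
    proof -
      have "norm (t *\<^sub>R y) \<le> r / 2"
        using mult_mono[of t "r / 4" "norm y" 2] y t r by simp
      then show ?thesis using x(2) dist_triangle_add[of x0 0 x "t *\<^sub>R y"] by simp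
    qed
    \<comment> \<open>\<open>\<gamma>\<close> ignores the axis direction, so its value at
      \<open>x + t z\<close> is that at \<open>p\<close>, whose distance from \<open>x\<close> is
      only \<open>t\<close> times that of \<open>z\<close> from \<open>c\<close>. The Lipschitz
      bound then costs \<open>L \<delta>\<close> per unit of \<open>t\<close>.\<close>
    define p where "p = x + t *\<^sub>R (z - c)"
    have p: "p \<in> ball x0 r" unfolding p_def using zc \<delta> by (intro in_ball) simp
    have xr: "x \<in> ball x0 r" using x(2) r by simp
    have "x + t *\<^sub>R z = p + (t * s) *\<^sub>R axis j 1" by (simp add: p_def c_def algebra_simps)
    then have "\<gamma> (x + t *\<^sub>R z) = \<gamma> p" using inv by simp
    also have "\<dots> \<le> \<gamma> x + L * norm (p - x)" using L(2)[of p x] p xr by (simp add: abs_le_iff)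
    also have "L * norm (p - x) \<le> L * (t * \<delta>)"
      unfolding p_def using zc t L(1) by (intro mult_left_mono) (auto intro: mult_left_mono)
    finally have 1: "\<gamma> (x + t *\<^sub>R z) \<le> \<gamma> x + t * (L * \<delta>)" by (simp add: mult.left_commute)
    have 2: "\<gamma> x < s * x $ j" using x(1) xr eq by blast
    have "\<bar>s * (z - c) $ j\<bar> \<le> norm (z - c)" using component_le_norm_cart[of "z - c" j] s by auto
    then have "- \<delta> \<le> s * (z - c) $ j" using zc by linarith
    moreover have "s * z $ j = s * (z - c) $ j + 1" using s by (auto simp: c_def axis_def)
    ultimately have "1 - \<delta> \<le> s * z $ j" by simp
    then have 3: "t * (1 - \<delta>) \<le> t * (s * z $ j)" using t(1) by (rule mult_left_mono)
    have "t * (L * \<delta>) + t * \<delta> = t * (1 / 2)" unfolding \<delta>(3)[symmetric] by (simp add: algebra_simps)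
    then have "t * (L * \<delta>) \<le> t * (1 - \<delta>)" using t(1) by (simp add: algebra_simps)
    then have "\<gamma> (x + t *\<^sub>R z) < s * (x + t *\<^sub>R z) $ j" using 1 2 3 by (simp add: algebra_simps)
    then show ?thesis using in_ball[OF nz] eq by blast
  qed
  then show ?thesis
    using r \<delta>(1) by (intro exI[of _ "r / 2"] exI[of _ c] exI[of _ \<delta>] exI[of _ "r / 4"]) auto
qed

context elliptic
begin

text \<open>Finitely many local estimates cover the compact closure. Each is available for
  \<open>k\<close> above a threshold; for smaller \<open>k\<close> the claim follows from
  \<open>norm0 \<Omega> u \<le> norm1 \<Omega> u\<close>.\<close>

theorem global_estimate:
  assumes bd: "C2_boundary \<Omega>"
  shows "\<exists>C\<ge>0. \<forall>k f u. k > 0 \<longrightarrow> solves k f u \<longrightarrow> k * norm0 \<Omega> u \<le> C * (norm0 \<Omega> f + norm1 \<Omega> u)"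
proof -
  have "\<forall>x0\<in>closure \<Omega>. \<exists>r K h. r > 0 \<and> K \<ge> 0 \<and> h > 0 \<and> (\<forall>k f u. k \<ge> 1 \<and> 1 / k \<le> h \<and> solves k f u \<longrightarrow>
      k * L2_norm (lebesgue_on (\<Omega> \<inter> ball x0 r)) u \<le> K * (norm0 \<Omega> f + norm1 \<Omega> u))"
  proof
    fix x0 assume "x0 \<in> closure \<Omega>"
    from uniform_cone_property[OF \<Omega>(1) bd this] obtain r c \<delta> h0 where *: "r > 0" "\<delta> > 0" "h0 > 0"
      "\<And>x z t. x \<in> \<Omega> \<inter> ball x0 r \<Longrightarrow> z \<in> ball c \<delta> \<Longrightarrow> 0 \<le> t \<Longrightarrow> t \<le> h0 \<Longrightarrow> x + t *\<^sub>R z \<in> \<Omega>" by blast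
    have "open (\<Omega> \<inter> ball x0 r)" "bounded (\<Omega> \<inter> ball x0 r)" using \<Omega> by auto
    from local_estimate[OF this *(2,3,4)] obtain K where K: "K \<ge> 0" "\<forall>k f u. k \<ge> 1 \<and> 1 / k \<le> h0
        \<and> solves k f u \<longrightarrow>
      k * L2_norm (lebesgue_on (\<Omega> \<inter> ball x0 r)) u \<le> K * (norm0 \<Omega> f + norm1 \<Omega> u)" by blast
    show "\<exists>r K h. r > 0 \<and> K \<ge> 0 \<and> h > 0 \<and> (\<forall>k f u. k \<ge> 1 \<and> 1 / k \<le> h \<and> solves k f u \<longrightarrow>
      k * L2_norm (lebesgue_on (\<Omega> \<inter> ball x0 r)) u \<le> K * (norm0 \<Omega> f + norm1 \<Omega> u))"
      by (rule exI[of _ r], rule exI[of _ K], rule exI[of _ h0]) (use *(1,3) K in simp)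
  qed
  from bchoice[OF this] obtain r where "\<forall>x0\<in>closure \<Omega>. \<exists>K h. r x0 > 0 \<and> K \<ge> 0 \<and> h > 0
      \<and> (\<forall>k f u. k \<ge> 1 \<and> 1 / k \<le> h \<and> solves k f u \<longrightarrow>
      k * L2_norm (lebesgue_on (\<Omega> \<inter> ball x0 (r x0))) u \<le> K * (norm0 \<Omega> f + norm1 \<Omega> u))" ..
  from bchoice[OF this] obtain K where "\<forall>x0\<in>closure \<Omega>. \<exists>h. r x0 > 0 \<and> K x0 \<ge> 0 \<and> h > 0
      \<and> (\<forall>k f u. k \<ge> 1 \<and> 1 / k \<le> h \<and> solves k f u \<longrightarrow>
      k * L2_norm (lebesgue_on (\<Omega> \<inter> ball x0 (r x0))) u \<le> K x0 * (norm0 \<Omega> f + norm1 \<Omega> u))" ..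
  from bchoice[OF this] obtain h where rKh: "\<forall>x0\<in>closure \<Omega>. r x0 > 0 \<and> K x0 \<ge> 0 \<and> h x0 > 0
      \<and> (\<forall>k f u. k \<ge> 1 \<and> 1 / k \<le> h x0 \<and> solves k f u \<longrightarrow>
      k * L2_norm (lebesgue_on (\<Omega> \<inter> ball x0 (r x0))) u \<le> K x0 * (norm0 \<Omega> f + norm1 \<Omega> u))" ..
  have cpt: "compact (closure \<Omega>)" using \<Omega>(2) by simp
  have cov: "closure \<Omega> \<subseteq> (\<Union>x\<in>closure \<Omega>. ball x (r x))" using rKh by auto
  obtain T where T: "T \<subseteq> closure \<Omega>" "finite T" "closure \<Omega> \<subseteq> (\<Union>x\<in>T. ball x (r x))"
    by (rule compactE_image[OF cpt _ cov], simp, rule that)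
  \<comment> \<open>Sums replace maxima over the finite cover: \<open>k0\<close> is at least
    \<open>1\<close> and at least every threshold \<open>1 / h x\<close>, and \<open>C\<close>
    serves both ranges of \<open>k\<close>.\<close>
  define k0 where "k0 = 1 + (\<Sum>x\<in>T. 1 / h x)"
  define C where "C = k0 + (\<Sum>x\<in>T. K x)"
  have hT: "h x > 0" "K x \<ge> 0" if "x \<in> T" for x using that T(1) rKh by auto
  have k0: "k0 \<ge> 1" "1 / h x \<le> k0" if "x \<in> T" for x
  proof -
    show "k0 \<ge> 1" unfolding k0_def using hT by (simp add: sum_nonneg less_imp_le)
    have "1 / h x \<le> (\<Sum>x\<in>T. 1 / h x)"
      using that T(2) hT by (intro member_le_sum) (auto simp: less_imp_le)
    then show "1 / h x \<le> k0" by (simp add: k0_def)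
  qed
  have k01: "k0 \<ge> 1" unfolding k0_def using hT by (simp add: sum_nonneg less_imp_le)
  have KT: "(\<Sum>x\<in>T. K x) \<ge> 0" using hT by (simp add: sum_nonneg)
  have "k * norm0 \<Omega> u \<le> C * (norm0 \<Omega> f + norm1 \<Omega> u)" if k: "k > 0" and sol: "solves k f u" for k f u
  proof -
    define X where "X = norm0 \<Omega> f + norm1 \<Omega> u"
    have n01: "norm0 \<Omega> u \<le> norm1 \<Omega> u" by (rule norm1_ge)
    have X: "norm1 \<Omega> u \<le> X" "0 \<le> X" using order_trans[OF L2_norm_nonneg n01] by (auto simp: X_def)
    show ?thesis
    proof (cases "k \<ge> k0")
      case False
      have "k * norm0 \<Omega> u \<le> k0 * X" using False k n01 X by (intro mult_mono) auto
      also have "\<dots> \<le> C * X" using KT X by (intro mult_right_mono) (auto simp: C_def)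
      finally show ?thesis by (simp add: X_def)
    next
      case True
      have u2: "u \<in> sobolev 2 \<Omega>" using sol by (simp only: solves_def)
      have uL: "u \<in> L2 (lebesgue_on \<Omega>)" by (rule sobolev1_D(1)[OF \<Omega>(1) sobolev2_D(1)[OF \<Omega>(1) u2]])
      define U where "U x = \<Omega> \<inter> ball x (r x)" for x
      have Uo: "U x \<in> sets lebesgue" for x unfolding U_def using \<Omega>(1) by (intro open_lebesgue) auto
      have uU: "u \<in> L2 (lebesgue_on (U x))" for x
        by (rule L2_on_subset(1)[OF open_lebesgue[OF \<Omega>(1)] Uo _ uL]) (auto simp: U_def)
      \<comment> \<open>On \<open>\<Omega>\<close> the function \<open>u\<close> is dominated by the
        sum of its absolute values on the overlapping pieces, so the triangle inequality takes the
        place of a partition.\<close>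
      define g where "g x y = complex_of_real (norm (indicator (U x) y *\<^sub>R u y))" for x y
      have g: "g x \<in> L2 lebesgue" "L2_norm lebesgue (g x) = L2_norm (lebesgue_on (U x)) u" for x
      proof -
        have m: "(\<lambda>y. indicator (U x) y *\<^sub>R u y) \<in> L2 lebesgue" using uU L2_on_iff[OF Uo] by blast
        have [measurable]: "(\<lambda>y. indicator (U x) y *\<^sub>R u y) \<in> borel_measurable lebesgue" using m
            by (rule L2_measurable)
        have gm: "g x \<in> borel_measurable lebesgue"
          unfolding g_def[abs_def]
          by (rule measurable_compose[OF L2_measurable[OF m]])
             (intro borel_measurable_continuous_onI continuous_intros)
        show "g x \<in> L2 lebesgue"
          by (rule L2_norm_mono(1)[OF gm m]) (rule AE_I2, simp only: g_def norm_of_real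
              abs_norm_cancel order_refl)
        show "L2_norm lebesgue (g x) = L2_norm (lebesgue_on (U x)) u"
          unfolding L2_norm_on[OF Uo] by (simp only: L2_norm_def g_def norm_of_real abs_norm_cancel)
      qed
      have "L2_norm lebesgue (\<lambda>y. indicator \<Omega> y *\<^sub>R u y) \<le> L2_norm lebesgue (\<lambda>y. \<Sum>x\<in>T. g x y)"
      proof (rule L2_norm_mono(2)[OF _ L2_sum[OF g(1)]])
        show "(\<lambda>y. indicator \<Omega> y *\<^sub>R u y) \<in> borel_measurable lebesgue"
          using uL L2_on_iff[OF open_lebesgue[OF \<Omega>(1)]] L2_measurable by blast
        show "AE y in lebesgue. norm (indicator \<Omega> y *\<^sub>R u y) \<le> norm (\<Sum>x\<in>T. g x y)"
        proof (rule AE_I2)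
          fix y
          have eq: "norm (\<Sum>x\<in>T. g x y) = (\<Sum>x\<in>T. norm (indicator (U x) y *\<^sub>R u y))"
            unfolding g_def of_real_sum[symmetric] norm_of_real by (simp add: sum_nonneg)
          show "norm (indicator \<Omega> y *\<^sub>R u y) \<le> norm (\<Sum>x\<in>T. g x y)"
          proof (cases "y \<in> \<Omega>")
            case True
            then obtain x where x: "x \<in> T" "y \<in> U x" using T(3) closure_subset[of \<Omega>]
                by (auto simp: U_def)
            have "norm (indicator \<Omega> y *\<^sub>R u y) = norm (indicator (U x) y *\<^sub>R u y)" using True x
                by simp
            also have "\<dots> \<le> (\<Sum>x\<in>T. norm (indicator (U x) y *\<^sub>R u y))"
              using x T(2) by (intro member_le_sum) auto
            finally show ?thesis unfolding eq .
          qed simp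
        qed
      qed
      also have "\<dots> \<le> (\<Sum>x\<in>T. L2_norm lebesgue (g x))" by (rule L2_norm_sum[OF g(1)])
      finally have "norm0 \<Omega> u \<le> (\<Sum>x\<in>T. L2_norm (lebesgue_on (U x)) u)"
        unfolding L2_norm_on[OF open_lebesgue[OF \<Omega>(1)]] g(2) .
      then have "k * norm0 \<Omega> u \<le> k * (\<Sum>x\<in>T. L2_norm (lebesgue_on (U x)) u)"
        using k by (intro mult_left_mono) auto
      also have "\<dots> = (\<Sum>x\<in>T. k * L2_norm (lebesgue_on (U x)) u)" by (rule sum_distrib_left)
      also have "\<dots> \<le> (\<Sum>x\<in>T. K x * X)"
      proof (rule sum_mono)
        fix x assume x: "x \<in> T"
        have "1 / h x \<le> k" using k0(2)[OF x] True by simp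
        then have "1 / k \<le> h x" using hT(1)[OF x] k by (simp add: field_simps)
        then show "k * L2_norm (lebesgue_on (U x)) u \<le> K x * X"
          using rKh x T(1) sol True k01 unfolding U_def X_def by auto
      qed
      also have "\<dots> \<le> C * X"
        unfolding sum_distrib_right[symmetric] using k01 X
            by (intro mult_right_mono) (auto simp: C_def)
      finally show ?thesis by (simp add: X_def)
    qed
  qed
  moreover have "C \<ge> 0" using k01 KT by (simp add: C_def)
  ultimately show ?thesis by blast
qed

end

section \<open>Exhausting subspaces and distance semi-norms\<close>

lemma countable_rational_boxes: "countable (rational_boxes :: (real^'n) set set)"
proof -
  let ?Q = "(\<lambda>f. \<chi> i. f i) ` ((UNIV :: 'n set) \<rightarrow>\<^sub>E \<rat>) :: (real^'n) set"
  have "countable ((UNIV :: 'n set) \<rightarrow>\<^sub>E (\<rat> :: real set))"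
    by (rule countable_PiE) (simp_all add: countable_rat)
  then have Q: "countable ?Q" by (rule countable_image)
  have "countable ((\<lambda>(a, b). box a b) ` (?Q \<times> ?Q))"
      by (rule countable_image[OF countable_SIGMA[OF Q Q]])
  moreover have "rational_boxes \<subseteq> (\<lambda>(a, b). box a b) ` (?Q \<times> ?Q)"
  proof
    fix A :: "(real^'n) set" assume "A \<in> rational_boxes"
    then obtain a b where A: "A = box a b" "\<forall>i. a $ i \<in> \<rat>" "\<forall>i. b $ i \<in> \<rat>"
        by (auto simp: rational_boxes_def)
    have "x \<in> ?Q" if "\<forall>i. x $ i \<in> \<rat>" for x :: "real^'n"
      by (rule image_eqI[of _ _ "\<lambda>i. x $ i"]) (use that in auto)
    then show "A \<in> (\<lambda>(a, b). box a b) ` (?Q \<times> ?Q)" using A by blast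
  qed
  ultimately show ?thesis by (rule countable_subset[rotated])
qed

declare sobolev.simps [simp del] and One_nat_def [simp del]

locale bounded_open =
  fixes \<Omega> :: "(real^'n) set"
  assumes \<Omega>: "open \<Omega>" "bounded \<Omega>"
begin

abbreviation H1 where "H1 \<equiv> sobolev 1 \<Omega>"

lemma semi_inner_H1: "semi_inner H1 (ip1 \<Omega>)"
  by (rule semi_inner_sobolev[OF \<Omega>(1)])

lemma nrm_H1: "semi_inner.nrm (ip1 \<Omega>) = norm1 \<Omega>"
  by (rule nrm_sobolev[OF \<Omega>(1)])

interpretation h: semi_inner H1 "ip1 \<Omega>"
  rewrites "semi_inner.nrm (ip1 \<Omega>) = norm1 \<Omega>"
  by (rule semi_inner_H1) (rule nrm_H1)

lemma closure1_subset: "closure1 \<Omega> V \<subseteq> H1"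
  by (auto simp: closure1_def)

lemma subset_closure1: "V \<subseteq> H1 \<Longrightarrow> V \<subseteq> closure1 \<Omega> V"
  by (auto simp: closure1_def subset_eq intro!: bexI)

lemma closed_subspace1I:
  assumes "V \<subseteq> H1" "(\<lambda>x. 0) \<in> V" "\<And>u v. u \<in> V \<Longrightarrow> v \<in> V \<Longrightarrow> (\<lambda>x. u x + v x) \<in> V"
    "\<And>c u. u \<in> V \<Longrightarrow> (\<lambda>x. c * u x) \<in> V" "closure1 \<Omega> V \<subseteq> V"
  shows "closed_subspace1 \<Omega> V"
  using assms subset_closure1[OF assms(1)] by (auto simp: closed_subspace1_def)

lemma closed_subspace1D:
  assumes "closed_subspace1 \<Omega> V"
  shows "V \<subseteq> H1" "(\<lambda>x. 0) \<in> V" "\<And>u v. u \<in> V \<Longrightarrow> v \<in> V \<Longrightarrow> (\<lambda>x. u x + v x) \<in> V"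
    "\<And>c u. u \<in> V \<Longrightarrow> (\<lambda>x. c * u x) \<in> V" "closure1 \<Omega> V = V"
  using assms by (auto simp: closed_subspace1_def)

text \<open>The elements of such a space lie in the domain of the Neumann realisation of \<open>1 - \<Delta>\<close>, on which
  the operator is bounded by \<open>K\<close>.\<close>

definition weakly_bounded :: "(real^'n \<Rightarrow> complex) set \<Rightarrow> real \<Rightarrow> bool" where
  "weakly_bounded V K \<longleftrightarrow> 0 \<le> K \<and> (\<forall>u\<in>H1. \<forall>v\<in>V. \<bar>ip1 \<Omega> u v\<bar> \<le> K * norm0 \<Omega> u * norm1 \<Omega> v)"

text \<open>Closed subspaces contain all functions that vanish almost everywhere, so this is the smallest
  one.\<close>

definition null_space where "null_space = {u \<in> H1. norm1 \<Omega> u = 0}"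

lemma null_space_closed: "closed_subspace1 \<Omega> null_space"
proof (rule closed_subspace1I)
  show "(\<lambda>x. u x + v x) \<in> null_space" if "u \<in> null_space" "v \<in> null_space" for u v
    using that h.nrm_triangle[of u v] h.nrm_nonneg[OF h.add_mem[of u v]] h.add_mem[of u v]
    by (auto simp: null_space_def intro: antisym)
  show "(\<lambda>x. c * u x) \<in> null_space" if "u \<in> null_space" for c u
    using that h.nrm_scale[of u c] h.scale_mem[of u c] by (auto simp: null_space_def)
  show "closure1 \<Omega> null_space \<subseteq> null_space"
  proof
    fix u assume u: "u \<in> closure1 \<Omega> null_space"
    then have uH: "u \<in> H1" using closure1_subset by blast
    have "norm1 \<Omega> u \<le> e" if e: "e > 0" for e
    proof -
      obtain v where v: "v \<in> null_space" "norm1 \<Omega> (\<lambda>x. u x - v x) < e"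
        using u e unfolding closure1_def by blast
      then show ?thesis using h.nrm_le_diff_add[OF uH, of v] by (auto simp: null_space_def)
    qed
    then have "norm1 \<Omega> u \<le> 0" using field_le_epsilon[of "norm1 \<Omega> u" 0] by simp
    then show "u \<in> null_space" using h.nrm_nonneg[OF uH] uH by (simp add: null_space_def)
  qed
qed (use h.zero_mem in \<open>auto simp: null_space_def\<close>)

lemma null_space_bounded: "weakly_bounded null_space 0"
proof -
  have "\<bar>ip1 \<Omega> u v\<bar> \<le> 0" if "u \<in> H1" "v \<in> null_space" for u v
    using that h.Cauchy_Schwarz[of u v] by (simp add: null_space_def)
  then show ?thesis unfolding weakly_bounded_def by simp
qed

section \<open>Adding one function to a closed subspace\<close>

definition extend :: "(real^'n \<Rightarrow> complex) set \<Rightarrow> (real^'n \<Rightarrow> complex) \<Rightarrow> (real^'n \<Rightarrow> complex) set" where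
  "extend V e = {\<lambda>x. v x + c * e x | v c. v \<in> V}"

text \<open>\<open>d\<close> is a positive lower bound for the distances from \<open>e\<close> to
  elements of \<open>V\<close>, which exists since \<open>V\<close> is closed; dividing by
  \<open>c\<close> reduces the claim to it. Thus the coefficient of \<open>e\<close> depends
  continuously on the sum.\<close>

lemma extend_coefficient_bound:
  assumes V: "closed_subspace1 \<Omega> V" and e: "e \<in> H1" "e \<notin> V"
  obtains d where "d > 0" "\<And>v c. v \<in> V \<Longrightarrow> norm c * d \<le> norm1 \<Omega> (\<lambda>x. v x + c * e x)"
proof -
  note VD = closed_subspace1D[OF V]
  have "e \<notin> closure1 \<Omega> V" using e(2) VD(5) by simp
  then obtain d where d: "d > 0" "\<And>v. v \<in> V \<Longrightarrow> d \<le> norm1 \<Omega> (\<lambda>x. e x - v x)"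
    using e(1) unfolding closure1_def by (auto simp: not_less)
  show ?thesis
  proof (rule that[OF d(1)])
    fix v c assume v: "v \<in> V"
    have vH: "v \<in> H1" using v VD(1) by blast
    have mem: "(\<lambda>x. v x + c * e x) \<in> H1" by (intro h.add_mem vH h.scale_mem e)
    show "norm c * d \<le> norm1 \<Omega> (\<lambda>x. v x + c * e x)"
    proof (cases "c = 0")
      case True
      then show ?thesis using h.nrm_nonneg[OF mem] by simp
    next
      case False
      define w where "w x = (- 1 / c) * v x" for x
      have w: "w \<in> V" unfolding w_def by (rule VD(4)[OF v])
      have "(\<lambda>x. v x + c * e x) = (\<lambda>x. c * (e x - w x))" using False
          by (simp add: w_def fun_eq_iff field_simps)
      then have "norm1 \<Omega> (\<lambda>x. v x + c * e x) = norm c * norm1 \<Omega> (\<lambda>x. e x - w x)"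
        using h.nrm_scale[OF h.diff_mem[OF e(1)], of w c] w VD(1) by auto
      then show ?thesis using d(2)[OF w] by (simp add: mult_left_mono)
    qed
  qed
qed

text \<open>Along an approximating sequence the coefficients of \<open>e\<close> are Cauchy by
  \<open>extend_coefficient_bound\<close>; subtracting their limit times \<open>e\<close> leaves an
  element of the closure of \<open>V\<close>.\<close>

lemma extend_closed:
  assumes V: "closed_subspace1 \<Omega> V" and e: "e \<in> H1" "e \<notin> V"
  shows "closed_subspace1 \<Omega> (extend V e)"
proof (rule closed_subspace1I)
  note VD = closed_subspace1D[OF V]
  show sub: "extend V e \<subseteq> H1" unfolding extend_def using VD(1) e(1)
      by (auto intro!: h.add_mem h.scale_mem)
  show "(\<lambda>x. 0) \<in> extend V e" unfolding extend_def using VD(2)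
      by (intro CollectI exI[of _ "\<lambda>x. 0"] exI[of _ 0]) simp
  show "(\<lambda>x. u x + v x) \<in> extend V e" if "u \<in> extend V e" "v \<in> extend V e" for u v
  proof -
    from that obtain a c b d where "u = (\<lambda>x. a x + c * e x)" "v
        = (\<lambda>x. b x + d * e x)" "a \<in> V" "b \<in> V"
      unfolding extend_def by blast
    then show ?thesis unfolding extend_def
      by (intro CollectI exI[of _ "\<lambda>x. a x + b x"] exI[of _ "c
          + d"]) (auto simp: algebra_simps intro!: VD(3))
  qed
  show "(\<lambda>x. r * u x) \<in> extend V e" if "u \<in> extend V e" for r u
  proof -
    from that obtain a c where "u = (\<lambda>x. a x + c * e x)" "a \<in> V" unfolding extend_def by blast
    then show ?thesis unfolding extend_def
      by (intro CollectI exI[of _ "\<lambda>x. r * a x"] exI[of _ "r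
          * c"]) (auto simp: algebra_simps intro!: VD(4))
  qed
  obtain d where d: "d > 0" "\<And>v c. v \<in> V \<Longrightarrow> norm c * d \<le> norm1 \<Omega> (\<lambda>x. v x + c * e x)"
    using extend_coefficient_bound[OF V e] by blast
  show "closure1 \<Omega> (extend V e) \<subseteq> extend V e"
  proof
    fix u assume u: "u \<in> closure1 \<Omega> (extend V e)"
    then have uH: "u \<in> H1" using closure1_subset by blast
    have "\<exists>a c. a \<in> V \<and> norm1 \<Omega> (\<lambda>x. u x - (a x + c * e x)) < 1 / (real n + 1)" for n :: nat
    proof -
      have "0 < 1 / (real n + 1)" by simp
      then obtain p where "p \<in> extend V e" "norm1 \<Omega> (\<lambda>x. u x - p x) < 1 / (real n + 1)"
        using u unfolding closure1_def by blast
      then show ?thesis unfolding extend_def by blast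
    qed
    then obtain a c where a: "\<And>n. a n \<in> V" and ac: "\<And>n::nat. norm1 \<Omega> (\<lambda>x. u x - (a n x + c n
        * e x)) < 1 / (real n + 1)"
      by metis
    have aH: "a n \<in> H1" for n using a VD(1) by blast
    have pH: "(\<lambda>x. a n x + c n * e x) \<in> H1" for n by (intro h.add_mem h.scale_mem aH e)
    have cd: "norm (c m - c n) * d \<le> 1 / (real m + 1) + 1 / (real n + 1)" for m n
    proof -
      have av: "(\<lambda>x. a m x + (-1) * a n x) \<in> V" by (intro VD(3,4) a)
      have "norm (c m - c n) * d \<le> norm1 \<Omega> (\<lambda>x. (a m x + (-1) * a n x) + (c m - c n) * e x)"
        by (rule d(2)[OF av])
      also have "(\<lambda>x. (a m x + (-1) * a n x) + (c m - c n) * e x)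
          = (\<lambda>x. (a m x + c m * e x) - (a n x + c n * e x))"
        by (simp add: algebra_simps)
      also have "norm1 \<Omega> \<dots> \<le> norm1 \<Omega> (\<lambda>x. (a m x + c m * e x) - u x) + norm1 \<Omega> (\<lambda>x. u x - (a n x
          + c n * e x))"
        by (rule h.nrm_triangle_diff[OF pH uH pH])
      also have "norm1 \<Omega> (\<lambda>x. (a m x + c m * e x) - u x) = norm1 \<Omega> (\<lambda>x. u x - (a m x + c m * e x))"
        by (rule h.nrm_minus_commute[OF pH uH])
      finally show ?thesis using ac[of m] ac[of n] by linarith
    qed
    have "Cauchy c"
    proof (rule metric_CauchyI)
      fix r :: real assume r: "r > 0"
      obtain N :: nat where N: "2 / (r * d) < real N" using reals_Archimedean2 by blast
      have Np: "0 < real N" using N r d(1) by (meson divide_pos_pos less_trans mult_pos_pos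
          zero_less_numeral)
      have "dist (c m) (c n) < r" if "m \<ge> N" "n \<ge> N" for m n
      proof -
        have "1 / (real m + 1) \<le> 1 / real N" "1 / (real n + 1) \<le> 1 / real N"
          using that Np by (auto intro!: divide_left_mono mult_pos_pos)
        then have "norm (c m - c n) * d \<le> 2 / real N" using cd[of m n] by simp
        also have "\<dots> < r * d" using N Np r d(1) by (simp add: field_simps)
        finally show ?thesis using d(1) by (simp add: dist_norm)
      qed
      then show "\<exists>N. \<forall>m\<ge>N. \<forall>n\<ge>N. dist (c m) (c n) < r" by blast
    qed
    then obtain c0 where c0: "c \<longlonglongrightarrow> c0" by (auto simp: Cauchy_convergent_iff convergent_def)
    define w where "w x = u x - c0 * e x" for x
    have wH: "w \<in> H1" unfolding w_def[abs_def] by (intro h.diff_mem h.scale_mem uH e)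
    have bound: "norm1 \<Omega> (\<lambda>x. w x - a n x) \<le> 1 / (real n + 1) + norm (c n - c0) * norm1 \<Omega> e" for n
    proof -
      have "(\<lambda>x. w x - a n x) = (\<lambda>x. (u x - (a n x + c n * e x)) + (c n - c0) * e x)"
        by (simp add: w_def algebra_simps)
      then have "norm1 \<Omega> (\<lambda>x. w x - a n x) \<le> norm1 \<Omega> (\<lambda>x. u x - (a n x + c n * e x))
          + norm1 \<Omega> (\<lambda>x. (c n - c0) * e x)"
        using h.nrm_triangle[OF h.diff_mem[OF uH pH] h.scale_mem[OF e(1)]] by simp
      then show ?thesis using ac[of n] h.nrm_scale[OF e(1), of "c n - c0"] by simp
    qed
    have "(\<lambda>n. 1 / (real n + 1) + norm (c n - c0) * norm1 \<Omega> e) \<longlonglongrightarrow> 0 + norm (c0 - c0) * norm1 \<Omega> e"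
      using LIMSEQ_inverse_real_of_nat
      by (intro tendsto_intros c0) (simp add: inverse_eq_divide add.commute)
    then have lim: "(\<lambda>n. 1 / (real n + 1) + norm (c n - c0) * norm1 \<Omega> e) \<longlonglongrightarrow> 0" by simp
    have "w \<in> closure1 \<Omega> V"
      unfolding closure1_def
    proof (intro CollectI conjI wH allI impI)
      fix r :: real assume "r > 0"
      from LIMSEQ_D[OF lim this] obtain n where "norm (1 / (real n + 1) + norm (c n - c0)
          * norm1 \<Omega> e - 0) < r" by blast
      then have "norm1 \<Omega> (\<lambda>x. w x - a n x) < r" using bound[of n] by (simp add: abs_less_iff)
      then show "\<exists>v\<in>V. norm1 \<Omega> (\<lambda>x. w x - v x) < r" using a by blast
    qed
    then have "w \<in> V" using VD(5) by simp
    moreover have "u = (\<lambda>x. w x + c0 * e x)" by (simp add: w_def)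
    ultimately show "u \<in> extend V e" unfolding extend_def by blast
  qed
qed

lemma extend_bounded:
  assumes V: "closed_subspace1 \<Omega> V" and e: "e \<in> H1" "e \<notin> V" and K: "weakly_bounded V K"
    and Ke: "Ke \<ge> 0" "\<And>u c. u \<in> H1 \<Longrightarrow> \<bar>ip1 \<Omega> u (\<lambda>x. c * e x)\<bar> \<le> Ke * norm c * norm0 \<Omega> u"
  shows "\<exists>K'. weakly_bounded (extend V e) K'"
proof -
  obtain d where d: "d > 0" "\<And>v c. v \<in> V \<Longrightarrow> norm c * d \<le> norm1 \<Omega> (\<lambda>x. v x + c * e x)"
    using extend_coefficient_bound[OF V e] by blast
  note VD = closed_subspace1D[OF V]
  have K0: "K \<ge> 0" "\<And>u v. u \<in> H1 \<Longrightarrow> v \<in> V \<Longrightarrow> \<bar>ip1 \<Omega> u v\<bar> \<le> K * norm0 \<Omega> u * norm1 \<Omega> v"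
    using K by (auto simp: weakly_bounded_def)
  have e0: "norm1 \<Omega> e \<ge> 0" by (rule h.nrm_nonneg[OF e(1)])
  \<comment> \<open>With \<open>p\<close> the norm of \<open>v + c e\<close>, the coefficient is at
    most \<open>p / d\<close> and the norm of \<open>v\<close> at most
    \<open>(1 + norm1 \<Omega> e / d) p\<close>; these are multiplied by the constants
    \<open>Ke\<close> and \<open>K\<close>.\<close>
  define K' where "K' = K * (1 + norm1 \<Omega> e / d) + Ke / d"
  have "\<bar>ip1 \<Omega> u (\<lambda>x. v x + c * e x)\<bar> \<le> K' * norm0 \<Omega> u * norm1 \<Omega> (\<lambda>x. v x + c * e x)"
    if u: "u \<in> H1" and v: "v \<in> V" for u v c
  proof -
    define p where "p = norm1 \<Omega> (\<lambda>x. v x + c * e x)"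
    have vH: "v \<in> H1" using v VD(1) by blast
    have ceH: "(\<lambda>x. c * e x) \<in> H1" by (rule h.scale_mem[OF e(1)])
    have c: "norm c \<le> p / d" using d(2)[OF v, of c] d(1) by (simp add: p_def field_simps)
    have "norm1 \<Omega> v \<le> norm1 \<Omega> (\<lambda>x. v x - (v x + c * e x)) + p"
      unfolding p_def by (rule h.nrm_le_diff_add[OF vH h.add_mem[OF vH ceH]])
    also have "(\<lambda>x. v x - (v x + c * e x)) = (\<lambda>x. (- c) * e x)" by simp
    also have "norm1 \<Omega> \<dots> = norm c * norm1 \<Omega> e" using h.nrm_scale[OF e(1), of "- c"] by simp
    also have "norm c * norm1 \<Omega> e \<le> p / d * norm1 \<Omega> e" using c e0 by (rule mult_right_mono)
    finally have nv: "norm1 \<Omega> v \<le> (1 + norm1 \<Omega> e / d) * p" by (simp add: algebra_simps)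
    have "\<bar>ip1 \<Omega> u (\<lambda>x. v x + c * e x)\<bar> \<le> \<bar>ip1 \<Omega> u v\<bar> + \<bar>ip1 \<Omega> u (\<lambda>x. c * e x)\<bar>"
      using h.add_right[OF vH ceH u] by simp
    also have "\<dots> \<le> K * norm0 \<Omega> u * norm1 \<Omega> v + Ke * norm c * norm0 \<Omega> u"
      by (intro add_mono K0(2) Ke(2) u v)
    also have "\<dots> \<le> K * norm0 \<Omega> u * ((1 + norm1 \<Omega> e / d) * p) + Ke * (p / d) * norm0 \<Omega> u"
      using K0(1) Ke(1) nv c by (intro add_mono mult_left_mono mult_right_mono) auto
    also have "\<dots> = K' * norm0 \<Omega> u * p" by (simp add: K'_def algebra_simps)
    finally show ?thesis by (simp add: p_def)
  qed
  moreover have "K' \<ge> 0" using K0(1) Ke(1) d(1) e0 by (simp add: K'_def)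
  ultimately have "weakly_bounded (extend V e) K'"
    unfolding weakly_bounded_def extend_def by blast
  then show ?thesis ..
qed

lemma box_indicator_L2:
  assumes "A \<in> rational_boxes"
  shows "(\<lambda>x. complex_of_real (indicator A x)) \<in> L2 (lebesgue_on \<Omega>)"
proof -
  interpret finite_measure "lebesgue_on \<Omega>"
    using \<Omega> by (intro finite_measure_lebesgue_on lmeasurable_open)
  have "A \<in> sets lebesgue" using assms by (auto simp: rational_boxes_def intro!: open_lebesgue)
  then have m: "(\<lambda>x. complex_of_real (indicator A x)) \<in> borel_measurable (lebesgue_on \<Omega>)"
    by (intro measurable_restrict_space1 measurable_compose[OF borel_measurable_indicator]
        borel_measurable_continuous_onI continuous_intros)
  show ?thesis
    by (rule L2_dominated[OF m, of "\<lambda>x. 1"]) (auto simp: indicator_def)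
qed

text \<open>\<open>e\<close> is the weak solution of \<open>(1 - \<Delta>) e = indicator A\<close>
  with Neumann boundary condition. Its product with \<open>v\<close> is an integral of the real part
  of \<open>v\<close>, so it is controlled without derivatives of \<open>v\<close>.\<close>

lemma Riesz_box:
  assumes A: "A \<in> rational_boxes"
  obtains e where "e \<in> H1" "\<And>v. v \<in> H1 \<Longrightarrow> ip1 \<Omega> v e
      = ip (lebesgue_on \<Omega>) v (\<lambda>x. complex_of_real (indicator A x))"
proof -
  let ?M = "lebesgue_on \<Omega>" let ?b = "\<lambda>x. complex_of_real (indicator A x)"
  note bL = box_indicator_L2[OF A]
  have L: "v \<in> L2 ?M" if "v \<in> H1" for v using sobolev1_D(1)[OF \<Omega>(1) that] .
  obtain w where w: "w \<in> H1" "\<And>v. v \<in> H1 \<Longrightarrow> ip1 \<Omega> w v = ip ?M v ?b"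
  proof (rule h.Riesz_on_subspace[of H1 "\<lambda>v. ip ?M v ?b" "L2_norm ?M ?b"])
    show "\<exists>w\<in>H1. (\<lambda>n. norm1 \<Omega> (\<lambda>x. X n x - w x)) \<longlonglongrightarrow> 0"
      if "\<And>n. X n \<in> H1" "\<And>e. 0 < e \<Longrightarrow> \<exists>M. \<forall>m\<ge>M. \<forall>n\<ge>M. norm1 \<Omega> (\<lambda>x. X m x - X n x) < e"
          for X :: "nat \<Rightarrow> _"
      by (rule sobolev1_complete[OF \<Omega> that])
    show "ip ?M (\<lambda>x. u x + v x) ?b = ip ?M u ?b + ip ?M v ?b" if "u \<in> H1" "v \<in> H1" for u v
      by (rule l2.add_left[OF L[OF that(1)] L[OF that(2)] bL])
    show "ip ?M (\<lambda>x. of_real r * u x) ?b = r * ip ?M u ?b" if "u \<in> H1" for r u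
      by (rule l2.real_left[OF L[OF that] bL])
    show "\<bar>ip ?M u ?b\<bar> \<le> L2_norm ?M ?b * norm1 \<Omega> u" if "u \<in> H1" for u
    proof -
      have "\<bar>ip ?M u ?b\<bar> \<le> norm0 \<Omega> u * L2_norm ?M ?b" by (rule ip_bound[OF L[OF that] bL])
      also have "\<dots> \<le> norm1 \<Omega> u * L2_norm ?M ?b" by (intro mult_right_mono norm1_ge) simp
      finally show ?thesis by (simp add: mult.commute)
    qed
  qed (auto intro: h.zero_mem h.add_mem h.scale_mem)
  show ?thesis
    by (rule that[OF w(1)]) (use w h.sym in auto)
qed

text \<open>Pairing with \<open>c * e n\<close> is an \<open>L2\<close> pairing with a multiple of
  an indicator, hence the bound by \<open>norm0\<close>. If all these pairings vanish, so do the
  integrals of \<open>u\<close> over all rational boxes, and \<open>u\<close> is zero almost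
  everywhere.\<close>

lemma spanning_sequence:
  obtains e :: "nat \<Rightarrow> real^'n \<Rightarrow> complex" where
    "\<And>n. e n \<in> H1" "\<And>n. \<exists>K\<ge>0. \<forall>u\<in>H1. \<forall>c. \<bar>ip1 \<Omega> u (\<lambda>x. c * e n x)\<bar> \<le> K * norm c * norm0 \<Omega> u"
    "\<And>u. u \<in> H1 \<Longrightarrow> \<forall>n c. ip1 \<Omega> u (\<lambda>x. c * e n x) = 0 \<Longrightarrow> norm1 \<Omega> u = 0"
proof -
  let ?M = "lebesgue_on \<Omega>" let ?b = "\<lambda>A x. complex_of_real (indicator A x)"
  have "box 0 0 \<in> (rational_boxes :: (real^'n) set set)"
    unfolding rational_boxes_def by (intro CollectI exI[of _ 0]) auto
  then have ne: "(rational_boxes :: (real^'n) set set) \<noteq> {}" by blast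
  define A where "A = from_nat_into (rational_boxes :: (real^'n) set set)"
  have A: "A n \<in> rational_boxes" for n unfolding A_def by (rule from_nat_into[OF ne])
  have "\<exists>e. e \<in> H1 \<and> (\<forall>v\<in>H1. ip1 \<Omega> v e = ip ?M v (?b (A n)))" for n
  proof -
    obtain p where "p \<in> H1" "\<And>v. v \<in> H1 \<Longrightarrow> ip1 \<Omega> v p = ip ?M v (?b (A n))"
      by (rule Riesz_box[OF A[of n]], rule that)
    then show ?thesis by (intro exI[of _ p]) simp
  qed
  then have "\<forall>n. \<exists>e. e \<in> H1 \<and> (\<forall>v\<in>H1. ip1 \<Omega> v e = ip ?M v (?b (A n)))" ..
  from choice[OF this] obtain e where "\<forall>n. e n \<in> H1 \<and> (\<forall>v\<in>H1. ip1 \<Omega> v (e n)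
      = ip ?M v (?b (A n)))" ..
  then have e: "e n \<in> H1" "v \<in> H1 \<Longrightarrow> ip1 \<Omega> v (e n) = ip ?M v (?b (A n))" for n v by simp_all
  have L: "v \<in> L2 ?M" if "v \<in> H1" for v using sobolev1_D(1)[OF \<Omega>(1) that] .
  \<comment> \<open>Multiplying \<open>e n\<close> by \<open>\<i>\<close> turns the real part of the
    integral into the imaginary one, which is why orthogonality is stated for all
    \<open>c\<close>.\<close>
  have ipc: "ip1 \<Omega> u (\<lambda>x. c * e n x) = ip ?M (\<lambda>x. cnj c * u x) (?b (A n))" if u: "u \<in> H1" for u c n
    using h.cnj_left[OF u e(1)[of n], of "cnj c"] e(2)[OF h.scale_mem[OF u, of "cnj c"], of n]
        by simp
  show ?thesis
  proof (rule that[of e])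
    show "e n \<in> H1" for n by (rule e)
    show "\<exists>K\<ge>0. \<forall>u\<in>H1. \<forall>c. \<bar>ip1 \<Omega> u (\<lambda>x. c * e n x)\<bar> \<le> K * norm c * norm0 \<Omega> u" for n
    proof (intro exI[of _ "L2_norm ?M (?b (A n))"] conjI ballI allI)
      fix u :: "real^'n \<Rightarrow> complex" and c assume u: "u \<in> H1"
      have "\<bar>ip1 \<Omega> u (\<lambda>x. c * e n x)\<bar> \<le> L2_norm ?M (\<lambda>x. cnj c * u x) * L2_norm ?M (?b (A n))"
        unfolding ipc[OF u] by (rule ip_bound[OF L2_scale[OF L[OF u]] box_indicator_L2[OF A]])
      also have "L2_norm ?M (\<lambda>x. cnj c * u x) = norm c * norm0 \<Omega> u"
          by (simp add: L2_norm_scale[OF L[OF u]])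
      finally show "\<bar>ip1 \<Omega> u (\<lambda>x. c * e n x)\<bar> \<le> L2_norm ?M (?b (A n)) * norm c * norm0 \<Omega> u"
        by (simp add: mult_ac)
    qed simp
    fix u assume u: "u \<in> H1" and orth: "\<forall>n c. ip1 \<Omega> u (\<lambda>x. c * e n x) = 0"
    have fin: "finite_measure ?M" using \<Omega> by (intro finite_measure_lebesgue_on lmeasurable_open)
    have OL: "\<Omega> \<in> sets lebesgue" by (rule open_lebesgue[OF \<Omega>(1)])
    have iu: "integrable ?M u" by (rule L2_integrable(1)[OF fin L[OF u]])
    have iu': "integrable lebesgue (\<lambda>x. indicator \<Omega> x *\<^sub>R u x)"
      using iu OL by (simp add: integrable_restrict_space)
    have "AE x in lebesgue. indicator \<Omega> x *\<^sub>R u x = 0"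
    proof (rule AE_zero_if_rational_boxes[OF iu'])
      fix Q :: "(real^'n) set" assume Q: "Q \<in> rational_boxes"
      then obtain n where n: "Q = A n" using from_nat_into_surj[OF countable_rational_boxes Q]
          by (auto simp: A_def)
      have QL: "Q \<in> sets lebesgue" using Q by (auto simp: rational_boxes_def intro!: open_lebesgue)
      have iQ: "integrable ?M (\<lambda>x. indicator Q x *\<^sub>R u x)"
        using L2_integrable_mult[OF box_indicator_L2[OF Q] L[OF u]]
            by (simp add: scaleR_conv_of_real)
      have "(\<integral>x. Re (indicator Q x *\<^sub>R u x) \<partial>?M) = ip1 \<Omega> u (\<lambda>x. 1 * e n x)"
        unfolding ipc[OF u] ip_def n by (simp add: inner_complex_def mult.commute)
      then have R: "Re (\<integral>x. indicator Q x *\<^sub>R u x \<partial>?M) = 0"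
          using orth[rule_format, where n = n and c = 1] integral_Re[OF iQ] by simp
      have "(\<integral>x. Im (indicator Q x *\<^sub>R u x) \<partial>?M) = ip1 \<Omega> u (\<lambda>x. \<i> * e n x)"
        unfolding ipc[OF u] ip_def n by (simp add: inner_complex_def mult.commute)
      then have "Im (\<integral>x. indicator Q x *\<^sub>R u x \<partial>?M) = 0"
          using orth[rule_format, where n = n and c = "\<i>"] integral_Im[OF iQ] by simp
      with R have "(\<integral>x. indicator Q x *\<^sub>R u x \<partial>?M) = 0" by (simp add: complex_eq_iff)
      then show "(\<integral>x. indicator Q x *\<^sub>R (indicator \<Omega> x *\<^sub>R u x) \<partial>lebesgue) = 0"
        using OL by (simp add: integral_restrict_space mult.commute)
    qed
    then have ae: "AE x in ?M. u x = 0"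
      unfolding AE_lebesgue_on_iff[OF OL] by eventually_elim (auto simp: indicator_def)
    have z: "has_weak_partial \<Omega> j (\<lambda>x. 0) (\<lambda>x. 0 :: complex)" for j
      by (auto simp: has_weak_partial_def loc_integrable_def)
    have "has_weak_partial \<Omega> j u (\<lambda>x. 0)" for j
      by (rule has_weak_partial_cong[OF \<Omega>(1) z]) (use ae in auto)
    from weak_partial_eq[OF \<Omega>(1) this] have "AE x in ?M. weak_partial \<Omega> j u x = 0" for j
      by (rule AE_mp) (auto)
    then have "L2_norm ?M (weak_partial \<Omega> j u) = 0" for j
      using L2_norm_zero_AE[OF sobolev1_D(3)[OF \<Omega>(1) u]] by blast
    moreover have "norm0 \<Omega> u = 0" using L2_norm_zero_AE[OF L[OF u]] ae by blast
    ultimately show "norm1 \<Omega> u = 0" by (simp add: norm1_def)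
  qed
qed

text \<open>\<open>V n\<close> is the null space enlarged by the first \<open>n\<close> functions of
  the spanning sequence. For density, \<open>u\<close> is projected onto the closure of the union:
  the remainder is orthogonal to the whole sequence and so has norm zero.\<close>

lemma exhausting_subspaces:
  obtains V :: "nat \<Rightarrow> (real^'n \<Rightarrow> complex) set" and K :: "nat \<Rightarrow> real" where
    "\<And>n. closed_subspace1 \<Omega> (V n)" "\<And>n. V n \<subseteq> V (Suc n)" "\<And>n. weakly_bounded (V n) (K n)" "K 0 = 0"
    "closure1 \<Omega> (\<Union>n. V n) = H1"
proof -
  obtain e :: "nat \<Rightarrow> real^'n \<Rightarrow> complex" where e: "\<And>n. e n \<in> H1"
    "\<And>n. \<exists>K\<ge>0. \<forall>u\<in>H1. \<forall>c. \<bar>ip1 \<Omega> u (\<lambda>x. c * e n x)\<bar> \<le> K * norm c * norm0 \<Omega> u"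
    "\<And>u. u \<in> H1 \<Longrightarrow> \<forall>n c. ip1 \<Omega> u (\<lambda>x. c * e n x) = 0 \<Longrightarrow> norm1 \<Omega> u = 0"
    by (rule spanning_sequence, rule that)
  \<comment> \<open>A function already contained is skipped, since \<open>extend_closed\<close>
    relies on its positive distance from the space.\<close>
  define V where "V = rec_nat null_space (\<lambda>n W. if e n \<in> W then W else extend W (e n))"
  have V0: "V 0 = null_space" and VS: "V (Suc n)
      = (if e n \<in> V n then V n else extend (V n) (e n))" for n
    by (simp_all add: V_def)
  have good: "closed_subspace1 \<Omega> (V n) \<and> (\<exists>K. weakly_bounded (V n) K)" for n
  proof (induction n)
    case 0
    then show ?case using null_space_closed null_space_bounded V0 by auto
  next
    case (Suc n)
    then obtain K where K: "closed_subspace1 \<Omega> (V n)" "weakly_bounded (V n) K" by blast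
    obtain Ke where Ke: "Ke \<ge> 0" "\<And>u c. u \<in> H1
        \<Longrightarrow> \<bar>ip1 \<Omega> u (\<lambda>x. c * e n x)\<bar> \<le> Ke * norm c * norm0 \<Omega> u"
      using e(2)[of n] by blast
    show ?case
    proof (cases "e n \<in> V n")
      case True
      then show ?thesis using K by (auto simp: VS)
    next
      case False
      then show ?thesis
        using extend_closed[OF K(1) e(1) False] extend_bounded[OF K(1) e(1) False K(2) Ke]
            by (simp add: VS)
    qed
  qed
  \<comment> \<open>The value \<open>0\<close> at index \<open>0\<close> belongs to the null space;
    it makes this index admissible however small \<open>k > 0\<close> is.\<close>
  define K where "K n = (if n = 0 then 0 else SOME K. weakly_bounded (V n) K)" for n
  have KV: "weakly_bounded (V n) (K n)" for n
    using null_space_bounded V0 good[of n] by (auto simp: K_def intro: someI)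
  note VD = closed_subspace1D[OF good[THEN conjunct1]]
  have ext: "W \<subseteq> extend W a" for W a
  proof
    fix p assume "p \<in> W"
    then show "p \<in> extend W a"
      unfolding extend_def by (intro CollectI exI[of _ p] exI[of _ 0]) simp
  qed
  have mono1: "V n \<subseteq> V (Suc n)" for n using ext by (auto simp: VS)
  then have mono: "V m \<subseteq> V n" if "m \<le> n" for m n using lift_Suc_mono_le[of V] that by blast
  have eV: "e n \<in> V (Suc n)" for n
  proof (cases "e n \<in> V n")
    case False
    have "e n \<in> extend (V n) (e n)" unfolding extend_def using VD(2)[of n]
        by (intro CollectI exI[of _ "\<lambda>x. 0"] exI[of _ 1]) auto
    then show ?thesis using False by (simp add: VS)
  qed (simp add: VS)
  let ?W = "\<Union>n. V n"
  have WH: "?W \<subseteq> H1" using VD(1) by blast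
  have "H1 \<subseteq> closure1 \<Omega> ?W"
  proof
    fix u assume u: "u \<in> H1"
    obtain w where w: "w \<in> H1" "\<And>r. r > 0 \<Longrightarrow> \<exists>v\<in>?W. norm1 \<Omega> (\<lambda>x. w x - v x) < r"
      "\<And>v. v \<in> ?W \<Longrightarrow> ip1 \<Omega> w v = ip1 \<Omega> u v"
    proof (rule h.Riesz_on_subspace[of ?W "ip1 \<Omega> u" "norm1 \<Omega> u"])
      show "\<exists>w\<in>H1. (\<lambda>n. norm1 \<Omega> (\<lambda>x. X n x - w x)) \<longlonglongrightarrow> 0"
        if "\<And>n. X n \<in> H1" "\<And>e. 0 < e \<Longrightarrow> \<exists>M. \<forall>m\<ge>M. \<forall>n\<ge>M. norm1 \<Omega> (\<lambda>x. X m x - X n x) < e"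
            for X :: "nat \<Rightarrow> _"
        by (rule sobolev1_complete[OF \<Omega> that])
      show "?W \<subseteq> H1" by (rule WH)
      show "(\<lambda>x. 0) \<in> ?W" using VD(2) by blast
      show "(\<lambda>x. p x + q x) \<in> ?W" if "p \<in> ?W" "q \<in> ?W" for p q
      proof -
        from that obtain m n where "p \<in> V m" "q \<in> V n" by blast
        then have "p \<in> V (max m n)" "q \<in> V (max m n)"
            using mono[of m "max m n"] mono[of n "max m n"] by auto
        then show ?thesis using VD(3) by blast
      qed
      show "(\<lambda>x. of_real r * p x) \<in> ?W" if "p \<in> ?W" for r p using that VD(4) by blast
      show "ip1 \<Omega> u (\<lambda>x. p x + q x) = ip1 \<Omega> u p + ip1 \<Omega> u q" if "p \<in> ?W" "q \<in> ?W" for p q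
        using that WH u by (intro h.add_right) blast+
      show "ip1 \<Omega> u (\<lambda>x. of_real r * p x) = r * ip1 \<Omega> u p" if "p \<in> ?W" for r p
        using that WH u by (intro h.real_right) blast+
      show "\<bar>ip1 \<Omega> u p\<bar> \<le> norm1 \<Omega> u * norm1 \<Omega> p" if "p \<in> ?W" for p
        using that WH u by (intro h.Cauchy_Schwarz) blast+
    qed (rule that)
    have d: "(\<lambda>x. u x - w x) \<in> H1" by (rule h.diff_mem[OF u w(1)])
    have "norm1 \<Omega> (\<lambda>x. u x - w x) = 0"
    proof (rule e(3)[OF d], intro allI)
      fix n c
      have "(\<lambda>x. c * e n x) \<in> ?W" using VD(4)[OF eV] by blast
      then show "ip1 \<Omega> (\<lambda>x. u x - w x) (\<lambda>x. c * e n x) = 0"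
        using w(3) h.diff_left[OF u w(1) h.scale_mem[OF e(1)]] by simp
    qed
    then have "\<exists>v\<in>?W. norm1 \<Omega> (\<lambda>x. u x - v x) < r" if r: "r > 0" for r
    proof -
      obtain v where v: "v \<in> ?W" "norm1 \<Omega> (\<lambda>x. w x - v x) < r" using w(2)[OF r] by blast
      then have vH: "v \<in> H1" using WH by blast
      have "norm1 \<Omega> (\<lambda>x. u x - v x) < r"
        using h.nrm_triangle_diff[OF u w(1) vH] v(2) \<open>norm1 \<Omega> (\<lambda>x. u x - w x) = 0\<close> by simp
      then show ?thesis using v(1) by blast
    qed
    then show "u \<in> closure1 \<Omega> ?W" using u unfolding closure1_def by blast
  qed
  then have "closure1 \<Omega> ?W = H1" using closure1_subset by blast
  moreover have "K 0 = 0" by (simp add: K_def)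
  ultimately show ?thesis using that[of V K] good KV mono1 by blast
qed

section \<open>The distance from a subspace as a semi-norm\<close>

definition dist1 :: "(real^'n \<Rightarrow> complex) set \<Rightarrow> (real^'n \<Rightarrow> complex) \<Rightarrow> real" where
  "dist1 V u = Inf ((\<lambda>v. norm1 \<Omega> (\<lambda>x. u x - v x)) ` V)"

lemma dist1_le: "V \<subseteq> H1 \<Longrightarrow> u \<in> H1 \<Longrightarrow> v \<in> V \<Longrightarrow> dist1 V u \<le> norm1 \<Omega> (\<lambda>x. u x - v x)"
  unfolding dist1_def by (rule cInf_lower) (auto intro!: bdd_belowI[of _ 0] h.nrm_nonneg h.diff_mem)

lemma dist1_approx:
  assumes "closed_subspace1 \<Omega> V" "r > 0"
  shows "\<exists>v\<in>V. norm1 \<Omega> (\<lambda>x. u x - v x) < dist1 V u + r"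
proof -
  have "(\<lambda>v. norm1 \<Omega> (\<lambda>x. u x - v x)) ` V \<noteq> {}" using closed_subspace1D(2)[OF assms(1)] by blast
  from cInf_lessD[OF this, of "dist1 V u + r"] show ?thesis using assms(2) by (auto simp: dist1_def)
qed

lemma dist1_nonneg:
  assumes V: "closed_subspace1 \<Omega> V" and u: "u \<in> H1" shows "0 \<le> dist1 V u"
  unfolding dist1_def using closed_subspace1D(1,2)[OF V] u
  by (intro cInf_greatest) (auto intro!: h.nrm_nonneg h.diff_mem)

lemma dist1_zero: 
  assumes V: "closed_subspace1 \<Omega> V" and u: "u \<in> V" shows "dist1 V u = 0"
proof -
  have uH: "u \<in> H1" using closed_subspace1D(1)[OF V] u by blast
  have "dist1 V u \<le> 0" using dist1_le[OF closed_subspace1D(1)[OF V] uH u] by simp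
  then show ?thesis using dist1_nonneg[OF V uH] by simp
qed

lemma dist1_antimono:
  assumes V: "closed_subspace1 \<Omega> V" and V': "closed_subspace1 \<Omega> V'" and sub: "V \<subseteq> V'" and u:
      "u \<in> H1"
  shows "dist1 V' u \<le> dist1 V u"
proof (rule field_le_epsilon)
  fix r :: real assume "r > 0"
  then obtain v where "v \<in> V" "norm1 \<Omega> (\<lambda>x. u x - v x) < dist1 V u + r" using dist1_approx[OF V]
      by blast
  then show "dist1 V' u \<le> dist1 V u + r"
    using dist1_le[OF closed_subspace1D(1)[OF V'] u, of v] sub by auto
qed

lemma dist1_scale_le:
  assumes V: "closed_subspace1 \<Omega> V" and u: "u \<in> H1"
  shows "dist1 V (\<lambda>x. c * u x) \<le> norm c * dist1 V u"
proof -
  have "dist1 V (\<lambda>x. c * u x) - norm c * dist1 V u \<le> norm c * r" if r: "r > 0" for r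
  proof -
    obtain v where v: "v \<in> V" "norm1 \<Omega> (\<lambda>x. u x - v x) < dist1 V u + r"
        using dist1_approx[OF V r] by blast
    have vH: "v \<in> H1" using v closed_subspace1D(1)[OF V] by blast
    have "dist1 V (\<lambda>x. c * u x) \<le> norm1 \<Omega> (\<lambda>x. c * u x - c * v x)"
      by (rule dist1_le[OF closed_subspace1D(1)[OF V] h.scale_mem[OF u] closed_subspace1D(4)[OF V
          v(1)]])
    also have "\<dots> = norm c * norm1 \<Omega> (\<lambda>x. u x - v x)"
      using h.nrm_scale[OF h.diff_mem[OF u vH], of c] by (simp add: right_diff_distrib)
    also have "\<dots> \<le> norm c * (dist1 V u + r)" using v(2) by (intro mult_left_mono) auto
    finally show ?thesis by (simp add: algebra_simps)
  qed
  from nonpos_if_le_all_multiples[OF this] show ?thesis by simp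
qed

lemma dist1_seminorm:
  assumes V: "closed_subspace1 \<Omega> V" shows "seminorm1 \<Omega> (dist1 V)"
  unfolding seminorm1_def
proof (intro conjI ballI allI)
  show "0 \<le> dist1 V u" if "u \<in> H1" for u by (rule dist1_nonneg[OF V that])
  note VD = closed_subspace1D[OF V]
  fix u assume u: "u \<in> H1"
  show "dist1 V (\<lambda>x. u x + v x) \<le> dist1 V u + dist1 V v" if v: "v \<in> H1" for v
  proof (rule field_le_epsilon)
    fix r :: real assume "r > 0"
    then have r: "r / 2 > 0" by simp
    obtain a b where ab: "a \<in> V" "norm1 \<Omega> (\<lambda>x. u x - a x) < dist1 V u + r / 2"
      "b \<in> V" "norm1 \<Omega> (\<lambda>x. v x - b x) < dist1 V v + r / 2"
      using dist1_approx[OF V r] by blast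
    have H: "a \<in> H1" "b \<in> H1" using ab VD(1) by auto
    have "dist1 V (\<lambda>x. u x + v x) \<le> norm1 \<Omega> (\<lambda>x. (u x + v x) - (a x + b x))"
      by (rule dist1_le[OF VD(1) h.add_mem[OF u v] VD(3)[OF ab(1,3)]])
    also have "(\<lambda>x. (u x + v x) - (a x + b x)) = (\<lambda>x. (u x - a x) + (v x - b x))"
        by (simp add: fun_eq_iff)
    also have "norm1 \<Omega> \<dots> \<le> norm1 \<Omega> (\<lambda>x. u x - a x) + norm1 \<Omega> (\<lambda>x. v x - b x)"
      by (rule h.nrm_triangle[OF h.diff_mem[OF u H(1)] h.diff_mem[OF v H(2)]])
    finally show "dist1 V (\<lambda>x. u x + v x) \<le> dist1 V u + dist1 V v + r" using ab by simp
  qed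
next
  fix c and u assume u: "u \<in> H1"
  note VD = closed_subspace1D[OF V]
  show "dist1 V (\<lambda>x. c * u x) = norm c * dist1 V u"
  proof (cases "c = 0")
    case True
    then show ?thesis using dist1_zero[OF V VD(2)] by simp
  next
    case False
    \<comment> \<open>The reverse inequality is \<open>dist1_scale_le\<close> applied to
      \<open>c u\<close> with the factor \<open>1 / c\<close>.\<close>
    have "dist1 V (\<lambda>x. (1 / c) * (c * u x)) \<le> norm (1 / c) * dist1 V (\<lambda>x. c * u x)"
      by (rule dist1_scale_le[OF V h.scale_mem[OF u]])
    then have "norm c * dist1 V u \<le> dist1 V (\<lambda>x. c * u x)"
      using False by (simp add: norm_divide field_simps)
    then show ?thesis using dist1_scale_le[OF V u, of c] by simp
  qed
qed

text \<open>For \<open>v\<close> in \<open>V\<close> close to \<open>u\<close>, the squared norm of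
  \<open>v\<close> is its product with \<open>u\<close>, controlled by \<open>norm0\<close>, minus
  that with \<open>u - v\<close>. After cancelling one norm, \<open>v\<close> is bounded by
  \<open>K * norm0 \<Omega> u\<close> plus its distance from \<open>u\<close>. Returning from
  \<open>v\<close> to \<open>u\<close> costs the distance once more, hence the factor
  \<open>2\<close>.\<close>

lemma norm1_le_dist1:
  assumes V: "closed_subspace1 \<Omega> V" and K: "weakly_bounded V K" and u: "u \<in> H1"
  shows "norm1 \<Omega> u \<le> 2 * dist1 V u + K * norm0 \<Omega> u"
proof -
  have "norm1 \<Omega> u - (2 * dist1 V u + K * norm0 \<Omega> u) \<le> 2 * r" if r: "r > 0" for r
  proof -
    obtain v where v: "v \<in> V" "norm1 \<Omega> (\<lambda>x. u x - v x) < dist1 V u + r"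
        using dist1_approx[OF V r] by blast
    have vH: "v \<in> H1" using v closed_subspace1D(1)[OF V] by blast
    have dH: "(\<lambda>x. u x - v x) \<in> H1" by (rule h.diff_mem[OF u vH])
    have K0: "K \<ge> 0" "\<bar>ip1 \<Omega> u v\<bar> \<le> K * norm0 \<Omega> u * norm1 \<Omega> v"
      using K u v(1) by (auto simp: weakly_bounded_def)
    have n: "0 \<le> norm1 \<Omega> v" "0 \<le> norm1 \<Omega> (\<lambda>x. u x - v x)" using h.nrm_nonneg vH dH by auto
    have "(norm1 \<Omega> v)\<^sup>2 = ip1 \<Omega> u v - ip1 \<Omega> (\<lambda>x. u x - v x) v"
      using h.nrm_sq[OF vH] h.diff_left[OF u vH vH] by simp
    also have "\<dots> \<le> K * norm0 \<Omega> u * norm1 \<Omega> v + norm1 \<Omega> (\<lambda>x. u x - v x) * norm1 \<Omega> v"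
      using K0(2) h.Cauchy_Schwarz[OF dH vH] by linarith
    finally have "norm1 \<Omega> v * norm1 \<Omega> v \<le> (K * norm0 \<Omega> u + norm1 \<Omega> (\<lambda>x. u x - v x)) * norm1 \<Omega> v"
      by (simp add: power2_eq_square algebra_simps)
    then have "norm1 \<Omega> v \<le> K * norm0 \<Omega> u + norm1 \<Omega> (\<lambda>x. u x - v x)"
      using n K0(1) by (cases "norm1 \<Omega> v = 0") (auto simp: mult_le_cancel_right)
    then show ?thesis using h.nrm_le_diff_add[OF u vH] v(2) by linarith
  qed
  from nonpos_if_le_all_multiples[OF this] show ?thesis by simp
qed

end

context bounded_open
begin

text \<open>The index of the exhausting subspace used for \<open>k\<close> grows so slowly that its constant stays
  below a small multiple of \<open>k\<close>.\<close>

theorem approximating_family: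
  assumes C: "C \<ge> 0"
  obtains W :: "real \<Rightarrow> (real^'n \<Rightarrow> complex) set" where
    "\<And>k. k > 0 \<Longrightarrow> closed_subspace1 \<Omega> (W k)" "\<And>k k'. 0 < k \<Longrightarrow> k \<le> k' \<Longrightarrow> W k \<subseteq> W k'"
    "closure1 \<Omega> (\<Union>k\<in>{0<..}. W k) = sobolev 1 \<Omega>"
    "\<And>k u. k > 0 \<Longrightarrow> u \<in> sobolev 1 \<Omega> \<Longrightarrow> C * norm1 \<Omega> u \<le> 2 * C * dist1 (W k) u + k / 2 * norm0 \<Omega> u"
proof -
  obtain V :: "nat \<Rightarrow> (real^'n \<Rightarrow> complex) set" and K :: "nat \<Rightarrow> real" where
    V: "\<And>n. closed_subspace1 \<Omega> (V n)" "\<And>n. V n \<subseteq> V (Suc n)" "\<And>n. weakly_bounded (V n) (K n)" "K 0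
        = 0"
    "closure1 \<Omega> (\<Union>n. V n) = H1"
    by (rule exhausting_subspaces, rule that)
  have mono: "V m \<subseteq> V n" if "m \<le> n" for m n using lift_Suc_mono_le[of V, OF V(2) that] .
  \<comment> \<open>Admissible indices for \<open>k\<close>: the first condition makes the set
    finite, the second gives \<open>C * K (idx k) \<le> k / 2\<close>. Both relax as
    \<open>k\<close> grows, so the largest index is monotone.\<close>
  define M where "M k = {m. real m \<le> k \<and> (\<forall>i\<le>m. 2 * C * K i \<le> k)}" for k
  have fin: "finite (M k)" for k
    by (rule finite_subset[of _ "{..nat \<lfloor>k\<rfloor>}"]) (auto simp: M_def le_nat_floor)
  have M0: "0 \<in> M k" if "k > 0" for k using that V(4) by (simp add: M_def)
  define idx where "idx k = Max (M k)" for k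
  have idxM: "idx k \<in> M k" if "k > 0" for k
    unfolding idx_def using fin M0[OF that] by (intro Max_in) auto
  have idx_mono: "idx k \<le> idx k'" if "0 < k" "k \<le> k'" for k k'
    unfolding idx_def
  proof (rule Max_mono)
    show "M k \<subseteq> M k'" using that(2) by (auto simp: M_def intro: order_trans)
    show "M k \<noteq> {}" using M0[OF that(1)] by blast
  qed (rule fin)
  define W where "W k = V (idx k)" for k
  show ?thesis
  proof (rule that[of W])
    show "closed_subspace1 \<Omega> (W k)" for k unfolding W_def by (rule V(1))
    show "W k \<subseteq> W k'" if "0 < k" "k \<le> k'" for k k' unfolding W_def using idx_mono[OF that]
        by (rule mono)
    have "(\<Union>k\<in>{0<..}. W k) = (\<Union>n. V n)"
    proof
      show "(\<Union>n. V n) \<subseteq> (\<Union>k\<in>{0<..}. W k)"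
      proof
        fix u assume "u \<in> (\<Union>n. V n)"
        then obtain n where n: "u \<in> V n" by blast
        \<comment> \<open>Large enough for the index \<open>n\<close> to satisfy both conditions, so
          every \<open>V n\<close> is reached by some \<open>k\<close>.\<close>
        define k where "k = 1 + real n + (\<Sum>i\<le>n. \<bar>2 * C * K i\<bar>)"
        have s: "0 \<le> (\<Sum>i\<le>n. \<bar>2 * C * K i\<bar>)" by (simp add: sum_nonneg)
        have k: "k > 0" "real n \<le> k" using s unfolding k_def by linarith+
        have "2 * C * K i \<le> k" if "i \<le> n" for i
        proof -
          have "\<bar>2 * C * K i\<bar> \<le> (\<Sum>i\<le>n. \<bar>2 * C * K i\<bar>)" using that by (intro member_le_sum) auto
          then show ?thesis using abs_ge_self[of "2 * C * K i"] unfolding k_def by linarith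
        qed
        then have "n \<in> M k" using k(2) by (simp add: M_def)
        then have "n \<le> idx k" unfolding idx_def by (rule Max_ge[OF fin])
        then have "u \<in> W k" unfolding W_def using mono n by blast
        then show "u \<in> (\<Union>k\<in>{0<..}. W k)" using k(1) by blast
      qed
    qed (auto simp: W_def)
    then show "closure1 \<Omega> (\<Union>k\<in>{0<..}. W k) = sobolev 1 \<Omega>" using V(5) by simp
    fix k u assume k: "k > (0::real)" and u: "u \<in> sobolev 1 \<Omega>"
    have "C * norm1 \<Omega> u \<le> C * (2 * dist1 (W k) u + K (idx k) * norm0 \<Omega> u)"
      unfolding W_def by (intro mult_left_mono norm1_le_dist1 V u C)
    also have "\<dots> = 2 * C * dist1 (W k) u + C * K (idx k) * norm0 \<Omega> u" by (simp add: algebra_simps)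
    also have "C * K (idx k) * norm0 \<Omega> u \<le> k / 2 * norm0 \<Omega> u"
      using idxM[OF k] by (intro mult_right_mono) (auto simp: M_def)
    finally show "C * norm1 \<Omega> u \<le> 2 * C * dist1 (W k) u + k / 2 * norm0 \<Omega> u" by simp
  qed
qed

end

section \<open>From the coefficient hypotheses to the two estimates\<close>

lemma Linf_uniform_bound:
  assumes "finite I" "\<And>i. i \<in> I \<Longrightarrow> g i \<in> Linf M"
  shows "\<exists>B\<ge>0. \<forall>i\<in>I. AE x in M. norm (g i x) \<le> B"
  using assms
proof (induction I)
  case (insert i I)
  then obtain B where B: "B \<ge> 0" "\<forall>i\<in>I. AE x in M. norm (g i x) \<le> B" by auto
  obtain b where b: "AE x in M. norm (g i x) \<le> b" using insert by (auto simp: Linf_def)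
  have "AE x in M. norm (g i x) \<le> max b B" using b by eventually_elim simp
  moreover have "AE x in M. norm (g l x) \<le> max b B" if "l \<in> I" for l
    using B(2)[rule_format, OF that] by eventually_elim simp
  ultimately show ?case using B(1) by (intro exI[of _ "max b B"]) auto
qed auto

lemma ex_elliptic:
  fixes \<Omega> :: "(real^'n) set"
  assumes \<Omega>: "open \<Omega>" "bounded \<Omega>" and a2: "\<And>j m. a2 j m \<in> Linf (lebesgue_on \<Omega>)"
    and da: "\<And>p j m. \<exists>v \<in> Linf (lebesgue_on \<Omega>). has_weak_partial \<Omega> p (a2 j m) v"
    and a1: "\<And>j. a1 j \<in> Linf (lebesgue_on \<Omega>)"
    and a: "a \<in> Linf (lebesgue_on \<Omega>)" and a0: "a0 \<in> Linf (lebesgue_on \<Omega>)"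
  obtains da B where "elliptic \<Omega> a2 da a1 a a0 B"
proof -
  let ?L = "lebesgue_on \<Omega>"
  define da where "da p j m = (SOME v. v \<in> Linf ?L \<and> has_weak_partial \<Omega> p (a2 j m) v)" for p j m
  have d: "da p j m \<in> Linf ?L \<and> has_weak_partial \<Omega> p (a2 j m) (da p j m)" for p j m
  proof -
    have "\<exists>v. v \<in> Linf ?L \<and> has_weak_partial \<Omega> p (a2 j m) v" using da by blast
    from someI_ex[OF this] show ?thesis unfolding da_def .
  qed
  obtain B1 where B1: "B1 \<ge> 0" "\<forall>i\<in>UNIV. AE x in ?L. norm ((case i of (j, m) \<Rightarrow> a2 j m) x) \<le> B1"
    using Linf_uniform_bound[of "UNIV :: ('n \<times> 'n) set" "\<lambda>(j, m). a2 j m" ?L] a2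
        by (auto simp: case_prod_unfold)
  obtain B2 where B2: "B2 \<ge> 0" "\<forall>i\<in>UNIV. AE x in ?L. norm ((case i of (j, m) \<Rightarrow> da j j m) x) \<le> B2"
    using Linf_uniform_bound[of "UNIV :: ('n \<times> 'n) set" "\<lambda>(j, m). da j j m" ?L] d
        by (auto simp: case_prod_unfold)
  obtain B3 where B3: "B3 \<ge> 0" "\<forall>i\<in>UNIV. AE x in ?L. norm (a1 i x) \<le> B3"
    using Linf_uniform_bound[of "UNIV :: 'n set" a1 ?L] a1 by auto
  have ab: "(if i then a else a0) \<in> Linf ?L" for i using a a0 by (cases i) simp_all
  obtain B4 where B4: "B4 \<ge> 0" "\<forall>i\<in>UNIV. AE x in ?L. norm ((if i then a else a0) x) \<le> B4"
    using Linf_uniform_bound[of "UNIV :: bool set" "\<lambda>i. if i then a else a0" ?L] ab by auto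
  define B where "B = B1 + B2 + B3 + B4"
  have up: "AE x in ?L. f x \<le> B" if "AE x in ?L. f x \<le> b" "b \<le> B" for f b
    using that(1) by eventually_elim (use that(2) in linarith)
  have le: "B1 \<le> B" "B2 \<le> B" "B3 \<le> B" "B4 \<le> B" "0 \<le> B" using B1(1) B2(1) B3(1) B4(1)
      by (auto simp: B_def)
  have "elliptic \<Omega> a2 da a1 a a0 B"
  proof
    show "AE x in ?L. \<bar>a2 j m x\<bar> \<le> B" for j m using up[OF B1(2)[rule_format, of
        "(j, m)", simplified] le(1)] by simp
    show "AE x in ?L. \<bar>da j j m x\<bar> \<le> B" for j m
        using up[OF B2(2)[rule_format, of "(j, m)", simplified] le(2)] by simp
    show "AE x in ?L. norm (a1 j x) \<le> B" for j
        using up[OF B3(2)[rule_format, of j, simplified] le(3)] .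
    show "AE x in ?L. norm (a x) \<le> B" using up[OF B4(2)[rule_format, of True, simplified] le(4)] .
    show "AE x in ?L. norm (a0 x) \<le> B" using up[OF B4(2)[rule_format, of False, simplified] le(4)] .
  qed (use \<Omega> a2 d a1 a a0 le in auto)
  then show ?thesis by (rule that)
qed

lemma bdry_norm1_nonneg: "0 \<le> bdry_norm1 \<Omega> \<Gamma> v"
  by (simp add: bdry_norm1_def sum_nonneg)

theorem theorem1p1:
  fixes \<Omega> \<Gamma> :: "(real^'n) set"
    and a2 :: "'n \<Rightarrow> 'n \<Rightarrow> real^'n \<Rightarrow> real"
    and a1 :: "'n \<Rightarrow> real^'n \<Rightarrow> complex"
    and a a0 :: "real^'n \<Rightarrow> complex"
    and \<epsilon>0 E0 :: real
  assumes "open \<Omega>" and "connected \<Omega>" and "bounded \<Omega>" and "C2_boundary \<Omega>"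
    and "openin (top_of_set (frontier \<Omega>)) \<Gamma>" and "\<Gamma> \<noteq> {}"
    and "\<And>j m x. x \<in> \<Omega> \<Longrightarrow> a2 j m x = a2 m j x"
    and "\<epsilon>0 > 0" and "E0 > 0"
    and "\<And>x \<xi>. x \<in> \<Omega> \<Longrightarrow>
           \<epsilon>0 * (norm \<xi>)\<^sup>2 \<le> (\<Sum>j\<in>UNIV. \<Sum>l\<in>UNIV. a2 j l x * \<xi> $ j * \<xi> $ l) \<and>
           (\<Sum>j\<in>UNIV. \<Sum>l\<in>UNIV. a2 j l x * \<xi> $ j * \<xi> $ l) \<le> E0\<^sup>2 * (norm \<xi>)\<^sup>2"
    and "\<And>j m. a2 j m \<in> Linf (lebesgue_on \<Omega>)"
    and "\<And>p j m. \<exists>v \<in> Linf (lebesgue_on \<Omega>). has_weak_partial \<Omega> p (a2 j m) v"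
    and "\<And>j. a1 j \<in> Linf (lebesgue_on \<Omega>)"
    and "a \<in> Linf (lebesgue_on \<Omega>)" and "a0 \<in> Linf (lebesgue_on \<Omega>)"
  shows
    "(\<exists>C::real. \<forall>k>0. \<forall>f u0 u1. \<forall>u \<in> sobolev 2 \<Omega>.
        cauchy_problem \<Omega> \<Gamma> a2 a1 a a0 k f u0 u1 u \<longrightarrow>
        norm0 \<Omega> u \<le> C * (bdry_norm0 \<Gamma> (bdry_trace \<Omega> u) +
          1 / k * (norm0 \<Omega> f + bdry_norm1 \<Omega> \<Gamma> u0 + bdry_norm0 \<Gamma> u1 + norm1 \<Omega> u))) \<and>
     (C2_diffeomorphic \<Omega> (ball 0 1) \<longrightarrow>
       (\<exists>(H1 :: real \<Rightarrow> (real^'n \<Rightarrow> complex) set) (N1 :: real \<Rightarrow> (real^'n \<Rightarrow> complex) \<Rightarrow> real) (C::real).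
          (\<forall>k>0. closed_subspace1 \<Omega> (H1 k)) \<and>
          (\<forall>k k'. 0 < k \<and> k \<le> k' \<longrightarrow> H1 k \<subseteq> H1 k') \<and>
          closure1 \<Omega> (\<Union>k\<in>{0<..}. H1 k) = sobolev 1 \<Omega> \<and>
          (\<forall>k>0. seminorm1 \<Omega> (N1 k)) \<and>
          (\<forall>k>0. \<forall>u \<in> H1 k. N1 k u = 0) \<and>
          (\<forall>k k'. 0 < k \<and> k \<le> k' \<longrightarrow> (\<forall>u \<in> sobolev 1 \<Omega>. N1 k' u \<le> N1 k u)) \<and>
          (\<forall>k>0. \<forall>f u0 u1. \<forall>u \<in> sobolev 2 \<Omega>.
             cauchy_problem \<Omega> \<Gamma> a2 a1 a a0 k f u0 u1 u \<longrightarrow>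
             norm0 \<Omega> u \<le> C * (bdry_norm0 \<Gamma> (bdry_trace \<Omega> u) +
               1 / k * (norm0 \<Omega> f + bdry_norm1 \<Omega> \<Gamma> u0 + bdry_norm0 \<Gamma> u1 + N1 k u)))))"
proof -
  obtain da B where ell: "elliptic \<Omega> a2 da a1 a a0 B"
    by (rule ex_elliptic[OF assms(1,3,11,12,13,14,15)], rule that)
  interpret elliptic \<Omega> a2 da a1 a a0 B by (rule ell)
  interpret bounded_open \<Omega> by unfold_locales (use assms in auto)
  obtain C where C: "C \<ge> 0" "\<And>k f u. k > 0 \<Longrightarrow> solves k f u
      \<Longrightarrow> k * norm0 \<Omega> u \<le> C * (norm0 \<Omega> f + norm1 \<Omega> u)"
    using global_estimate[OF assms(4)] by blast
  have sol: "solves k f u" if "u \<in> sobolev 2 \<Omega>" "cauchy_problem \<Omega> \<Gamma> a2 a1 a a0 k f u0 u1 u"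
      for k f u u0 u1
    using that by (simp only: solves_def cauchy_problem_def)
  have absorb: "norm0 \<Omega> u \<le> c * (bdry_norm0 \<Gamma> b + 1 / k * (norm0 \<Omega> f + bdry_norm1 \<Omega> \<Gamma> u0
      + bdry_norm0 \<Gamma> u1 + N))"
    if "k > 0" "c \<ge> 0" "k * norm0 \<Omega> u \<le> c * (norm0 \<Omega> f + N)" for k c N :: real and u f b u0 u1
  proof -
    have "norm0 \<Omega> u \<le> c * (1 / k * (norm0 \<Omega> f + N))" using that by (simp add: field_simps)
    also have "\<dots> \<le> c * (bdry_norm0 \<Gamma> b + 1 / k * (norm0 \<Omega> f + bdry_norm1 \<Omega> \<Gamma> u0 + bdry_norm0 \<Gamma> u1
        + N))"
    proof (rule mult_left_mono[OF _ that(2)])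
      have "1 / k * (norm0 \<Omega> f + N) \<le> 1 / k * (norm0 \<Omega> f + bdry_norm1 \<Omega> \<Gamma> u0 + bdry_norm0 \<Gamma> u1 + N)"
        using that(1) bdry_norm1_nonneg[of \<Omega> \<Gamma> u0] L2_norm_nonneg[of "surface_measure \<Gamma>" u1]
        by (intro mult_left_mono) auto
      then show "1 / k * (norm0 \<Omega> f + N) \<le> bdry_norm0 \<Gamma> b + 1 / k * (norm0 \<Omega> f
          + bdry_norm1 \<Omega> \<Gamma> u0 + bdry_norm0 \<Gamma> u1 + N)"
        using L2_norm_nonneg[of "surface_measure \<Gamma>" b] by linarith
    qed
    finally show ?thesis .
  qed
  \<comment> \<open>The subspaces are built for the constant \<open>C\<close> of the first estimate,
    so they are fixed before any solution is considered.\<close>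
  obtain W :: "real \<Rightarrow> (real^'n \<Rightarrow> complex) set" where
    W: "\<And>k. k > 0 \<Longrightarrow> closed_subspace1 \<Omega> (W k)" "\<And>k k'. 0 < k \<Longrightarrow> k \<le> k' \<Longrightarrow> W k \<subseteq> W k'"
    "closure1 \<Omega> (\<Union>k\<in>{0<..}. W k) = sobolev 1 \<Omega>"
    "\<And>k u. k > 0 \<Longrightarrow> u \<in> sobolev 1 \<Omega> \<Longrightarrow> C * norm1 \<Omega> u \<le> 2 * C * dist1 (W k) u + k / 2 * norm0 \<Omega> u"
    by (rule approximating_family[OF C(1)], rule that)
  \<comment> \<open>Inserting \<open>W(4)\<close> into the first estimate leaves
    \<open>k / 2\<close> times \<open>norm0 \<Omega> u\<close> on the right. Subtracting it and
    doubling gives \<open>2 C\<close> at \<open>f\<close> and \<open>4 C\<close> at the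
    distance.\<close>
  have est: "k * norm0 \<Omega> u \<le> (4 * C) * (norm0 \<Omega> f + dist1 (W k) u)"
      if k: "k > 0" and s: "solves k f u" for k f u
  proof -
    have u: "u \<in> sobolev 1 \<Omega>" using s sobolev2_D(1)[OF assms(1)] by (simp only: solves_def)
    have "0 \<le> C * norm0 \<Omega> f" using C(1) by simp
    then show ?thesis using C(2)[OF k s] W(4)[OF k u] by (simp add: algebra_simps)
  qed
  show ?thesis
  proof (intro conjI impI)
    show "\<exists>C::real. \<forall>k>0. \<forall>f u0 u1. \<forall>u \<in> sobolev 2 \<Omega>.
        cauchy_problem \<Omega> \<Gamma> a2 a1 a a0 k f u0 u1 u \<longrightarrow>
        norm0 \<Omega> u \<le> C * (bdry_norm0 \<Gamma> (bdry_trace \<Omega> u) +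
          1 / k * (norm0 \<Omega> f + bdry_norm1 \<Omega> \<Gamma> u0 + bdry_norm0 \<Gamma> u1 + norm1 \<Omega> u))"
      by (intro exI[of _ C] allI ballI impI absorb C sol)
    show "\<exists>(H1 :: real \<Rightarrow> (real^'n \<Rightarrow> complex) set) (N1 :: real \<Rightarrow> (real^'n \<Rightarrow> complex) \<Rightarrow> real)
        (C::real).
          (\<forall>k>0. closed_subspace1 \<Omega> (H1 k)) \<and>
          (\<forall>k k'. 0 < k \<and> k \<le> k' \<longrightarrow> H1 k \<subseteq> H1 k') \<and>
          closure1 \<Omega> (\<Union>k\<in>{0<..}. H1 k) = sobolev 1 \<Omega> \<and>
          (\<forall>k>0. seminorm1 \<Omega> (N1 k)) \<and>
          (\<forall>k>0. \<forall>u \<in> H1 k. N1 k u = 0) \<and>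
          (\<forall>k k'. 0 < k \<and> k \<le> k' \<longrightarrow> (\<forall>u \<in> sobolev 1 \<Omega>. N1 k' u \<le> N1 k u)) \<and>
          (\<forall>k>0. \<forall>f u0 u1. \<forall>u \<in> sobolev 2 \<Omega>.
             cauchy_problem \<Omega> \<Gamma> a2 a1 a a0 k f u0 u1 u \<longrightarrow>
             norm0 \<Omega> u \<le> C * (bdry_norm0 \<Gamma> (bdry_trace \<Omega> u) +
               1 / k * (norm0 \<Omega> f + bdry_norm1 \<Omega> \<Gamma> u0 + bdry_norm0 \<Gamma> u1 + N1 k u)))"
    proof (intro exI[of _ W] exI[of _ "\<lambda>k. dist1 (W k)"] exI[of _ "4 * C"] conjI allI impI ballI)
      show "closed_subspace1 \<Omega> (W k)" if "0 < k" for k using W(1) that .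
      show "W k \<subseteq> W k'" if "0 < k \<and> k \<le> k'" for k k' using W(2) that by blast
      show "closure1 \<Omega> (\<Union>k\<in>{0<..}. W k) = sobolev 1 \<Omega>" by (rule W(3))
      show "seminorm1 \<Omega> (dist1 (W k))" if "0 < k" for k by (rule dist1_seminorm[OF W(1)[OF that]])
      show "dist1 (W k) u = 0" if "0 < k" "u \<in> W k" for k u
          by (rule dist1_zero[OF W(1)[OF that(1)] that(2)])
      show "dist1 (W k') u \<le> dist1 (W k) u" if "0 < k \<and> k \<le> k'" "u \<in> sobolev 1 \<Omega>" for k k' u
        using that by (intro dist1_antimono W) auto
      show "norm0 \<Omega> u \<le> 4 * C * (bdry_norm0 \<Gamma> (bdry_trace \<Omega> u) +
               1 / k * (norm0 \<Omega> f + bdry_norm1 \<Omega> \<Gamma> u0 + bdry_norm0 \<Gamma> u1 + dist1 (W k) u))"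
        if "0 < k" "u \<in> sobolev 2 \<Omega>" "cauchy_problem \<Omega> \<Gamma> a2 a1 a a0 k f u0 u1 u" for k f u0 u1 u
        by (rule absorb[OF that(1) _ est[OF that(1) sol[OF that(2,3)]]]) (use C(1) in simp)
    qed
  qed
qed

end
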